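(* Let $(\mathbf d,w)\in\mathbb N^m\times\mathbb R_{>0}^m$ be a normalized pair (i.e. $\sum_{i=1}^m d_i\ge n$ and $\sum_{i=1}^m w_i^2d_i=1$). Then: 1. The spectra (with multiplicities) of the frame operators of all global minimizers of the fusion frame potential $\mathrm{FFP}$ in $\mathcal B_{m,n}(\mathbf d,w)$ coincide. 2. The local minimizers of $\mathrm{FFP}$ in $\mathcal B_{m,n}(\mathbf d,w)$ with respect to the pseudo-distance $d_S$ lie in $\mathcal S_{m,n}(\mathbf d,w)$ and are also global minimizers of $\mathrm{FFP}$ in $\mathcal B_{m,n}(\mathbf d,w)$.
   Context: $P_W$ is the orthogonal projection onto $W$. $\mathcal B_{m,n}(\mathbf d,w)$ is the set of all $\mathcal W_w=(w_i,W_i)_{i=1}^m$ with the fixed weights $w$ and subspaces $W_i\subseteq\mathbb C^n$, $\dim W_i=d_i$. The frame operator is $S_{\mathcal W_w}=\sum_i w_i^2P_{W_i}$; $\mathcal S_{m,n}(\mathbf d,w)$ is the subset of those $\mathcal W_w\in\mathcal B_{m,n}(\mathbf d,w)$ which are fusion frames, i.e. with $S_{\mathcal W_w}$ invertible. $\mathrm{FFP}(\mathcal W_w)=\sum_{i,j}w_i^2w_j^2\operatorname{tr}(P_{W_i}P_{W_j})=\operatorname{tr}(S_{\mathcal W_w}^2)$. The operatorial pseudo-distance is $d_S(\mathcal W_w,\mathcal W'_w)=\|S_{\mathcal W_w}-S_{\mathcal W'_w}\|$ (spectral norm). *)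

theory Defs
  imports "HOL-Analysis.Analysis" "HOL-Computational_Algebra.Computational_Algebra"
begin

definition cinner :: "complex ^ 'n \<Rightarrow> complex ^ 'n \<Rightarrow> complex" where
  "cinner x y = (\<Sum>i\<in>UNIV. x $ i * cnj (y $ i))"

definition is_orth_proj :: "(complex ^ 'n) set \<Rightarrow> complex ^ 'n ^ 'n \<Rightarrow> bool" where
  "is_orth_proj W P \<longleftrightarrow>
     (\<forall>x. P *v x \<in> W \<and> (\<forall>y\<in>W. cinner (x - P *v x) y = 0))"

lemma inner_eq_Re_cinner: "x \<bullet> y = Re (cinner x y)"
  by (simp add: inner_vec_def cinner_def inner_complex_def)

lemma cinner_self_eq_0: "cinner x x = 0 \<Longrightarrow> x = 0"
  using inner_eq_Re_cinner[of x x] by simp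

lemma cinner_diff_left: "cinner (x - y) z = cinner x z - cinner y z"
  by (simp add: cinner_def algebra_simps sum_subtractf)

lemma cinner_add_left: "cinner (x + y) z = cinner x z + cinner y z"
  by (simp add: cinner_def algebra_simps sum.distrib)

lemma cinner_scale_left: "cinner (c *s x) z = c * cinner x z"
  by (simp add: cinner_def algebra_simps sum_distrib_left)

lemma cinner_scale_right: "cinner x (c *s z) = cnj c * cinner x z"
  by (simp add: cinner_def algebra_simps sum_distrib_left)

lemma orth_comp_unique:
  assumes "vec.subspace W" "p \<in> W" "q \<in> W"
    "\<forall>y\<in>W. cinner (x - p) y = 0" "\<forall>y\<in>W. cinner (x - q) y = 0"
  shows "p = q"
proof -
  have "p - q \<in> W" using assms vec.subspace_diff by blast
  then have "cinner (x - q) (p - q) = 0" "cinner (x - p) (p - q) = 0" using assms by auto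
  then have "cinner (p - q) (p - q) = 0" by (simp add: cinner_diff_left)
  then show ?thesis using cinner_self_eq_0 by fastforce
qed

lemma ex1_orth_proj:
  fixes W :: "(complex ^ 'n) set"
  assumes W: "vec.subspace W"
  shows "\<exists>!P. is_orth_proj W P"
proof -
  have "(\<chi> i. complex_of_real c * x $ i) \<in> W" if "x \<in> W" for c x
    using vec.subspace_scale[OF W that, of "complex_of_real c"] by (simp add: vector_scalar_mult_def)
  moreover have "(\<chi> i. complex_of_real c * x $ i) = c *\<^sub>R x" for c and x :: "complex ^ 'n"
    by (simp add: vec_eq_iff) (simp add: scaleR_conv_of_real)
  ultimately have sub: "subspace W"
    using W by (auto simp: subspace_def vec.subspace_def)
  have "\<exists>p\<in>W. \<forall>y\<in>W. cinner (x - p) y = 0" for x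
  proof -
    obtain p z where p: "p \<in> span W" "\<And>w. w \<in> span W \<Longrightarrow> orthogonal z w" "x = p + z"
      using orthogonal_subspace_decomp_exists[of W x] by metis
    have pW: "p \<in> W" using p(1) span_minimal[OF subset_refl sub] by blast
    have re: "Re (cinner z y) = 0" if "y \<in> W" for y
      using p(2)[of y] that inner_eq_Re_cinner[of z y] by (simp add: orthogonal_def span_base)
    have "cinner z y = 0" if "y \<in> W" for y
    proof -
      have "\<i> *s y \<in> W" using W that by (rule vec.subspace_scale)
      then have "Im (cinner z y) = 0" using re[of "\<i> *s y"] by (simp add: cinner_scale_right)
      then show ?thesis using re[OF that] by (simp add: complex_eq_iff)
    qed
    then show ?thesis using pW p(3) by (intro bexI[of _ p]) auto
  qed
  then obtain p where p: "\<And>x. p x \<in> W" "\<And>x y. y \<in> W \<Longrightarrow> cinner (x - p x) y = 0" by metis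
  have "Vector_Spaces.linear (*s) (*s) p"
  proof (rule Vector_Spaces.linear_iff[THEN iffD2], intro conjI allI)
    fix x y
    show "p (x + y) = p x + p y"
    proof (rule orth_comp_unique[OF W, of _ _ "x + y"])
      show "\<forall>z\<in>W. cinner (x + y - (p x + p y)) z = 0"
        using p(2) by (simp add: add_diff_add cinner_add_left)
    qed (simp_all add: p vec.subspace_add[OF W])
  next
    fix c x
    show "p (c *s x) = c *s p x"
    proof (rule orth_comp_unique[OF W, of _ _ "c *s x"])
      show "\<forall>z\<in>W. cinner (c *s x - c *s p x) z = 0"
        using p(2)[of _ x] unfolding vec.scale_right_diff_distrib[symmetric] cinner_scale_left by simp
    qed (simp_all add: p vec.subspace_scale[OF W])
  qed (rule vec.vector_space_axioms)+
  then have m: "matrix p *v x = p x" for x by (rule matrix_works)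
  show ?thesis
  proof (rule ex1I[of _ "matrix p"])
    show "is_orth_proj W (matrix p)" using p by (simp add: is_orth_proj_def m)
  next
    fix Q assume Q: "is_orth_proj W Q"
    have "Q *v x = matrix p *v x" for x
      using orth_comp_unique[OF W, of "Q *v x" "p x" x] Q p by (auto simp: is_orth_proj_def m)
    then show "Q = matrix p" by (simp add: matrix_eq)
  qed
qed

text \<open>Well-defined on complex subspaces by \<open>ex1_orth_proj\<close>.\<close>

definition orth_proj :: "(complex ^ 'n) set \<Rightarrow> complex ^ 'n ^ 'n" where
  "orth_proj W = (THE P. is_orth_proj W P)"

definition normalized_pair :: "'n::finite itself \<Rightarrow> ('m::finite \<Rightarrow> nat) \<Rightarrow> ('m \<Rightarrow> real) \<Rightarrow> bool" where
  "normalized_pair _ d w \<longleftrightarrow>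
     (\<forall>i. w i > 0) \<and> CARD('n) \<le> (\<Sum>i\<in>UNIV. d i) \<and> (\<Sum>i\<in>UNIV. (w i)\<^sup>2 * real (d i)) = 1"

text \<open>The weights \<open>w\<close> are fixed, so a weighted family \<open>(w\<^sub>i, W\<^sub>i)\<close> is represented by the
  family of subspaces \<open>W\<close> alone, and \<open>w\<close> is passed as a parameter.
  Subspaces and dimensions (\<open>vec.subspace\<close>, \<open>vec.dim\<close>) are over the complex field.\<close>

definition subspace_families :: "('m::finite \<Rightarrow> nat) \<Rightarrow> ('m \<Rightarrow> (complex ^ 'n) set) set" where
  "subspace_families d = {W. \<forall>i. vec.subspace (W i) \<and> vec.dim (W i) = d i}"

definition frame_op :: "('m::finite \<Rightarrow> real) \<Rightarrow> ('m \<Rightarrow> (complex ^ 'n) set) \<Rightarrow> complex ^ 'n ^ 'n" where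
  "frame_op w W = (\<Sum>i\<in>UNIV. (w i)\<^sup>2 *\<^sub>R orth_proj (W i))"

definition fusion_frames ::
    "('m::finite \<Rightarrow> nat) \<Rightarrow> ('m \<Rightarrow> real) \<Rightarrow> ('m \<Rightarrow> (complex ^ 'n) set) set" where
  "fusion_frames d w = {W \<in> subspace_families d. invertible (frame_op w W)}"

text \<open>The traces below are real, as traces of products of two orthogonal projections.\<close>

definition ffp :: "('m::finite \<Rightarrow> real) \<Rightarrow> ('m \<Rightarrow> (complex ^ 'n) set) \<Rightarrow> real" where
  "ffp w W = (\<Sum>i\<in>UNIV. \<Sum>j\<in>UNIV.
     (w i)\<^sup>2 * (w j)\<^sup>2 * Re (trace (orth_proj (W i) ** orth_proj (W j))))"

text \<open>The norm on \<open>complex ^ 'n\<close> is the Euclidean one, so \<open>onorm\<close> is the spectral norm.\<close>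

definition dist_S ::
    "('m::finite \<Rightarrow> real) \<Rightarrow> ('m \<Rightarrow> (complex ^ 'n) set) \<Rightarrow> ('m \<Rightarrow> (complex ^ 'n) set) \<Rightarrow> real" where
  "dist_S w W V = onorm (\<lambda>x. (frame_op w W - frame_op w V) *v x)"

definition charpoly :: "complex ^ 'n ^ 'n \<Rightarrow> complex poly" where
  "charpoly A = det (mat [:0, 1:] - (\<chi> i j. [:A $ i $ j:]))"

definition spectrum_mset :: "complex ^ 'n ^ 'n \<Rightarrow> complex multiset" where
  "spectrum_mset A = proots (charpoly A)"

definition global_minimizer ::
    "('m::finite \<Rightarrow> nat) \<Rightarrow> ('m \<Rightarrow> real) \<Rightarrow> ('m \<Rightarrow> (complex ^ 'n) set) \<Rightarrow> bool" where
  "global_minimizer d w W \<longleftrightarrow> is_arg_min (ffp w) (\<lambda>V. V \<in> subspace_families d) W"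

definition local_minimizer ::
    "('m::finite \<Rightarrow> nat) \<Rightarrow> ('m \<Rightarrow> real) \<Rightarrow> ('m \<Rightarrow> (complex ^ 'n) set) \<Rightarrow> bool" where
  "local_minimizer d w W \<longleftrightarrow> W \<in> subspace_families d \<and>
     (\<exists>\<epsilon>>0. \<forall>V\<in>subspace_families d. dist_S w W V < \<epsilon> \<longrightarrow> ffp w W \<le> ffp w V)"

end

theory Submission
  imports Defs
begin

text \<open>
  Write \<open>S\<^sub>W\<close> for the frame operator of \<open>W\<close>, so that the potential of \<open>W\<close> is the squared Frobenius norm
  \<open>\<parallel>S\<^sub>W\<parallel>\<^sup>2\<close>. Everything follows from one comparison (\<open>local_minimizer_comparison\<close>): if \<open>W\<close> is a
  local minimizer, then every family \<open>V\<close> with the same dimensions admits a unitary \<open>U\<close> with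
  \<open>\<parallel>S\<^sub>W\<parallel>\<^sup>2 \<le> \<langle>S\<^sub>V, U S\<^sub>W U\<^sup>*\<rangle>\<close>. Expanding the square turns this into
  \<open>\<parallel>S\<^sub>V - U S\<^sub>W U\<^sup>*\<parallel>\<^sup>2 \<le> FFP(V) - FFP(W)\<close>: hence \<open>W\<close> is a global minimizer, and if \<open>V\<close> has the same
  potential then \<open>S\<^sub>V\<close> and \<open>S\<^sub>W\<close> are unitarily similar.

  For the comparison, move each \<open>W\<^sub>i\<close> to the graph of \<open>t T\<^sub>i\<close>, where \<open>T\<^sub>i\<close> maps \<open>W\<^sub>i\<close> to its orthogonal
  complement. Stationarity of the potential says that \<open>S\<^sub>W\<close> commutes with the projections onto the
  \<open>W\<^sub>i\<close>, so the \<open>W\<^sub>i\<close> split along the eigenspaces of \<open>S\<^sub>W\<close>. If the \<open>T\<^sub>i\<close> map eigenspaces of larger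
  eigenvalues to eigenspaces of smaller ones and \<open>\<Sum> w\<^sub>i\<^sup>2 T\<^sub>i = 0\<close>, then the first variation of
  \<open>S\<^sub>W\<close> is zero and the second variation of the potential is negative unless all \<open>T\<^sub>i\<close> vanish;
  so there are no such relations. Dually, every infinitesimal motion of the family \<open>W\<close> is the
  sum of a motion of the whole space and of motions of the single \<open>W\<^sub>i\<close> that respect the filtration
  of the space by sums of eigenspaces with large eigenvalues (\<open>lowering_surjective\<close>).

  In other words, the polynomial map \<open>(X, N\<^sub>i, H\<^sub>i) \<mapsto> (X N\<^sub>i H\<^sub>i)\<^sub>i\<close>, with \<open>N\<^sub>i\<close> respecting the filtration
  on \<open>W\<^sub>i\<close> and \<open>H\<^sub>i\<close> preserving \<open>W\<^sub>i\<close>, has a surjective derivative at the identity. A polynomial map of a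
  complex vector space to itself with this property at one point has dense range
  (\<open>polynomial_map_dense_range\<close>). This is the step from local to global information: every
  family \<open>V\<close> is a limit of families \<open>X N\<^sub>i W\<^sub>i\<close>. For these, \<open>X\<close> carries the filtration to a flag
  whose members meet \<open>X N\<^sub>i W\<^sub>i\<close> in at least the dimension in which the members of the original
  filtration meet \<open>W\<^sub>i\<close>. This bounds traces of the frame operator against the projections onto the
  flag from below, and summing over the flag gives the comparison, with \<open>U\<close> the unitary part of \<open>X\<close>
  (\<open>factored_family_inequality\<close>). Compactness of the unitary group handles the limit.

  A nonzero kernel vector \<open>k\<close> of \<open>S\<^sub>W\<close> would make every rank one map \<open>x \<mapsto> \<langle>x, x\<^sub>i\<rangle> k\<close> with \<open>x\<^sub>i \<in> W\<^sub>i\<close>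
  lower eigenvalues; the absence of relations then forces the \<open>W\<^sub>i\<close> to be independent subspaces
  of a proper subspace, which contradicts \<open>\<Sum> d\<^sub>i \<ge> n\<close> (\<open>local_minimizer_invertible\<close>).
\<close>

no_notation fps_nth (infixl "$" 75)


section \<open>Complex matrices and their Frobenius geometry\<close>

lemma matrix_add_rdistrib: "(B + C) ** A = B ** A + C ** (A :: 'a::comm_ring_1 ^ 'n ^ 'n)"
  by (simp add: matrix_matrix_mult_def vec_eq_iff algebra_simps sum.distrib)

lemma matrix_diff_ldistrib: "A ** (B - C) = A ** B - A ** (C :: 'a::comm_ring_1 ^ 'n ^ 'n)"
  by (simp add: matrix_matrix_mult_def vec_eq_iff algebra_simps sum_subtractf)

lemma matrix_diff_rdistrib: "(B - C) ** A = B ** A - C ** (A :: 'a::comm_ring_1 ^ 'n ^ 'n)"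
  by (simp add: matrix_matrix_mult_def vec_eq_iff algebra_simps sum_subtractf)

lemma matrix_uminus_left: "(- A) ** B = - (A ** (B :: 'a::comm_ring_1 ^ 'n ^ 'n))"
  by (simp add: matrix_matrix_mult_def vec_eq_iff sum_negf)

lemma matrix_uminus_right: "A ** (- B) = - (A ** (B :: 'a::comm_ring_1 ^ 'n ^ 'n))"
  by (simp add: matrix_matrix_mult_def vec_eq_iff sum_negf)

lemma matrix_scaleR_left: "(c *\<^sub>R A) ** B = c *\<^sub>R (A ** (B :: complex ^ 'n ^ 'n))"
  by (simp add: matrix_matrix_mult_def vec_eq_iff scaleR_sum_right)

lemma matrix_scaleR_right: "A ** (c *\<^sub>R B) = c *\<^sub>R (A ** (B :: complex ^ 'n ^ 'n))"
  by (simp add: matrix_matrix_mult_def vec_eq_iff scaleR_sum_right)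

lemma matrix_zero_left: "0 ** A = (0 :: complex ^ 'n ^ 'n)"
  by (simp add: matrix_matrix_mult_def vec_eq_iff)

lemma matrix_zero_right: "A ** 0 = (0 :: complex ^ 'n ^ 'n)"
  by (simp add: matrix_matrix_mult_def vec_eq_iff)

lemma matrix_sum_left: "(\<Sum>i\<in>I. f i) ** A = (\<Sum>i\<in>I. f i ** (A :: complex ^ 'n ^ 'n))"
  by (induction I rule: infinite_finite_induct) (simp_all add: matrix_zero_left matrix_add_rdistrib)

lemma matrix_sum_right: "A ** (\<Sum>i\<in>I. f i) = (\<Sum>i\<in>I. (A :: complex ^ 'n ^ 'n) ** f i)"
  by (induction I rule: infinite_finite_induct) (simp_all add: matrix_zero_right matrix_add_ldistrib)

lemmas matrix_algebra = matrix_add_ldistrib matrix_add_rdistrib matrix_diff_ldistrib matrix_diff_rdistrib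
  matrix_scaleR_left matrix_scaleR_right matrix_zero_left matrix_zero_right
  matrix_uminus_left matrix_uminus_right matrix_mul_assoc[symmetric]

lemma scaleR_matrix_vector: "(c *\<^sub>R A) *v x = c *\<^sub>R (A *v (x :: complex ^ 'n))"
  by (simp add: matrix_vector_mult_def vec_eq_iff scaleR_sum_right)

text \<open>The conjugate transpose, which is the adjoint for \<open>cinner\<close> (\<open>cinner_adj\<close>).\<close>

definition adj :: "complex ^ 'n ^ 'n \<Rightarrow> complex ^ 'n ^ 'n" where
  "adj A = (\<chi> i j. cnj (A $ j $ i))"

lemma adj_nth [simp]: "adj A $ i $ j = cnj (A $ j $ i)" by (simp add: adj_def)
lemma adj_adj [simp]: "adj (adj A) = A" by (simp add: vec_eq_iff)
lemma adj_add: "adj (A + B) = adj A + adj B" by (simp add: vec_eq_iff)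
lemma adj_diff: "adj (A - B) = adj A - adj B" by (simp add: vec_eq_iff)
lemma adj_uminus: "adj (- A) = - adj A" by (simp add: vec_eq_iff)
lemma adj_scaleR: "adj (c *\<^sub>R A) = c *\<^sub>R adj A" by (simp add: vec_eq_iff)
lemma adj_zero [simp]: "adj 0 = 0" by (simp add: vec_eq_iff)
lemma adj_mat_1 [simp]: "adj (mat 1) = mat 1" by (simp add: vec_eq_iff mat_def)
lemma adj_mult: "adj (A ** B) = adj B ** adj A"
  by (simp add: vec_eq_iff matrix_matrix_mult_def mult.commute)
lemma adj_sum: "adj (\<Sum>i\<in>I. f i) = (\<Sum>i\<in>I. adj (f i))"
  by (induction I rule: infinite_finite_induct) (simp_all add: adj_add)

lemma cinner_adj: "cinner (A *v x) y = cinner x (adj A *v y)"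
proof -
  have "cinner (A *v x) y = (\<Sum>i\<in>UNIV. \<Sum>j\<in>UNIV. A $ i $ j * x $ j * cnj (y $ i))"
    by (simp add: cinner_def matrix_vector_mult_def sum_distrib_right)
  also have "\<dots> = (\<Sum>j\<in>UNIV. \<Sum>i\<in>UNIV. A $ i $ j * x $ j * cnj (y $ i))" by (rule sum.swap)
  also have "\<dots> = cinner x (adj A *v y)"
    by (simp add: cinner_def matrix_vector_mult_def sum_distrib_left ac_simps)
  finally show ?thesis .
qed

lemma cinner_commute: "cinner x y = cnj (cinner y x)"
  by (simp add: cinner_def mult.commute)

lemma trace_cyclic: "trace (A ** B) = trace (B ** (A :: complex ^ 'n ^ 'n))"
  unfolding trace_def matrix_matrix_mult_def
  by (simp, subst sum.swap, simp add: mult.commute)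

lemma trace_diff: "trace (A - B) = trace A - trace (B :: complex ^ 'n ^ 'n)"
  by (simp add: trace_def sum_subtractf)
lemma trace_sum: "trace (\<Sum>i\<in>I. f i) = (\<Sum>i\<in>I. trace (f i :: complex ^ 'n ^ 'n))"
  unfolding trace_def sum_component by (rule sum.swap)

text \<open>The real inner product of \<open>complex ^ 'n ^ 'n\<close> is the real part of the Frobenius product, so that
  traces of products can be handled as inner products and norms.\<close>

lemma inner_matrix: "A \<bullet> B = Re (trace (A ** adj B))"
  by (simp add: inner_vec_def trace_def matrix_matrix_mult_def inner_complex_def)

lemma inner_matrix_herm: "adj B = B \<Longrightarrow> A \<bullet> B = Re (trace (A ** B))"
  by (simp add: inner_matrix)

lemma inner_mult_left: "(A ** B) \<bullet> (C :: complex ^ 'n ^ 'n) = B \<bullet> (adj A ** C)"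
  using trace_cyclic[of A "B ** adj C"] by (simp add: inner_matrix adj_mult matrix_mul_assoc)

lemma inner_mult_right: "(A ** B) \<bullet> (C :: complex ^ 'n ^ 'n) = A \<bullet> (C ** adj B)"
  unfolding inner_matrix adj_mult adj_adj by (simp add: matrix_mul_assoc)

lemma inner_adj: "adj A \<bullet> adj B = A \<bullet> B"
  by (simp add: inner_vec_def inner_complex_def) (subst sum.swap, simp)

lemma norm_matrix_vector_le: "norm (A *v x) \<le> norm A * norm (x :: complex ^ 'n)"
proof -
  have "norm ((A *v x) $ i) \<le> norm (A $ i) * norm x" for i
  proof -
    have "norm ((A *v x) $ i) \<le> (\<Sum>j\<in>UNIV. \<bar>norm (A $ i $ j)\<bar> * \<bar>norm (x $ j)\<bar>)"
      unfolding matrix_vector_mult_def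
      using norm_sum[of "\<lambda>j. A $ i $ j * x $ j" UNIV] by (simp add: norm_mult)
    also have "\<dots> \<le> norm (A $ i) * norm x"
      unfolding norm_vec_def by (rule L2_set_mult_ineq)
    finally show ?thesis .
  qed
  then have "norm (A *v x) \<le> L2_set (\<lambda>i. norm (A $ i) * norm x) UNIV"
    unfolding norm_vec_def[of "A *v x"] by (intro L2_set_mono) auto
  also have "\<dots> = norm A * norm x"
    by (simp add: norm_vec_def[of A] L2_set_left_distrib)
  finally show ?thesis .
qed

lemma norm_adj: "norm (adj A) = norm A"
  using inner_adj[of A A] by (simp add: norm_eq_sqrt_inner)

text \<open>By Cauchy--Schwarz in every row: row \<open>i\<close> of \<open>A ** B\<close> is, up to conjugation, the adjoint
  of \<open>B\<close> applied to row \<open>i\<close> of \<open>A\<close>.\<close>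

lemma norm_matrix_mult_le: "norm (A ** B) \<le> norm A * norm (B :: complex ^ 'n ^ 'n)"
proof -
  have "norm ((A ** B) $ i) \<le> norm (A $ i) * norm B" for i
  proof -
    have "norm ((A ** B) $ i) = norm (adj B *v (\<chi> j. cnj (A $ i $ j)))"
      unfolding norm_vec_def
      by (rule arg_cong2[where f = L2_set, OF ext refl])
        (simp add: matrix_matrix_mult_def matrix_vector_mult_def mult.commute flip: complex_cnj_mult cnj_sum)
    also have "\<dots> \<le> norm (adj B) * norm (\<chi> j. cnj (A $ i $ j))" by (rule norm_matrix_vector_le)
    also have "norm (\<chi> j. cnj (A $ i $ j)) = norm (A $ i)" by (simp add: norm_vec_def)
    finally show ?thesis by (simp add: norm_adj mult.commute)
  qed
  then have "norm (A ** B) \<le> L2_set (\<lambda>i. norm (A $ i) * norm B) UNIV"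
    unfolding norm_vec_def[of "A ** B"] by (intro L2_set_mono) auto
  also have "\<dots> = norm A * norm B"
    by (simp add: norm_vec_def[of A] L2_set_left_distrib)
  finally show ?thesis .
qed

lemma bounded_bilinear_matrix_mult: "bounded_bilinear ((**) :: complex ^ 'n ^ 'n \<Rightarrow> complex ^ 'n ^ 'n \<Rightarrow> _)"
  by (rule bounded_bilinear.intro)
    (auto simp: matrix_algebra intro!: exI[of _ 1] norm_matrix_mult_le)

lemmas tendsto_matrix_mult = bounded_bilinear.tendsto[OF bounded_bilinear_matrix_mult]

lemma tendsto_adj: "(f \<longlongrightarrow> A) F \<Longrightarrow> ((\<lambda>x. adj (f x)) \<longlongrightarrow> adj A) F"
  unfolding adj_def by (intro tendsto_vec_lambda tendsto_cnj tendsto_vec_nth)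

lemma matrix_invertible_if_injective:
  fixes A :: "complex ^ 'n ^ 'n"
  assumes "\<And>x. A *v x = 0 \<Longrightarrow> x = 0"
  shows "invertible A"
  using assms matrix_left_invertible_ker[of A] invertible_left_inverse[of A] by blast


lemma invertible_mult_factors:
  fixes A B :: "complex ^ 'n ^ 'n"
  assumes "invertible (A ** B)" shows "invertible A" "invertible B"
proof -
  obtain C where "A ** B ** C = mat 1" "C ** (A ** B) = mat 1" using assms by (auto simp: invertible_def)
  then have "A ** (B ** C) = mat 1" "(C ** A) ** B = mat 1" by (simp_all add: matrix_mul_assoc)
  then show "invertible A" "invertible B"
    using invertible_right_inverse[of A] invertible_left_inverse[of B] by blast+
qed

section \<open>Orthogonal projections and frame operators\<close>

definition proj :: "complex ^ 'n ^ 'n \<Rightarrow> bool" where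
  "proj P \<longleftrightarrow> adj P = P \<and> P ** P = P"

lemma orth_proj_eqI:
  assumes W: "vec.subspace W" and P: "adj P = P" "\<And>x. P *v x \<in> W" "\<And>y. y \<in> W \<Longrightarrow> P *v y = y"
  shows "orth_proj W = P"
proof -
  have "is_orth_proj W P"
    unfolding is_orth_proj_def
  proof (intro allI conjI ballI)
    fix x y assume y: "y \<in> W"
    have "cinner (x - P *v x) y = cinner (x - P *v x) (adj P *v y)" using P(1,3) y by simp
    also have "\<dots> = cinner (P *v (x - P *v x)) y" by (rule cinner_adj[symmetric])
    also have "P *v (x - P *v x) = 0" using P(2,3) by (simp add: matrix_vector_mult_diff_distrib)
    finally show "cinner (x - P *v x) y = 0" by (simp add: cinner_def)
  qed (rule P)
  then show ?thesis unfolding orth_proj_def using ex1_orth_proj[OF W] by (rule the1_equality[rotated])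
qed

lemma orth_proj_props:
  assumes W: "vec.subspace W"
  shows orth_proj_in: "orth_proj W *v x \<in> W"
    and orth_proj_fix: "y \<in> W \<Longrightarrow> orth_proj W *v y = y"
    and adj_orth_proj: "adj (orth_proj W) = orth_proj W"
    and orth_proj_idem: "orth_proj W ** orth_proj W = orth_proj W"
proof -
  let ?P = "orth_proj W"
  have P: "is_orth_proj W ?P"
    unfolding orth_proj_def using ex1_orth_proj[OF W] by (rule theI')
  show in_W: "?P *v x \<in> W" for x using P by (simp add: is_orth_proj_def)
  have orth: "cinner (x - ?P *v x) y = 0" if "y \<in> W" for x y
    using P that by (simp add: is_orth_proj_def)
  show fix_W: "?P *v y = y" if "y \<in> W" for y
    using orth_comp_unique[OF W in_W that, of y y] orth by (simp add: cinner_def)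
  have "?P ** ?P *v x = ?P *v x" for x using fix_W in_W by (simp flip: matrix_vector_mul_assoc)
  then show "?P ** ?P = ?P" by (simp add: matrix_eq)
  have sym: "cinner (?P *v x) y = cinner x (?P *v y)" for x y
  proof -
    have "cinner x (?P *v y) = cinner (?P *v x) (?P *v y)"
      using orth[OF in_W, of x y] by (simp add: cinner_diff_left)
    moreover have "cinner y (?P *v x) = cinner (?P *v y) (?P *v x)"
      using orth[OF in_W, of y x] by (simp add: cinner_diff_left)
    ultimately show ?thesis using cinner_commute by metis
  qed
  show "adj ?P = ?P"
  proof (rule matrix_eq[THEN iffD2], rule allI)
    fix y
    have "cinner x (adj ?P *v y - ?P *v y) = 0" for x
      using sym[of x y] cinner_adj[of ?P x y]
      by (metis cinner_commute cinner_diff_left complex_cnj_zero right_minus_eq)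
    then show "adj ?P *v y = ?P *v y" using cinner_self_eq_0 by (metis right_minus_eq)
  qed
qed


lemma subspace_image: "vec.subspace W \<Longrightarrow> vec.subspace ((*v) G ` W)"
  for W :: "(complex ^ 'n) set"
  by (rule vec.subspace_image)

lemma dim_image_invertible:
  fixes W :: "(complex ^ 'n) set" and G :: "complex ^ 'n ^ 'n"
  assumes "invertible G"
  shows "vec.dim ((*v) G ` W) = vec.dim W"
  by (rule vec.dim_image_eq) (use assms in \<open>auto intro: inj_on_subset[OF inj_matrix_vector_mult]\<close>)

text \<open>The hypotheses hold for two idempotents with a common range; this compares traces of orthogonal projections
  without computing dimensions.\<close>

lemma trace_eq_same_range:
  fixes A B :: "complex ^ 'n ^ 'n"
  assumes "A ** B = B" "B ** A = A" shows "trace A = trace B"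
  using trace_cyclic[of A B] assms by simp

text \<open>The oblique projection \<open>G ** P ** G\<^sup>-\<^sup>1\<close> has the same range as the orthogonal projection
  onto the image and, being similar to \<open>P\<close>, the same trace as \<open>P\<close>.\<close>

lemma trace_orth_proj_image:
  fixes G :: "complex ^ 'n ^ 'n"
  assumes W: "vec.subspace W" and G: "invertible G"
  shows "trace (orth_proj ((*v) G ` W)) = trace (orth_proj W)"
proof -
  let ?P = "orth_proj W" and ?Q = "orth_proj ((*v) G ` W)"
  have V: "vec.subspace ((*v) G ` W)" using W by (rule subspace_image)
  obtain H where H: "G ** H = mat 1" "H ** G = mat 1" using G by (auto simp: invertible_def)
  let ?A = "G ** ?P ** H"
  have "?Q ** ?A = ?A"
  proof (rule matrix_eq[THEN iffD2], rule allI)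
    fix x
    have "?A *v x = G *v (?P *v (H *v x))" by (simp flip: matrix_vector_mul_assoc)
    then have "?A *v x \<in> (*v) G ` W" using orth_proj_in[OF W] by auto
    then show "(?Q ** ?A) *v x = ?A *v x"
      using orth_proj_fix[OF V] by (simp flip: matrix_vector_mul_assoc)
  qed
  moreover have "?A ** ?Q = ?Q"
  proof (rule matrix_eq[THEN iffD2], rule allI)
    fix x
    obtain u where u: "u \<in> W" "?Q *v x = G *v u" using orth_proj_in[OF V, of x] by auto
    have "?A *v (G *v u) = G *v (?P *v ((H ** G) *v u))" by (simp add: matrix_vector_mul_assoc matrix_mul_assoc)
    also have "\<dots> = G *v u" using orth_proj_fix[OF W u(1)] by (simp add: H)
    finally show "(?A ** ?Q) *v x = ?Q *v x" using u(2) by (simp flip: matrix_vector_mul_assoc)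
  qed
  ultimately have "trace ?Q = trace ?A" by (intro trace_eq_same_range)
  also have "\<dots> = trace (H ** (G ** ?P))" using trace_cyclic[of "G ** ?P" H] by simp
  also have "\<dots> = trace ?P" by (simp add: matrix_mul_assoc H)
  finally show ?thesis .
qed

lemma adj_frame_op:
  assumes "\<And>i. vec.subspace (W i)" shows "adj (frame_op w W) = frame_op w W"
  by (simp add: frame_op_def adj_sum adj_scaleR adj_orth_proj[OF assms])

lemma ffp_eq_inner:
  assumes W: "\<And>i. vec.subspace (W i)"
  shows "ffp w W = frame_op w W \<bullet> frame_op w W"
proof -
  have "frame_op w W \<bullet> frame_op w W = (\<Sum>i\<in>UNIV. \<Sum>j\<in>UNIV.
      (w i)\<^sup>2 * ((w j)\<^sup>2 * (orth_proj (W i) \<bullet> orth_proj (W j))))"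
    unfolding frame_op_def inner_sum_left inner_sum_right
    by (subst sum.swap) (simp add: sum_distrib_left ac_simps inner_commute)
  then show ?thesis by (simp add: ffp_def inner_matrix_herm[OF adj_orth_proj[OF W]] mult.assoc)
qed

lemma dist_S_le: "dist_S w W V \<le> norm (frame_op w W - frame_op w V)"
  unfolding dist_S_def by (rule onorm_le) (rule norm_matrix_vector_le)


section \<open>Diagonalization, triangular factorization and traces against flags\<close>

lemma cinner_self: "cinner x x = complex_of_real ((norm x)\<^sup>2)"
  using inner_eq_Re_cinner[of x x] cinner_commute[of x x]
  by (simp add: complex_eq_iff power2_norm_eq_inner)

lemma matrix_vector_scaleR: "A *v (c *\<^sub>R x) = c *\<^sub>R (A *v (x :: complex ^ 'n))"
  by (simp add: matrix_vector_mult_def vec_eq_iff scaleR_sum_right)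

lemma matrix_vector_axis: "A *v axis k 1 = column k (A :: complex ^ 'n ^ 'n)"
proof -
  have "(A *v axis k 1) $ i = (\<Sum>j\<in>UNIV. if j = k then A $ i $ k else 0)" for i
    unfolding matrix_vector_mult_def axis_def vec_lambda_beta by (rule sum.cong) auto
  then show ?thesis by (simp add: vec_eq_iff column_def)
qed

lemma orth_proj_orth:
  assumes "vec.subspace W" "y \<in> W"
  shows "cinner (x - orth_proj W *v x) y = 0"
proof -
  have "cinner (x - orth_proj W *v x) y = cinner (x - orth_proj W *v x) (adj (orth_proj W) *v y)"
    by (simp add: adj_orth_proj orth_proj_fix assms)
  also have "\<dots> = cinner (orth_proj W *v (x - orth_proj W *v x)) y" by (rule cinner_adj[symmetric])
  also have "orth_proj W *v (x - orth_proj W *v x) = 0"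
    by (simp add: matrix_vector_mult_diff_distrib matrix_vector_mul_assoc orth_proj_idem assms)
  finally show ?thesis by (simp add: cinner_def)
qed

definition diag_mat :: "('n \<Rightarrow> real) \<Rightarrow> complex ^ 'n ^ 'n" where
  "diag_mat f = (\<chi> i j. if i = j then complex_of_real (f i) else 0)"

lemma diag_mat_mult_left: "(diag_mat f ** A) $ i $ j = complex_of_real (f i) * A $ i $ j"
proof -
  have "(diag_mat f ** A) $ i $ j = (\<Sum>k\<in>UNIV. if k = i then complex_of_real (f i) * A $ i $ j else 0)"
    unfolding matrix_matrix_mult_def diag_mat_def vec_lambda_beta by (rule sum.cong) auto
  then show ?thesis by simp
qed

lemma diag_mat_mult_right: "(A ** diag_mat f) $ i $ j = A $ i $ j * complex_of_real (f j)"
proof -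
  have "(A ** diag_mat f) $ i $ j = (\<Sum>k\<in>UNIV. if k = j then A $ i $ j * complex_of_real (f j) else 0)"
    unfolding matrix_matrix_mult_def diag_mat_def vec_lambda_beta by (rule sum.cong) auto
  then show ?thesis by simp
qed

lemma adj_diag_mat [simp]: "adj (diag_mat f) = diag_mat f"
  by (simp add: vec_eq_iff diag_mat_def)

lemma trace_mult_diag_mat: "trace (A ** diag_mat f) = (\<Sum>a\<in>UNIV. A $ a $ a * complex_of_real (f a))"
  by (simp add: trace_def diag_mat_mult_right)

text \<open>A maximizer of the quadratic form of \<open>S\<close> on the unit sphere of \<open>W\<close>: the form of
  \<open>\<mu> - S\<close> is nonnegative on \<open>W\<close> and vanishes at the maximizer \<open>x\<close>, so the residual
  \<open>\<mu> x - S x\<close> is orthogonal to itself.\<close>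

lemma hermitian_eigenvector_in_subspace:
  fixes S :: "complex ^ 'n ^ 'n"
  assumes S: "adj S = S" and W: "vec.subspace W" and inv: "\<And>x. x \<in> W \<Longrightarrow> S *v x \<in> W"
    and "z \<in> W" "z \<noteq> 0"
  obtains x \<mu> where "x \<in> W" "norm x = 1" "S *v x = \<mu> *\<^sub>R x"
proof -
  have scR: "c *\<^sub>R x \<in> W" if "x \<in> W" for c x
    using vec.subspace_scale[OF W that, of "complex_of_real c"]
    by (simp add: vector_scalar_mult_def scaleR_vec_def scaleR_conv_of_real)
  have add: "x + y \<in> W" if "x \<in> W" "y \<in> W" for x y using vec.subspace_add[OF W that] .
  have sub: "subspace W" using vec.subspace_0[OF W] add scR by (auto simp: subspace_def)
  have "compact (W \<inter> sphere 0 1)"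
    using closed_subspace[OF sub] by (intro closed_Int_compact) auto
  moreover have "(inverse (norm z)) *\<^sub>R z \<in> W \<inter> sphere 0 1"
    using assms(4,5) scR by auto
  moreover have "continuous_on (W \<inter> sphere 0 1) (\<lambda>x. (S *v x) \<bullet> x)"
    by (intro continuous_intros linear_continuous_on) auto
  ultimately obtain x where x: "x \<in> W" "norm x = 1"
    and max: "\<And>y. y \<in> W \<Longrightarrow> norm y = 1 \<Longrightarrow> (S *v y) \<bullet> y \<le> (S *v x) \<bullet> x"
    using continuous_attains_sup[of "W \<inter> sphere 0 1" "\<lambda>x. (S *v x) \<bullet> x"]
    by (metis (no_types, lifting) IntD1 IntD2 IntI empty_iff mem_sphere_0)
  define \<mu> where "\<mu> = (S *v x) \<bullet> x"
  have sym: "(S *v x) \<bullet> y = x \<bullet> (S *v y)" for x y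
    by (simp add: inner_eq_Re_cinner cinner_adj S)
  have le: "(S *v y) \<bullet> y \<le> \<mu> * (y \<bullet> y)" if "y \<in> W" for y
  proof (cases "y = 0")
    case False
    let ?u = "inverse (norm y) *\<^sub>R y"
    have "(S *v ?u) \<bullet> ?u \<le> \<mu>" unfolding \<mu>_def by (rule max) (use False scR that in auto)
    then have "inverse (norm y) * (inverse (norm y) * ((S *v y) \<bullet> y)) \<le> \<mu>"
      by (simp add: matrix_vector_scaleR)
    then have "(S *v y) \<bullet> y \<le> \<mu> * (norm y)\<^sup>2"
      using False by (simp add: field_simps power2_eq_square)
    then show ?thesis by (simp add: power2_norm_eq_inner)
  qed (auto simp: matrix_vector_mult_0_right)
  define r where "r = \<mu> *\<^sub>R x - S *v x"
  have rW: "r \<in> W" unfolding r_def using vec.subspace_diff[OF W] scR inv x(1) by blast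
  have xx: "x \<bullet> x = 1" using x(2) by (simp add: norm_eq_1)
  have quad: "0 \<le> t * (2 * (r \<bullet> r)) + t\<^sup>2 * (\<mu> * (r \<bullet> r) - (S *v r) \<bullet> r)" for t
  proof -
    have "0 \<le> \<mu> * ((x + t *\<^sub>R r) \<bullet> (x + t *\<^sub>R r)) - (S *v (x + t *\<^sub>R r)) \<bullet> (x + t *\<^sub>R r)"
      using le[of "x + t *\<^sub>R r"] add scR x(1) rW by simp
    also have "\<dots> = \<mu> * (x \<bullet> x) - (S *v x) \<bullet> x + t * (2 * (\<mu> * (x \<bullet> r) - (S *v x) \<bullet> r)) + t\<^sup>2 * (\<mu> * (r \<bullet> r) - (S *v r) \<bullet> r)"
    proof -
      have e1: "(x + t *\<^sub>R r) \<bullet> (x + t *\<^sub>R r) = x \<bullet> x + 2 * t * (x \<bullet> r) + t\<^sup>2 * (r \<bullet> r)"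
        using inner_commute[of r x] by (simp add: inner_add_left inner_add_right power2_eq_square ring_distribs)
      have "(S *v r) \<bullet> x = (S *v x) \<bullet> r" using sym[of r x] inner_commute by metis
      then have e2: "(S *v (x + t *\<^sub>R r)) \<bullet> (x + t *\<^sub>R r) =
          (S *v x) \<bullet> x + 2 * t * ((S *v x) \<bullet> r) + t\<^sup>2 * ((S *v r) \<bullet> r)"
        by (simp add: matrix_vector_right_distrib matrix_vector_scaleR inner_add_left inner_add_right power2_eq_square ring_distribs)
      show ?thesis unfolding e1 e2 by (simp add: ring_distribs)
    qed
    also have "\<mu> * (x \<bullet> r) - (S *v x) \<bullet> r = r \<bullet> r"
      by (simp add: r_def inner_diff_left)
    finally show ?thesis by (simp add: xx \<mu>_def)
  qed
  have "r \<bullet> r \<le> 0"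
  proof (rule ccontr)
    assume "\<not> r \<bullet> r \<le> 0"
    then have pos: "r \<bullet> r > 0" by linarith
    define c where "c = \<bar>\<mu> * (r \<bullet> r) - (S *v r) \<bullet> r\<bar> + 1"
    \<comment> \<open>at this \<open>t\<close> the linear term outweighs any quadratic term with coefficient at
      most \<open>c\<close>\<close>
    define t where "t = - (r \<bullet> r) / c"
    have c: "c > 0" by (simp add: c_def)
    have "t\<^sup>2 * (\<mu> * (r \<bullet> r) - (S *v r) \<bullet> r) \<le> t\<^sup>2 * c"
      by (intro mult_left_mono) (auto simp: c_def)
    with quad[of t] have "0 \<le> t * (2 * (r \<bullet> r)) + t\<^sup>2 * c" by linarith
    also have "\<dots> = - ((r \<bullet> r)\<^sup>2 / c)" using c by (simp add: t_def field_simps power2_eq_square)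
    finally show False using pos c by (simp add: divide_le_0_iff)
  qed
  then have "r = 0" by (metis inner_ge_zero inner_eq_zero_iff order_antisym)
  then have "S *v x = \<mu> *\<^sub>R x" by (simp add: r_def)
  then show ?thesis using that x by blast
qed

lemma unitary_of_orthonormal:
  fixes u :: "'n \<Rightarrow> complex ^ 'n"
  assumes "\<And>a b. cinner (u a) (u b) = (if a = b then 1 else 0)"
  shows "adj (\<chi> i a. u a $ i) ** (\<chi> i a. u a $ i) = mat 1"
proof -
  have "(adj (\<chi> i a. u a $ i) ** (\<chi> i a. u a $ i)) $ a $ b = cinner (u b) (u a)" for a b
    by (simp add: matrix_matrix_mult_def cinner_def mult.commute)
  then show ?thesis using assms by (auto simp: vec_eq_iff mat_def)
qed

text \<open>An orthonormal system of eigenvectors can always be enlarged, because the orthogonal complement of an invariant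
  subspace is invariant.\<close>

theorem hermitian_diagonalization:
  fixes S :: "complex ^ 'n ^ 'n"
  assumes S: "adj S = S"
  obtains U lam where "adj U ** U = mat 1" "S = U ** diag_mat lam ** adj U"
proof -
  have "\<exists>X. finite X \<and> card X = k \<and> (\<forall>x\<in>X. norm x = 1 \<and> (\<exists>\<mu>. S *v x = \<mu> *\<^sub>R x)) \<and>
      (\<forall>x\<in>X. \<forall>y\<in>X. x \<noteq> y \<longrightarrow> cinner x y = 0)" if "k \<le> CARD('n)" for k
    using that
  proof (induction k)
    case 0
    show ?case by (rule exI[of _ "{}"]) auto
  next
    case (Suc k)
    then obtain X where X: "finite X" "card X = k" "\<And>x. x \<in> X \<Longrightarrow> norm x = 1"
      "\<And>x. x \<in> X \<Longrightarrow> \<exists>\<mu>. S *v x = \<mu> *\<^sub>R x" "\<And>x y. x \<in> X \<Longrightarrow> y \<in> X \<Longrightarrow> x \<noteq> y \<Longrightarrow> cinner x y = 0"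
      by auto
    let ?V = "vec.span X"
    have V: "vec.subspace ?V" by (rule vec.subspace_span)
    have "vec.dim ?V < CARD('n)"
      using vec.dim_le_card[OF subset_refl X(1)[unfolded X(2)]] Suc.prems X(1,2)
      by (metis Suc_le_eq order_le_less_trans vec.dim_le_card vec.dim_span vec.span_superset)
    then have "?V \<noteq> UNIV" using vec_dim_card by (metis less_irrefl)
    then obtain y where y: "y \<notin> ?V" by blast
    define z where "z = y - orth_proj ?V *v y"
    define W where "W = {x. \<forall>v\<in>X. cinner x v = 0}"
    have W: "vec.subspace W"
      unfolding vec.subspace_def W_def by (auto simp: cinner_add_left cinner_scale_left) (simp add: cinner_def)
    have zW: "z \<in> W" unfolding W_def z_def using orth_proj_orth[OF V] vec.span_superset by blast
    have z0: "z \<noteq> 0" using y orth_proj_in[OF V, of y] by (auto simp: z_def)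
    have inv: "S *v x \<in> W" if "x \<in> W" for x
      unfolding W_def
    proof safe
      fix v assume v: "v \<in> X"
      then obtain \<mu> where \<mu>: "S *v v = \<mu> *\<^sub>R v" using X(4) by blast
      have "cinner (S *v x) v = cinner x (complex_of_real \<mu> *s v)"
        by (simp add: cinner_adj S \<mu>) (simp add: vector_scalar_mult_def scaleR_vec_def scaleR_conv_of_real)
      then show "cinner (S *v x) v = 0" using that v by (simp add: cinner_scale_right W_def)
    qed
    obtain x \<mu> where x: "x \<in> W" "norm x = 1" "S *v x = \<mu> *\<^sub>R x"
      using hermitian_eigenvector_in_subspace[OF S W inv zW z0] by blast
    have ort: "cinner x v = 0" "cinner v x = 0" if "v \<in> X" for v
      using x(1) that cinner_commute[of v x] by (auto simp: W_def)
    have "x \<notin> X" using ort[of x] x(2) cinner_self_eq_0[of x] by auto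
    then show ?case
      using X x ort by (intro exI[of _ "insert x X"]) auto
  qed
  from this[OF order_refl] obtain X where X: "finite X" "card X = CARD('n)" "\<And>x. x \<in> X \<Longrightarrow> norm x = 1"
      "\<And>x. x \<in> X \<Longrightarrow> \<exists>\<mu>. S *v x = \<mu> *\<^sub>R x" "\<And>x y. x \<in> X \<Longrightarrow> y \<in> X \<Longrightarrow> x \<noteq> y \<Longrightarrow> cinner x y = 0"
    by auto
  obtain u where u: "bij_betw u (UNIV :: 'n set) X"
    using finite_same_card_bij[OF finite X(1)] X(2) by metis
  then have uX: "u a \<in> X" for a by (auto simp: bij_betw_def)
  have inj: "u a = u b \<longleftrightarrow> a = b" for a b using u by (auto simp: bij_betw_def inj_on_def)
  have on: "cinner (u a) (u b) = (if a = b then 1 else 0)" for a b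
    using X(3)[OF uX, of a] X(5)[OF uX uX, of a b] inj by (auto simp: cinner_self)
  obtain lam where lam: "\<And>a. S *v u a = lam a *\<^sub>R u a" using X(4)[OF uX] by metis
  define U where "U = (\<chi> i a. u a $ i)"
  have U: "adj U ** U = mat 1" unfolding U_def by (rule unitary_of_orthonormal) (rule on)
  then have U': "U ** adj U = mat 1" by (simp add: matrix_left_right_inverse)
  have "S ** U = U ** diag_mat lam"
  proof -
    have "(S ** U) $ i $ a = (S *v u a) $ i" for i a
      by (simp add: matrix_matrix_mult_def matrix_vector_mult_def U_def)
    then show ?thesis
      by (simp add: vec_eq_iff diag_mat_mult_right lam) (simp add: U_def scaleR_conv_of_real mult.commute)
  qed
  then have "S ** (U ** adj U) = U ** diag_mat lam ** adj U" by (simp add: matrix_mul_assoc)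
  then show ?thesis using that U by (simp add: U')
qed

text \<open>Gram--Schmidt applied to the columns of \<open>X\<close>, taken in order of decreasing \<open>lam\<close>. Column
  \<open>b\<close> of \<open>R\<close> then lives in rows with values of \<open>lam\<close> at least \<open>lam b\<close>, so
  \<open>U\<close> and \<open>X\<close> carry the filtration by large values of \<open>lam\<close> to the same flag.\<close>

lemma upper_factorization:
  fixes X :: "complex ^ 'n ^ 'n" and lam :: "'n \<Rightarrow> real"
  assumes X: "invertible X"
  obtains U R where "adj U ** U = mat 1" "X = U ** R" "\<And>a b. lam a < lam b \<Longrightarrow> R $ a $ b = 0"
proof -
  obtain \<iota> :: "'n \<Rightarrow> nat" where \<iota>: "inj \<iota>"
    using finite_imp_inj_to_nat_seg[OF finite, of UNIV] by blast
  \<comment> \<open>a strict total order refining decreasing \<open>lam\<close>; the injection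
    \<open>\<iota>\<close> only breaks ties\<close>
  define before where "before b a \<longleftrightarrow> lam a < lam b \<or> (lam b = lam a \<and> \<iota> b < \<iota> a)" for a b
  have total: "before a b \<or> before b a" if "a \<noteq> b" for a b
    using that \<iota> unfolding before_def by (metis injD linorder_cases)
  have trans: "before c a" if "before c b" "before b a" for a b c
    using that unfolding before_def by auto
  define G where "G a = vec.span ((\<lambda>b. column b X) ` {b. before b a})" for a
  have G: "vec.subspace (G a)" for a unfolding G_def by (rule vec.subspace_span)
  define v where "v a = column a X - orth_proj (G a) *v column a X" for a
  have v0: "v a \<noteq> 0" for a
  proof
    assume "v a = 0"
    then have "column a X \<in> G a" using orth_proj_in[OF G, of a "column a X"] by (simp add: v_def)
    also have "G a = (*v) X ` vec.span ((\<lambda>b. axis b 1) ` {b. before b a})"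
    proof -
      have "(\<lambda>b. column b X) ` {b. before b a} = (*v) X ` ((\<lambda>b. axis b 1) ` {b. before b a})"
        by (simp add: image_image matrix_vector_axis)
      then show ?thesis unfolding G_def by (simp add: vec.linear_span_image[OF matrix_vector_mul_linear_gen])
    qed
    finally obtain y where y: "y \<in> vec.span ((\<lambda>b. axis b 1) ` {b. before b a})" "column a X = X *v y" by blast
    have "X *v axis a 1 = X *v y" by (simp add: matrix_vector_axis y(2))
    then have "axis a 1 = y" using inj_matrix_vector_mult[OF X] by (auto simp: inj_def)
    moreover have "y $ a = 0"
    proof -
      have "vec.span ((\<lambda>b. axis b 1) ` {b. before b a}) \<subseteq> {y :: complex ^ 'n. y $ a = 0}"
        by (rule vec.span_minimal) (auto simp: vec.subspace_def axis_def before_def)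
      then show ?thesis using y(1) by auto
    qed
    ultimately show False by (auto simp: axis_def)
  qed
  have orth: "cinner (v a) y = 0" if "y \<in> G a" for a y
    unfolding v_def using orth_proj_orth[OF G that] .
  have vG: "v b \<in> G a" if "before b a" for a b
  proof -
    have "G b \<subseteq> G a" unfolding G_def by (rule vec.span_mono) (use that trans in blast)
    moreover have "column b X \<in> G a" unfolding G_def by (rule vec.span_base) (use that in blast)
    ultimately show ?thesis
      unfolding v_def using orth_proj_in[OF G, of b "column b X"] by (intro vec.subspace_diff[OF G]) auto
  qed
  define u where "u a = complex_of_real (inverse (norm (v a))) *s v a" for a
  have vv: "cinner (v a) (v b) = 0" if "a \<noteq> b" for a b
    using total[OF that] orth vG cinner_commute[of "v a" "v b"] by (metis complex_cnj_zero)
  have "cinner (u a) (u b) = (if a = b then 1 else 0)" for a b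
    using v0[of a] vv[of a b]
    by (auto simp: u_def cinner_scale_left cinner_scale_right cinner_self power2_eq_square field_simps)
  note on = this
  define U where "U = (\<chi> i a. u a $ i)"
  have U: "adj U ** U = mat 1" unfolding U_def by (rule unitary_of_orthonormal) (rule on)
  then have U': "U ** adj U = mat 1" by (simp add: matrix_left_right_inverse)
  show ?thesis
  proof (rule that[OF U, of "adj U ** X"])
    show "X = U ** (adj U ** X)" by (simp add: matrix_mul_assoc U')
    fix a b assume "lam a < lam b"
    then have "column b X \<in> G a" unfolding G_def before_def by (intro vec.span_base) auto
    then have "cinner (v a) (column b X) = 0" by (rule orth)
    then have "cinner (column b X) (u a) = 0"
      using cinner_commute[of "column b X" "v a"] by (simp add: u_def cinner_scale_right)
    then show "(adj U ** X) $ a $ b = 0"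
      by (simp add: matrix_matrix_mult_def cinner_def U_def column_def mult.commute)
  qed
qed

text \<open>Integrate the hypothesis over the thresholds \<open>c\<close> between the least and the largest value of
  \<open>lam\<close>: each \<open>x a\<close> is counted for a length of \<open>lam a - m\<close>.\<close>

lemma layer_cake:
  fixes lam x :: "'n::finite \<Rightarrow> real"
  assumes pos: "\<And>c. 0 \<le> (\<Sum>a\<in>UNIV. if c \<le> lam a then x a else 0)" and sum0: "(\<Sum>a\<in>UNIV. x a) = 0"
  shows "0 \<le> (\<Sum>a\<in>UNIV. x a * lam a)"
proof -
  define m where "m = Min (range lam)"
  define M where "M = Max (range lam)"
  have mM: "m \<le> lam a" "lam a \<le> M" for a by (auto simp: m_def M_def)
  have "((\<lambda>c. if c \<le> lam a then x a else 0) has_integral (lam a - m) * x a) {m..M}" for a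
  proof -
    have "((\<lambda>c. x a) has_integral (lam a - m) * x a) {m..lam a}"
      using has_integral_const_real[of "x a" m "lam a"] mM by simp
    then have "((\<lambda>c. if c \<in> {m..lam a} then x a else 0) has_integral (lam a - m) * x a) {m..M}"
      using mM by (subst has_integral_restrict) auto
    then show ?thesis by (rule has_integral_eq[rotated]) auto
  qed
  then have "((\<lambda>c. \<Sum>a\<in>UNIV. if c \<le> lam a then x a else 0) has_integral (\<Sum>a\<in>UNIV. (lam a - m) * x a)) {m..M}"
    by (intro has_integral_sum) auto
  then have "0 \<le> (\<Sum>a\<in>UNIV. (lam a - m) * x a)"
    by (rule has_integral_nonneg) (use pos in auto)
  also have "\<dots> = (\<Sum>a\<in>UNIV. x a * lam a) - m * (\<Sum>a\<in>UNIV. x a)"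
  proof -
    have "(\<Sum>a\<in>UNIV. (lam a - m) * x a) = (\<Sum>a\<in>UNIV. x a * lam a - m * x a)"
      by (simp add: algebra_simps)
    then show ?thesis by (simp add: sum_subtractf sum_distrib_left)
  qed
  finally show ?thesis using sum0 by simp
qed

text \<open>The trace is the squared Frobenius norm of \<open>A ** B\<close>.\<close>

lemma trace_proj_mult_nonneg:
  fixes A B :: "complex ^ 'n ^ 'n"
  assumes "proj A" "proj B" shows "0 \<le> Re (trace (A ** B))"
proof -
  have "(A ** B) \<bullet> (A ** B) = A \<bullet> (A ** B ** adj B)" by (rule inner_mult_right)
  also have "\<dots> = (A ** B) \<bullet> A"
    using assms by (simp add: proj_def inner_commute flip: matrix_mul_assoc)
  also have "\<dots> = B \<bullet> (adj A ** A)" by (rule inner_mult_left)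
  also have "\<dots> = Re (trace (A ** B))"
    using assms by (simp add: proj_def inner_matrix trace_cyclic[of B A])
  finally show ?thesis by (metis inner_ge_zero)
qed

text \<open>If \<open>M\<close> maps \<open>W\<close> in a way that respects the filtration by large values of
  \<open>lam\<close>, then the image of \<open>W\<close> meets every member of the filtration in at least the dimension in
  which \<open>W\<close> meets it. The trace of the projection onto a subspace against the projection onto a member of the
  filtration is at least the dimension of the intersection, with equality for \<open>W\<close> because its projection
  commutes with \<open>diag_mat lam\<close>. The layer cake formula sums these inequalities.\<close>

lemma upper_image_trace_ge:
  fixes W :: "(complex ^ 'n) set" and lam :: "'n \<Rightarrow> real"
  assumes W: "vec.subspace W" and M: "invertible M"
    and comm: "orth_proj W ** diag_mat lam = diag_mat lam ** orth_proj W"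
    and upper: "\<And>a b. lam a < lam b \<Longrightarrow> (M ** orth_proj W) $ a $ b = 0"
  shows "Re (trace (orth_proj W ** diag_mat lam)) \<le> Re (trace (orth_proj ((*v) M ` W) ** diag_mat lam))"
proof -
  let ?P = "orth_proj W" and ?P' = "orth_proj ((*v) M ` W)"
  have V: "vec.subspace ((*v) M ` W)" using W by (rule subspace_image)
  note P = adj_orth_proj[OF W] orth_proj_idem[OF W] and P' = adj_orth_proj[OF V] orth_proj_idem[OF V]
  have block: "?P $ a $ b = 0" if "lam a \<noteq> lam b" for a b
  proof -
    have "(?P ** diag_mat lam) $ a $ b = (diag_mat lam ** ?P) $ a $ b" by (simp add: comm)
    then show ?thesis using that by (simp add: diag_mat_mult_left diag_mat_mult_right)
  qed
  have "0 \<le> (\<Sum>a\<in>UNIV. if c \<le> lam a then Re (?P' $ a $ a) - Re (?P $ a $ a) else 0)" for c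
  proof -
    define Q :: "complex ^ 'n ^ 'n" where "Q = diag_mat (\<lambda>a. if c \<le> lam a then 1 else 0)"
    have Qproj: "Q ** Q = Q" "adj Q = Q"
      by (auto simp: Q_def vec_eq_iff diag_mat_mult_left) (auto simp: diag_mat_def)
    have PQ: "?P ** Q = Q ** ?P"
    proof -
      have "(?P ** Q) $ a $ b = (Q ** ?P) $ a $ b" for a b
        using block[of a b] by (cases "lam a = lam b") (auto simp: Q_def diag_mat_mult_left diag_mat_mult_right)
      then show ?thesis by (simp add: vec_eq_iff)
    qed
    \<comment> \<open>\<open>Q\<close> projects onto the member of the filtration belonging to \<open>c\<close>,
      so \<open>W2\<close> is its intersection with \<open>W\<close>; \<open>F\<close> below lies in its
      intersection with the image of \<open>W\<close>\<close>
    define W2 where "W2 = {x \<in> W. Q *v x = x}"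
    have W2: "vec.subspace W2"
      using W unfolding W2_def vec.subspace_def
      by (auto simp: matrix_vector_right_distrib vector_scalar_commute)
    have op2: "orth_proj W2 = ?P ** Q"
    proof (rule orth_proj_eqI[OF W2])
      show "adj (?P ** Q) = ?P ** Q" by (simp add: adj_mult P Qproj PQ)
      have "Q ** (?P ** Q) = ?P ** Q" by (metis PQ Qproj(1) matrix_mul_assoc)
      then show "(?P ** Q) *v x \<in> W2" for x
        unfolding W2_def using orth_proj_in[OF W]
        by (auto simp: matrix_vector_mul_assoc) (simp flip: matrix_vector_mul_assoc add: orth_proj_in[OF W])
      show "(?P ** Q) *v y = y" if "y \<in> W2" for y
        using that orth_proj_fix[OF W] by (simp add: W2_def flip: matrix_vector_mul_assoc)
    qed
    define F where "F = (*v) M ` W2"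
    have F: "vec.subspace F" unfolding F_def using W2 by (rule subspace_image)
    let ?PF = "orth_proj F"
    note PF = adj_orth_proj[OF F] orth_proj_idem[OF F]
    have QF: "Q *v y = y" if "y \<in> F" for y
    proof -
      obtain x where x: "x \<in> W" "Q *v x = x" "y = M *v x" using \<open>y \<in> F\<close> by (auto simp: F_def W2_def)
      have "Q ** (M ** ?P ** Q) = M ** ?P ** Q"
      proof -
        have "(Q ** (M ** ?P ** Q)) $ a $ b = (M ** ?P ** Q) $ a $ b" for a b
          using upper[of a b] by (auto simp: Q_def diag_mat_mult_left diag_mat_mult_right)
        then show ?thesis by (simp add: vec_eq_iff)
      qed
      then have "(Q ** (M ** ?P ** Q)) *v x = (M ** ?P ** Q) *v x" by simp
      then show ?thesis using x orth_proj_fix[OF W x(1)] by (simp flip: matrix_vector_mul_assoc)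
    qed
    have "F \<subseteq> (*v) M ` W" by (auto simp: F_def W2_def)
    then have PP: "?P' ** ?PF = ?PF"
      using orth_proj_in[OF F] orth_proj_fix[OF V]
      by (auto simp: matrix_eq simp flip: matrix_vector_mul_assoc)
    then have PP': "?PF ** ?P' = ?PF" by (metis PF(1) P'(1) adj_mult)
    have QPF: "Q ** ?PF = ?PF"
      using orth_proj_in[OF F] QF by (auto simp: matrix_eq simp flip: matrix_vector_mul_assoc)
    have "proj (?P' - ?PF)" "proj Q"
      by (auto simp: proj_def adj_diff P' PF matrix_algebra PP PP' Qproj)
    then have "0 \<le> Re (trace ((?P' - ?PF) ** Q))" by (rule trace_proj_mult_nonneg)
    also have "\<dots> = Re (trace (?P' ** Q)) - Re (trace (?PF ** Q))"
      by (simp add: matrix_diff_rdistrib trace_diff)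
    also have "trace (?PF ** Q) = trace (?P ** Q)"
      unfolding trace_cyclic[of ?PF Q] QPF
    using trace_orth_proj_image[OF W2 M] by (simp add: op2 F_def)
    also have "Re (trace (?P' ** Q)) - Re (trace (?P ** Q)) =
        (\<Sum>a\<in>UNIV. if c \<le> lam a then Re (?P' $ a $ a) - Re (?P $ a $ a) else 0)"
      unfolding Q_def trace_mult_diag_mat Re_sum sum_subtractf[symmetric]
      by (rule sum.cong) auto
    finally show ?thesis .
  qed
  moreover have "(\<Sum>a\<in>UNIV. Re (?P' $ a $ a) - Re (?P $ a $ a)) = 0"
    using trace_orth_proj_image[OF W M] by (simp add: trace_def sum_subtractf flip: Re_sum)
  ultimately have "0 \<le> (\<Sum>a\<in>UNIV. (Re (?P' $ a $ a) - Re (?P $ a $ a)) * lam a)"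
    by (rule layer_cake)
  also have "\<dots> = Re (trace (?P' ** diag_mat lam)) - Re (trace (?P ** diag_mat lam))"
    unfolding trace_mult_diag_mat Re_sum sum_subtractf[symmetric]
    by (rule sum.cong) (auto simp: algebra_simps)
  finally show ?thesis by simp
qed


section \<open>Polynomial functions and algebraic relations\<close>

text \<open>Polynomial functions of several complex variables, as a class of functions. The restriction to a complex line is
  a univariate polynomial (\<open>polyfun_on_line\<close>), which is where zeros are controlled.\<close>

inductive polyfun :: "(complex ^ 'q \<Rightarrow> complex) \<Rightarrow> bool" where
  polyfun_const: "polyfun (\<lambda>x. c)"
| polyfun_coord: "polyfun (\<lambda>x. x $ i)"
| polyfun_add: "polyfun f \<Longrightarrow> polyfun g \<Longrightarrow> polyfun (\<lambda>x. f x + g x)"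
| polyfun_mult: "polyfun f \<Longrightarrow> polyfun g \<Longrightarrow> polyfun (\<lambda>x. f x * g x)"

lemma polyfun_sum: "(\<And>a. a \<in> A \<Longrightarrow> polyfun (f a)) \<Longrightarrow> polyfun (\<lambda>x. \<Sum>a\<in>A. f a x)"
  by (induction A rule: infinite_finite_induct) (auto intro: polyfun.intros)

lemma polyfun_prod: "(\<And>a. a \<in> A \<Longrightarrow> polyfun (f a)) \<Longrightarrow> polyfun (\<lambda>x. \<Prod>a\<in>A. f a x)"
  by (induction A rule: infinite_finite_induct) (auto intro: polyfun.intros)

lemma polyfun_power: "polyfun f \<Longrightarrow> polyfun (\<lambda>x. f x ^ k)"
  by (induction k) (auto intro: polyfun.intros)

lemma polyfun_uminus: "polyfun f \<Longrightarrow> polyfun (\<lambda>x. - f x)"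
  using polyfun_mult[OF polyfun_const[of "-1"]] by simp

lemma polyfun_diff: "polyfun f \<Longrightarrow> polyfun g \<Longrightarrow> polyfun (\<lambda>x. f x - g x)"
  using polyfun_add[OF _ polyfun_uminus, of f g] by simp

lemma polyfun_compose:
  assumes "polyfun p" and "\<And>i. polyfun (\<lambda>x. F x $ i)"
  shows "polyfun (\<lambda>x. p (F x))"
  using assms(1) by induction (auto intro: polyfun.intros assms(2))

lemma polyfun_continuous_on: "polyfun f \<Longrightarrow> continuous_on S f"
  by (induction rule: polyfun.induct) (auto intro!: continuous_intros)

lemma polyfun_on_line:
  assumes "polyfun f"
  shows "\<exists>p. \<forall>t. f (x + t *s v) = poly p t"
  using assms
proof induction
    case (polyfun_const c)
    show ?case by (rule exI[of _ "[:c:]"]) simp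
  next
    case (polyfun_coord i)
    show ?case by (rule exI[of _ "[:x $ i, v $ i:]"]) simp
  next
    case (polyfun_add f g)
    then show ?case by (metis poly_add)
  next
    case (polyfun_mult f g)
    then show ?case by (metis poly_mult)
qed

text \<open>On the line through the two points both factors restrict to nonzero polynomials, which have finitely many
  zeros.\<close>

lemma polyfun_mult_nonzero:
  assumes "polyfun f" "polyfun g" "f x \<noteq> 0" "g y \<noteq> 0"
  obtains z where "f z \<noteq> 0" "g z \<noteq> 0"
proof -
  obtain p where p: "\<And>t. f (x + t *s (y - x)) = poly p t" using polyfun_on_line[OF assms(1)] by metis
  obtain r where r: "\<And>t. g (x + t *s (y - x)) = poly r t" using polyfun_on_line[OF assms(2)] by metis
  have "poly p 0 \<noteq> 0" "poly r 1 \<noteq> 0" using assms p[of 0] r[of 1] by auto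
  then have "p * r \<noteq> 0" by auto
  then have "finite {t. poly (p * r) t = 0}" by (rule poly_roots_finite)
  then obtain t where "poly (p * r) t \<noteq> 0"
    by (metis (mono_tags, lifting) ex_new_if_finite infinite_UNIV_char_0 mem_Collect_eq)
  then show ?thesis using that p r by (metis mult_eq_0_iff poly_mult)
qed

lemma polyfun_prod_nonzero:
  assumes "finite A" "\<And>a. a \<in> A \<Longrightarrow> polyfun (f a)" "\<And>a. a \<in> A \<Longrightarrow> \<exists>x. f a x \<noteq> 0"
  shows "\<exists>x. (\<Prod>a\<in>A. f a x) \<noteq> 0"
  using assms
proof (induction A)
  case (insert a A)
  obtain x where x: "f a x \<noteq> 0" using insert.prems(2)[of a] by blast
  obtain y where y: "(\<Prod>a\<in>A. f a y) \<noteq> 0" using insert by auto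
  have "polyfun (\<lambda>x. \<Prod>a\<in>A. f a x)" using insert by (auto intro: polyfun_prod)
  then obtain z where "f a z \<noteq> 0" "(\<Prod>a\<in>A. f a z) \<noteq> 0"
    using polyfun_mult_nonzero[of "f a" "\<lambda>x. \<Prod>a\<in>A. f a x" x y] x y insert.prems(1) by blast
  then show ?case using insert by auto
qed auto

lemma polyfun_nonzero_in_open:
  assumes f: "polyfun f" "f y \<noteq> 0" and S: "open S" "x \<in> S"
  obtains z where "z \<in> S" "f z \<noteq> 0"
proof -
  obtain p where p: "\<And>t. f (x + t *s (y - x)) = poly p t" using polyfun_on_line[OF f(1)] by metis
  have "poly p 1 \<noteq> 0" using f p[of 1] by auto
  then have "p \<noteq> 0" by auto
  then have fin: "finite {t. poly p t = 0}" by (rule poly_roots_finite)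
  have "continuous_on UNIV (\<lambda>t. x + t *s (y - x))"
    unfolding vector_scalar_mult_def by (intro continuous_intros)
  then have "open ((\<lambda>t. x + t *s (y - x)) -` S)" using S(1) by (simp add: open_vimage)
  moreover have "0 \<in> (\<lambda>t. x + t *s (y - x)) -` S" using S by simp
  ultimately have "infinite ((\<lambda>t. x + t *s (y - x)) -` S)"
    by (metis empty_iff finite_imp_not_open) 
  then obtain t where "t \<in> (\<lambda>t. x + t *s (y - x)) -` S" "poly p t \<noteq> 0"
    using fin by (metis (mono_tags, lifting) finite_subset mem_Collect_eq subsetI)
  then show ?thesis using that p by (metis vimageE)
qed

lemma polyfun_has_derivative:
  assumes "polyfun f"
  obtains D where "\<And>i. polyfun (D i)"
    "\<And>x. (f has_derivative (\<lambda>v. \<Sum>i\<in>UNIV. D i x * v $ i)) (at x)"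
proof -
  have "\<exists>D. (\<forall>i. polyfun (D i)) \<and> (\<forall>x. (f has_derivative (\<lambda>v. \<Sum>i\<in>UNIV. D i x * v $ i)) (at x))"
    using assms
  proof induction
    case (polyfun_const c)
    show ?case by (rule exI[of _ "\<lambda>i x. 0"]) (auto intro: polyfun.intros)
  next
    case (polyfun_coord j)
    have "((\<lambda>x :: complex^'a. x $ j) has_derivative (\<lambda>v. v $ j)) (at x)" for x
        by (rule bounded_linear.has_derivative[OF bounded_linear_vec_nth has_derivative_ident])
    moreover have "(\<Sum>i\<in>UNIV. (if i = j then 1 else 0) * v $ i) = v $ j" for v :: "complex ^ 'a"
    proof -
      have "(\<Sum>i\<in>UNIV. (if i = j then 1 else 0) * v $ i) = (\<Sum>i\<in>UNIV. if i = j then v $ i else 0)"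
        by (rule sum.cong) auto
      then show ?thesis by simp
    qed
    ultimately have "\<forall>x. ((\<lambda>x :: complex^'a. x $ j) has_derivative
        (\<lambda>v. \<Sum>i\<in>UNIV. (if i = j then 1 else 0) * v $ i)) (at x)"
      by presburger
    then show ?case
      by (rule exI[of _ "\<lambda>i x. if i = j then 1 else 0", OF conjI[rotated]])
        (rule allI, rule polyfun.polyfun_const)
  next
    case (polyfun_add f g)
    obtain D where D: "\<forall>i. polyfun (D i)" "\<And>x. (f has_derivative (\<lambda>v. \<Sum>i\<in>UNIV. D i x * v $ i)) (at x)"
      using polyfun_add.IH(1) by blast
    obtain E where E: "\<forall>i. polyfun (E i)" "\<And>x. (g has_derivative (\<lambda>v. \<Sum>i\<in>UNIV. E i x * v $ i)) (at x)"
      using polyfun_add.IH(2) by blast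
    show ?case
      using D(1) E(1) has_derivative_add[OF D(2) E(2)]
      by (intro exI[of _ "\<lambda>i x. D i x + E i x"] conjI allI polyfun.polyfun_add)
        (simp_all add: sum.distrib ring_distribs)
  next
    case (polyfun_mult f g)
    obtain D where D: "\<forall>i. polyfun (D i)" "\<And>x. (f has_derivative (\<lambda>v. \<Sum>i\<in>UNIV. D i x * v $ i)) (at x)"
      using polyfun_mult.IH(1) by blast
    obtain E where E: "\<forall>i. polyfun (E i)" "\<And>x. (g has_derivative (\<lambda>v. \<Sum>i\<in>UNIV. E i x * v $ i)) (at x)"
      using polyfun_mult.IH(2) by blast
    show ?case
      using D(1) E(1) has_derivative_mult[OF D(2) E(2)] polyfun_mult.hyps
      by (intro exI[of _ "\<lambda>i x. f x * E i x + D i x * g x"] conjI allI polyfun.polyfun_add polyfun.polyfun_mult)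
        (simp_all add: sum.distrib ring_distribs sum_distrib_left sum_distrib_right ac_simps)
  qed
  then show ?thesis using that by blast
qed

text \<open>Exponent vectors whose degree in each variable separately is at most \<open>N\<close>. Their number is an exact
  power, which makes the counting below simpler than with total degrees.\<close>

definition exponent_box :: "nat \<Rightarrow> ('q::finite \<Rightarrow> nat) set" where
  "exponent_box N = (\<Pi>\<^sub>E i\<in>UNIV. {..N})"

definition power_product :: "('q::finite \<Rightarrow> nat) \<Rightarrow> complex ^ 'q \<Rightarrow> complex" where
  "power_product a x = (\<Prod>i\<in>UNIV. x $ i ^ a i)"

definition box_degree :: "nat \<Rightarrow> (complex ^ 'q::finite \<Rightarrow> complex) \<Rightarrow> bool" where
  "box_degree N f \<longleftrightarrow> (\<exists>c. f = (\<lambda>x. \<Sum>a\<in>exponent_box N. c a * power_product a x))"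

lemma finite_exponent_box: "finite (exponent_box N)" and card_exponent_box: "card (exponent_box N :: ('q::finite \<Rightarrow> nat) set) = (N + 1) ^ CARD('q)"
  by (auto simp: exponent_box_def card_PiE intro!: finite_PiE)

lemma exponent_box_iff: "a \<in> exponent_box N \<longleftrightarrow> (\<forall>i. a i \<le> N)"
  by (auto simp: exponent_box_def PiE_def)

lemma box_degree_add: "box_degree N f \<Longrightarrow> box_degree N g \<Longrightarrow> box_degree N (\<lambda>x. f x + g x)"
  unfolding box_degree_def
  by (elim exE, rename_tac c e, rule_tac x = "\<lambda>a. c a + e a" in exI) (simp add: ring_distribs sum.distrib)

lemma box_degree_scale: "box_degree N f \<Longrightarrow> box_degree N (\<lambda>x. c * f x)"
  unfolding box_degree_def
  by (elim exE, rename_tac e, rule_tac x = "\<lambda>a. c * e a" in exI) (simp add: sum_distrib_left mult.assoc)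

lemma box_degree_zero: "box_degree N (\<lambda>x. 0)"
  unfolding box_degree_def by (rule exI[of _ "\<lambda>_. 0"]) simp

lemma box_degree_sum: "(\<And>a. a \<in> A \<Longrightarrow> box_degree N (f a)) \<Longrightarrow> box_degree N (\<lambda>x. \<Sum>a\<in>A. f a x)"
  by (induction A rule: infinite_finite_induct) (auto intro: box_degree_zero box_degree_add)

lemma box_degree_mono_fun: "a \<in> exponent_box N \<Longrightarrow> box_degree N (power_product a)"
  unfolding box_degree_def
  by (rule exI[of _ "\<lambda>b. if b = a then 1 else 0"])
    (simp add: if_distrib[of "\<lambda>c. c * _"] sum.delta finite_exponent_box cong: if_cong)

lemma power_product_add: "power_product a x * power_product b x = power_product (\<lambda>i. a i + b i) x"
  by (simp add: power_product_def power_add prod.distrib)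

lemma box_degree_mult:
  assumes "box_degree M f" "box_degree N g" "M + N \<le> K"
  shows "box_degree K (\<lambda>x. f x * g x)"
proof -
  obtain c e where f: "f = (\<lambda>x. \<Sum>a\<in>exponent_box M. c a * power_product a x)"
    and g: "g = (\<lambda>x. \<Sum>b\<in>exponent_box N. e b * power_product b x)"
    using assms by (auto simp: box_degree_def)
  have "(\<lambda>x. f x * g x) = (\<lambda>x. \<Sum>a\<in>exponent_box M. \<Sum>b\<in>exponent_box N. (c a * e b) * power_product (\<lambda>i. a i + b i) x)"
    by (simp add: f g sum_product power_product_add[symmetric] ac_simps)
  moreover have "(\<lambda>i. a i + b i) \<in> exponent_box K" if "a \<in> exponent_box M" "b \<in> exponent_box N" for a b :: "'a \<Rightarrow> nat"
    using that assms(3) by (auto simp: exponent_box_iff) (meson add_mono le_trans)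
  ultimately show ?thesis
    by (auto intro!: box_degree_sum box_degree_scale box_degree_mono_fun)
qed

lemma box_degree_const: "box_degree N (\<lambda>x. c)"
proof -
  have "box_degree N (\<lambda>x. c * power_product (\<lambda>_. 0) x)"
    by (intro box_degree_scale box_degree_mono_fun) (simp add: exponent_box_iff)
  then show ?thesis by (simp add: power_product_def)
qed

lemma box_degree_mono:
  assumes "box_degree M f" "M \<le> N"
  shows "box_degree N f"
  using box_degree_mult[OF assms(1) box_degree_const[of 0 1], of N] assms(2) by simp

lemma box_degree_power:
  assumes "box_degree M f" shows "box_degree (k * M) (\<lambda>x. f x ^ k)"
  by (induction k) (auto intro: box_degree_const box_degree_mult assms)

lemma box_degree_prod:
  assumes "finite A" "\<And>a. a \<in> A \<Longrightarrow> box_degree M (f a)"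
  shows "box_degree (card A * M) (\<lambda>x. \<Prod>a\<in>A. f a x)"
  using assms by (induction A) (auto intro!: box_degree_const box_degree_mult)

lemma polyfun_imp_box_degree:
  "polyfun f \<Longrightarrow> \<exists>N. box_degree N f"
  proof (induction rule: polyfun.induct)
    case (polyfun_coord i)
    have "power_product (\<lambda>j. if j = i then 1 else 0) = (\<lambda>x :: complex^'a. x $ i)"
      by (auto simp: power_product_def fun_eq_iff if_distrib[of "\<lambda>k. _ ^ k"] prod.delta cong: if_cong)
    moreover have "box_degree 1 (power_product (\<lambda>j. if j = i then 1 else 0))"
      by (rule box_degree_mono_fun) (simp add: exponent_box_iff)
    ultimately show ?case by auto
  next
    case (polyfun_add f g)
    then obtain M N where "box_degree M f" "box_degree N g" by auto
    then have "box_degree (max M N) f" "box_degree (max M N) g" by (auto intro: box_degree_mono)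
    then show ?case using box_degree_add by blast
qed (auto intro: box_degree_const box_degree_mult)

text \<open>Induction on the set of variables: in one additional variable the sum is a univariate polynomial, so all its
  coefficients vanish.\<close>

lemma power_product_independent:
  assumes "\<And>y. (\<Sum>a\<in>exponent_box N. u a * power_product a y) = 0" "a \<in> exponent_box N"
  shows "u a = 0"
proof -
  have "\<forall>u. (\<forall>y :: 'a \<Rightarrow> complex. (\<Sum>a\<in>PiE I (\<lambda>_. {..N}). u a * (\<Prod>i\<in>I. y i ^ a i)) = 0) \<longrightarrow>
      (\<forall>a\<in>PiE I (\<lambda>_. {..N}). u a = 0)" if "finite I" for I :: "'a set"
    using that
  proof (induction I)
    case (insert i I)
    show ?case
    proof (intro allI impI)
      fix u :: "('a \<Rightarrow> nat) \<Rightarrow> complex"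
      assume *: "\<forall>y :: 'a \<Rightarrow> complex. (\<Sum>a\<in>PiE (insert i I) (\<lambda>_. {..N}). u a * (\<Prod>j\<in>insert i I. y j ^ a j)) = 0"
      define c where "c y k = (\<Sum>a\<in>PiE I (\<lambda>_. {..N}). u (a(i := k)) * (\<Prod>j\<in>I. y j ^ a j))" for y :: "'a \<Rightarrow> complex" and k
      have inj: "inj_on (\<lambda>(k, g). g(i := k)) ({..N} \<times> PiE I (\<lambda>_. {..N}))"
        using inj_combinator[OF insert(2), of "\<lambda>_. {..N}"] by simp
      have "(\<Sum>k\<le>N. c y k * z ^ k) = 0" for y z
      proof -
        have "0 = (\<Sum>a\<in>PiE (insert i I) (\<lambda>_. {..N}). u a * (\<Prod>j\<in>insert i I. (y(i := z)) j ^ a j))"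
          using * by simp
        also have "\<dots> = (\<Sum>(k, a)\<in>{..N} \<times> PiE I (\<lambda>_. {..N}).
            u (a(i := k)) * (\<Prod>j\<in>insert i I. (y(i := z)) j ^ (a(i := k)) j))"
          unfolding PiE_insert_eq by (subst sum.reindex[OF inj]) (simp add: case_prod_unfold)
        also have "\<dots> = (\<Sum>(k, a)\<in>{..N} \<times> PiE I (\<lambda>_. {..N}).
            u (a(i := k)) * (z ^ k * (\<Prod>j\<in>I. y j ^ a j)))"
        proof -
          have "(\<Prod>j\<in>I. (y(i := z)) j ^ (a(i := k)) j) = (\<Prod>j\<in>I. y j ^ a j)" for k a
            by (rule prod.cong) (use insert(2) in auto)
          then show ?thesis using insert(1,2) by simp
        qed
        also have "\<dots> = (\<Sum>k\<le>N. c y k * z ^ k)"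
          unfolding sum.cartesian_product[symmetric] c_def
          by (simp add: sum_distrib_left sum_distrib_right ac_simps)
        finally show ?thesis by simp
      qed
      then have "\<forall>k\<le>N. c y k = 0" for y
        using polyfun_eq_coeffs[where n = N and c = "c y" and d = "\<lambda>_. 0"] by simp
      then have c0: "c y k = 0" if "k \<le> N" for k y using that by blast
      have "u (a(i := k)) = 0" if "k \<le> N" "a \<in> PiE I (\<lambda>_. {..N})" for k a
        using insert.IH[rule_format, of "\<lambda>a. u (a(i := k))" a] c0[OF that(1)] that(2) by (simp add: c_def)
      then show "\<forall>a\<in>PiE (insert i I) (\<lambda>_. {..N}). u a = 0"
        unfolding PiE_insert_eq by auto
    qed
  qed auto
  from this[of UNIV] assms(2) show ?thesis
    using assms(1)[unfolded power_product_def exponent_box_def, of "\<chi> i. _ i"] by (auto simp: exponent_box_def)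
qed

text \<open>Gaussian elimination, removing one equation and one unknown at a time.\<close>

lemma homogeneous_system_nontrivial:
  fixes c :: "'k \<Rightarrow> 'b \<Rightarrow> 'a::field"
  assumes "finite B" "finite K" "card B < card K"
  shows "\<exists>u. (\<exists>k\<in>K. u k \<noteq> 0) \<and> (\<forall>b\<in>B. (\<Sum>k\<in>K. u k * c k b) = 0)"
  using assms
proof (induction B arbitrary: K c)
  case empty
  then obtain k where "k \<in> K" by (metis card_gt_0_iff card.empty ex_in_conv)
  then show ?case by (intro exI[of _ "\<lambda>_. 1"]) auto
next
  case (insert b B)
  show ?case
  proof (cases "\<forall>k\<in>K. c k b = 0")
    case True
    have "card B < card K" using insert by auto
    then show ?thesis using insert.IH[OF insert(4), of c] True by (auto intro!: sum.neutral)
  next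
    case False
    then obtain m where m: "m \<in> K" "c m b \<noteq> 0" by auto
    define c' where "c' k b' = c k b' - c k b / c m b * c m b'" for k b'
    have "card B < card (K - {m})" using insert m by auto
    then obtain u where u: "\<exists>k\<in>K - {m}. u k \<noteq> 0" "\<And>b'. b' \<in> B \<Longrightarrow> (\<Sum>k\<in>K - {m}. u k * c' k b') = 0"
      using insert.IH[of "K - {m}" c'] insert(4) by auto
    define v where "v = u(m := - (\<Sum>k\<in>K - {m}. u k * c k b) / c m b)"
    have split: "(\<Sum>k\<in>K. v k * c k b') = - (\<Sum>k\<in>K - {m}. u k * c k b) / c m b * c m b' + (\<Sum>k\<in>K - {m}. u k * c k b')" for b'
    proof -
      have "(\<Sum>k\<in>K - {m}. v k * c k b') = (\<Sum>k\<in>K - {m}. u k * c k b')"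
        by (rule sum.cong) (auto simp: v_def)
      then show ?thesis using sum.remove[OF insert(4) m(1), of "\<lambda>k. v k * c k b'"] by (simp add: v_def)
    qed
    have "(\<Sum>k\<in>K. v k * c k b') = (\<Sum>k\<in>K - {m}. u k * c' k b')" for b'
      unfolding split c'_def
      by (simp add: sum_subtractf ring_distribs sum_distrib_left sum_distrib_right sum_divide_distrib ac_simps)
    moreover have "(\<Sum>k\<in>K - {m}. u k * c' k b) = 0" using m(2) by (simp add: c'_def)
    ultimately have "\<forall>b'\<in>insert b B. (\<Sum>k\<in>K. v k * c k b') = 0" using u by auto
    moreover have "\<exists>k\<in>K. v k \<noteq> 0" using u(1) by (auto simp: v_def)
    ultimately show ?thesis by blast
  qed
qed

text \<open>The \<open>q\<close> components of \<open>F\<close> and \<open>g\<close> are \<open>q + 1\<close> polynomials in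
  \<open>q\<close> variables, hence algebraically dependent. The products of a power product of the components with exponents
  at most \<open>B\<close> and a power of \<open>g\<close> with exponent at most \<open>B\<close> have degree at most a
  constant times \<open>B\<close> in every variable, so their number \<open>(B + 1)^(q + 1)\<close> exceeds the dimension of
  the space that contains them when \<open>B\<close> is large.\<close>

lemma algebraic_relation:
  fixes F :: "complex ^ 'q \<Rightarrow> complex ^ 'q"
  assumes F: "\<And>i. polyfun (\<lambda>x. F x $ i)" and g: "polyfun g"
  shows "\<exists>p b0 B y0. (\<forall>b. polyfun (p b)) \<and> b0 \<le> B \<and> p b0 y0 \<noteq> 0 \<and>
    (\<forall>x. (\<Sum>b\<le>B. p b (F x) * g x ^ b) = 0)"
proof -
  let ?q = "CARD('q)"
  have "\<forall>i. \<exists>N. box_degree N (\<lambda>x. F x $ i)" using polyfun_imp_box_degree[OF F] by blast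
  from choice[OF this] obtain d where d: "\<And>i. box_degree (d i) (\<lambda>x. F x $ i)" by blast
  obtain e where e: "box_degree e g" using polyfun_imp_box_degree[OF g] by blast
  define D where "D = e + (\<Sum>i\<in>UNIV. d i)"
  have dD: "d i \<le> D" for i unfolding D_def by (rule trans_le_add2, rule member_le_sum) auto
  have DF: "box_degree D (\<lambda>x. F x $ i)" for i using d dD box_degree_mono by blast
  have Dg: "box_degree D g" by (rule box_degree_mono[OF e]) (simp add: D_def)
  \<comment> \<open>chosen so that \<open>(K + 1)^q \<le> B (B + 1)^q\<close>, which is less than the number
    \<open>(B + 1)^(q + 1)\<close> of products\<close>
  define B where "B = (?q * D + D + 1) ^ ?q"
  define K where "K = ?q * (B * D) + B * D"
  let ?I = "(exponent_box B :: ('q \<Rightarrow> nat) set) \<times> {..B}"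
  have box: "box_degree K (\<lambda>x. power_product a (F x) * g x ^ b)" if "a \<in> exponent_box B" "b \<le> B" for a b
  proof -
    have "box_degree (B * D) (\<lambda>x. F x $ i ^ a i)" for i
      by (rule box_degree_mono[OF box_degree_power[OF DF]]) (use that(1) in \<open>simp add: exponent_box_iff\<close>)
    then have "box_degree (?q * (B * D)) (\<lambda>x. power_product a (F x))"
      unfolding power_product_def by (rule box_degree_prod[OF finite])
    moreover have "box_degree (b * D) (\<lambda>x. g x ^ b)" by (rule box_degree_power[OF Dg])
    ultimately show ?thesis by (rule box_degree_mult) (use that(2) in \<open>simp add: K_def\<close>)
  qed
  have "\<forall>k\<in>?I. \<exists>c. \<forall>x. power_product (fst k) (F x) * g x ^ snd k = (\<Sum>s\<in>exponent_box K. c s * power_product s x)"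
  proof
    fix k assume "k \<in> ?I"
    then have "box_degree K (\<lambda>x. power_product (fst k) (F x) * g x ^ snd k)" by (intro box) auto
    then show "\<exists>c. \<forall>x. power_product (fst k) (F x) * g x ^ snd k = (\<Sum>s\<in>exponent_box K. c s * power_product s x)"
      unfolding box_degree_def fun_eq_iff .
  qed
  from bchoice[OF this] obtain c where
    c: "\<And>k x. k \<in> ?I \<Longrightarrow> power_product (fst k) (F x) * g x ^ snd k = (\<Sum>s\<in>exponent_box K. c k s * power_product s x)"
    by blast
  have "K + 1 \<le> (?q * D + D + 1) * (B + 1)" by (simp add: K_def ring_distribs)
  then have "(K + 1) ^ ?q \<le> ((?q * D + D + 1) * (B + 1)) ^ ?q" by (rule power_mono) simp
  also have "\<dots> = (?q * D + D + 1) ^ ?q * (B + 1) ^ ?q" by (rule power_mult_distrib)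
  also have "\<dots> < (B + 1) ^ ?q * (B + 1)" by (simp add: B_def)
  finally have "card (exponent_box K :: ('q \<Rightarrow> nat) set) < card ?I"
    by (simp add: card_exponent_box card_cartesian_product)
  then obtain u where u: "\<exists>k\<in>?I. u k \<noteq> 0" "\<And>s. s \<in> exponent_box K \<Longrightarrow> (\<Sum>k\<in>?I. u k * c k s) = 0"
    using homogeneous_system_nontrivial[of "exponent_box K" ?I c] by (auto simp: finite_exponent_box)
  define p where "p b y = (\<Sum>a\<in>exponent_box B. u (a, b) * power_product a y)" for b and y :: "complex ^ 'q"
  have "polyfun (p b)" for b
    unfolding p_def power_product_def
    by (intro polyfun_sum polyfun_mult polyfun_prod polyfun_power polyfun_const polyfun_coord)
  moreover obtain a0 b0 where ab: "a0 \<in> exponent_box B" "b0 \<le> B" "u (a0, b0) \<noteq> 0" using u(1) by auto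
  moreover obtain y0 where "p b0 y0 \<noteq> 0"
    using power_product_independent[where N = B and u = "\<lambda>a. u (a, b0)" and a = a0] ab unfolding p_def by blast
  moreover have "(\<Sum>b\<le>B. p b (F x) * g x ^ b) = 0" for x
  proof -
    have "(\<Sum>b\<le>B. p b (F x) * g x ^ b) = (\<Sum>a\<in>exponent_box B. \<Sum>b\<le>B. u (a, b) * (power_product a (F x) * g x ^ b))"
      unfolding p_def sum_distrib_right mult.assoc by (rule sum.swap)
    also have "\<dots> = (\<Sum>k\<in>?I. u k * (\<Sum>s\<in>exponent_box K. c k s * power_product s x))"
      unfolding sum.cartesian_product by (rule sum.cong) (auto simp: c[symmetric])
    also have "\<dots> = (\<Sum>s\<in>exponent_box K. (\<Sum>k\<in>?I. u k * c k s) * power_product s x)"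
      unfolding sum_distrib_left sum_distrib_right mult.assoc by (rule sum.swap)
    finally show ?thesis using u(2) by simp
  qed
  ultimately show ?thesis by blast
qed


section \<open>Density of the range of a polynomial map\<close>

text \<open>A relation in which the leading coefficient is not the zero polynomial. It keeps \<open>g\<close> bounded over
  bounded sets of values of \<open>F\<close> on which that coefficient stays away from zero.\<close>

lemma leading_relation:
  fixes F :: "complex ^ 'q \<Rightarrow> complex ^ 'q"
  assumes "\<And>i. polyfun (\<lambda>x. F x $ i)" and "polyfun g"
  shows "\<exists>C p. (\<forall>b. polyfun (p b)) \<and> (\<exists>y. p C y \<noteq> 0) \<and> (\<forall>x. (\<Sum>b\<le>C. p b (F x) * g x ^ b) = 0)"
proof -
  obtain p b0 B y0 where p: "\<And>b. polyfun (p b)" "b0 \<le> B" "p b0 y0 \<noteq> 0"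
    and rel: "\<And>x. (\<Sum>b\<le>B. p b (F x) * g x ^ b) = 0"
    using algebraic_relation[OF assms] by blast
  define N where "N = {b. b \<le> B \<and> (\<exists>y. p b y \<noteq> 0)}"
  define C where "C = Max N"
  have fin: "finite N" by (simp add: N_def)
  have "b0 \<in> N" using p by (auto simp: N_def)
  then have "C \<in> N" unfolding C_def using fin Max_in by blast
  then obtain y where C: "C \<le> B" "p C y \<noteq> 0" by (auto simp: N_def)
  have zero: "p b y = 0" if "b \<le> B" "\<not> b \<le> C" for b y
    using that Max_ge[OF fin, of b] by (auto simp: N_def C_def)
  have "(\<Sum>b\<le>C. p b (F x) * g x ^ b) = (\<Sum>b\<le>B. p b (F x) * g x ^ b)" for x
    by (rule sum.mono_neutral_left) (use C(1) zero in auto)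
  then show ?thesis using p(1) C(2) rel by metis
qed

text \<open>Dividing a relation by the largest power of \<open>g\<close> that divides it leaves a nonzero constant
  coefficient \<open>h\<close>; at a zero of \<open>g\<close> the divided relation reads \<open>h (F x) = 0\<close>.\<close>

lemma nonvanishing_certificate:
  fixes F :: "complex ^ 'q \<Rightarrow> complex ^ 'q"
  assumes F: "\<And>i. polyfun (\<lambda>x. F x $ i)" and g: "polyfun g" "g x0 \<noteq> 0"
  shows "\<exists>h y. polyfun h \<and> h y \<noteq> 0 \<and> (\<forall>x. h (F x) \<noteq> 0 \<longrightarrow> g x \<noteq> 0)"
proof -
  obtain p b0 B y0 where p: "\<And>b. polyfun (p b)" "b0 \<le> B" "p b0 y0 \<noteq> 0"
    and rel: "\<And>x. (\<Sum>b\<le>B. p b (F x) * g x ^ b) = 0"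
    using algebraic_relation[OF F g(1)] by blast
  \<comment> \<open>the relation is divisible by \<open>g ^ m\<close>, with quotient \<open>r\<close>\<close>
  define m where "m = (LEAST b. \<exists>y. p b y \<noteq> 0)"
  have "\<exists>y. p m y \<noteq> 0"
    unfolding m_def by (rule LeastI[of "\<lambda>b. \<exists>y. p b y \<noteq> 0" b0]) (use p(3) in blast)
  then obtain y where y: "p m y \<noteq> 0" ..
  have mB: "m \<le> B" unfolding m_def by (rule order_trans[OF Least_le p(2)]) (use p(3) in blast)
  have zero: "p b y = 0" if "b < m" for b y using that not_less_Least unfolding m_def by blast
  define r where "r x = (\<Sum>b\<in>{m..B}. p b (F x) * g x ^ (b - m))" for x
  have rg: "g x ^ m * r x = 0" for x
  proof -
    have "g x ^ m * r x = (\<Sum>b\<in>{m..B}. p b (F x) * g x ^ b)"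
      unfolding r_def sum_distrib_left
    proof (rule sum.cong[OF refl])
      fix b assume "b \<in> {m..B}"
      then have "g x ^ b = g x ^ m * g x ^ (b - m)" by (simp flip: power_add)
      then show "g x ^ m * (p b (F x) * g x ^ (b - m)) = p b (F x) * g x ^ b" by simp
    qed
    also have "\<dots> = (\<Sum>b\<le>B. p b (F x) * g x ^ b)"
      by (rule sum.mono_neutral_left) (use zero in auto)
    finally show ?thesis using rel by simp
  qed
  have "polyfun r"
    unfolding r_def by (intro polyfun_sum polyfun_mult polyfun_power polyfun_compose[OF p(1) F] g(1))
  have r0: "r x = 0" for x
  proof (rule ccontr)
    assume "r x \<noteq> 0"
    then obtain z where "g z \<noteq> 0" "r z \<noteq> 0"
      using polyfun_mult_nonzero[OF g(1) \<open>polyfun r\<close> g(2)] by blast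
    then show False using rg[of z] by simp
  qed
  have "g x \<noteq> 0" if h: "p m (F x) \<noteq> 0" for x
  proof
    assume "g x = 0"
    then have "r x = (\<Sum>b\<in>{m..B}. if b = m then p b (F x) else 0)"
      unfolding r_def by (intro sum.cong) auto
    also have "\<dots> = p m (F x)" using mB by simp
    finally show False using r0 h by simp
  qed
  then show ?thesis using p(1) y by blast
qed

lemma roots_bounded:
  fixes z :: "nat \<Rightarrow> complex"
  assumes a: "\<And>b. (\<lambda>k. a b k) \<longlonglongrightarrow> \<alpha> b" and lead: "\<alpha> C \<noteq> 0"
    and root: "\<And>k. (\<Sum>b\<le>C. a b k * z k ^ b) = 0"
  shows "Bseq z"
proof -
  have "(\<lambda>k. a b k / a C k) \<longlonglongrightarrow> \<alpha> b / \<alpha> C" for b by (intro tendsto_divide a lead)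
  then have "Bseq (\<lambda>k. a b k / a C k)" for b using convergent_imp_Bseq convergent_def by blast
  then have "\<forall>b. \<exists>M. \<forall>k. norm (a b k / a C k) \<le> M" unfolding Bseq_def by blast
  from choice[OF this] obtain M where M: "\<And>b k. norm (a b k / a C k) \<le> M b" by blast
  have "\<forall>\<^sub>F k in sequentially. a C k \<noteq> 0" using a lead by (rule tendsto_imp_eventually_ne)
  then have "\<forall>\<^sub>F k in sequentially. norm (z k) \<le> 1 + (\<Sum>b<C. M b)"
  proof eventually_elim
    case (elim k)
    have M0: "0 \<le> M b" for b using M[of b k] norm_ge_zero order_trans by blast
    then have S0: "0 \<le> (\<Sum>b<C. M b)" by (simp add: sum_nonneg)
    show ?case
    proof (cases "norm (z k) \<le> 1")
      case True then show ?thesis using S0 by simp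
    next
      case False
      have "a C k * z k ^ C + (\<Sum>b<C. a b k * z k ^ b) = 0"
        using root[of k] by (simp add: lessThan_Suc_atMost[symmetric] add.commute)
      then have "z k ^ C = - (\<Sum>b<C. a b k * z k ^ b) / a C k"
        using elim by (simp add: field_simps add_eq_0_iff)
      then have eq: "z k ^ C = - (\<Sum>b<C. a b k / a C k * z k ^ b)"
        by (simp add: sum_divide_distrib)
      have C0: "C \<noteq> 0"
      proof
        assume "C = 0" then show False using eq by simp
      qed
      have "norm (z k) ^ C \<le> (\<Sum>b<C. norm (a b k / a C k) * norm (z k) ^ b)"
        using norm_sum[of "\<lambda>b. a b k / a C k * z k ^ b" "{..<C}"]
        by (simp only: eq norm_minus_cancel norm_mult norm_power flip: norm_power)
      also have "\<dots> \<le> (\<Sum>b<C. M b * norm (z k) ^ (C - 1))"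
        by (intro sum_mono mult_mono M power_increasing M0) (use False in auto)
      also have "\<dots> = (\<Sum>b<C. M b) * norm (z k) ^ (C - 1)" by (simp add: sum_distrib_right)
      finally have "norm (z k) * norm (z k) ^ (C - 1) \<le> (\<Sum>b<C. M b) * norm (z k) ^ (C - 1)"
        using C0 by (metis power_eq_if)
      then have "norm (z k) \<le> (\<Sum>b<C. M b)"
        by (rule mult_right_le_imp_le) (use False in \<open>auto intro!: zero_less_power\<close>)
      then show ?thesis by simp
    qed
  qed
  then show ?thesis by (rule BfunI)
qed

text \<open>Let \<open>h\<close> be the product of the leading coefficients of relations for all coordinate functions and of
  a polynomial that certifies that the Jacobian determinant does not vanish. Over \<open>{h \<noteq> 0}\<close> the range of
  \<open>F\<close> is open, because \<open>F\<close> is a submersion there, and relatively closed, because the preimages of a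
  convergent sequence stay bounded. A complex line that contains one point of the range in \<open>{h \<noteq> 0}\<close>
  meets \<open>{h = 0}\<close> in finitely many points only, and the rest of the line is connected. Hence the range contains
  this rest, whose closure is the line. Polynomiality is essential: for entire maps the statement fails (Fatou--Bieberbach
  domains).\<close>

theorem polynomial_map_dense_range:
  fixes F :: "complex ^ 'q \<Rightarrow> complex ^ 'q"
  assumes F: "\<And>i. polyfun (\<lambda>x. F x $ i)"
    and der: "(F has_derivative F') (at x0)" and surj: "surj F'"
  shows "closure (range F) = UNIV"
proof -
  let ?R = "range F"
  have "\<forall>i. \<exists>D. (\<forall>j. polyfun (D j)) \<and>
      (\<forall>x. ((\<lambda>x. F x $ i) has_derivative (\<lambda>v. \<Sum>j\<in>UNIV. D j x * v $ j)) (at x))"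
    by (rule allI, rule polyfun_has_derivative[OF F]) blast
  from choice[OF this] obtain D where D: "\<And>i j. polyfun (D i j)"
    "\<And>i x. ((\<lambda>x. F x $ i) has_derivative (\<lambda>v. \<Sum>j\<in>UNIV. D i j x * v $ j)) (at x)" by blast
  define J :: "complex ^ 'q \<Rightarrow> complex ^ 'q ^ 'q" where "J x = (\<chi> i j. D i j x)" for x
  have derJ: "(F has_derivative (\<lambda>v. J x *v v)) (at x)" for x
    unfolding has_derivative_componentwise_within[of F]
  proof
    fix b :: "complex ^ 'q" assume "b \<in> Basis"
    then obtain i c where b: "b = axis i c" by (auto simp: Basis_vec_def)
    have "((\<lambda>x. F x $ i \<bullet> c) has_derivative (\<lambda>v. (\<Sum>j\<in>UNIV. D i j x * v $ j) \<bullet> c)) (at x)"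
      by (rule has_derivative_inner_left[OF D(2)])
    then show "((\<lambda>x. F x \<bullet> b) has_derivative (\<lambda>v. (J x *v v) \<bullet> b)) (at x)"
      by (simp add: b inner_axis J_def matrix_vector_mult_def)
  qed
  have contF: "continuous_on S F" for S
    using derJ by (meson has_derivative_continuous continuous_at_imp_continuous_on)
  have det_poly: "polyfun (\<lambda>x. det (J x))"
    unfolding det_def J_def by (simp, intro polyfun_sum polyfun_mult polyfun_prod polyfun_const D)
  have open_at: "F x \<in> interior ?R" if det: "det (J x) \<noteq> 0" for x
  proof -
    obtain K where K: "J x ** K = mat 1" using det by (metis invertible_det_nz invertible_def)
    show ?thesis
    proof (rule sussmann_open_mapping[OF open_UNIV contF _ derJ])
      show "bounded_linear ((*v) K)" by (rule matrix_vector_mul_bounded_linear)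
      show "(*v) (J x) \<circ> (*v) K = id" by (auto simp: matrix_vector_mul_assoc K)
    qed auto
  qed
  have "F' = (\<lambda>v. J x0 *v v)" using has_derivative_unique[OF der derJ] .
  then have "det (J x0) \<noteq> 0"
    using surj matrix_right_invertible_surjective[of "J x0"] invertible_right_inverse[of "J x0"] invertible_det_nz[of "J x0"] by auto
  then have F0: "F x0 \<in> interior ?R" by (rule open_at)
  obtain h0 y0 where h0: "polyfun h0" "h0 y0 \<noteq> 0" "\<And>x. h0 (F x) \<noteq> 0 \<Longrightarrow> det (J x) \<noteq> 0"
    using nonvanishing_certificate[OF F det_poly \<open>det (J x0) \<noteq> 0\<close>] by blast
  have "\<forall>j. \<exists>C p. (\<forall>b. polyfun (p b)) \<and> (\<exists>y. p C y \<noteq> 0) \<and> (\<forall>x. (\<Sum>b\<le>C. p b (F x) * (x $ j) ^ b) = 0)"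
  proof
    fix j
    show "\<exists>C p. (\<forall>b. polyfun (p b)) \<and> (\<exists>y. p C y \<noteq> 0) \<and> (\<forall>x. (\<Sum>b\<le>C. p b (F x) * (x $ j) ^ b) = 0)"
      using leading_relation[OF F polyfun_coord[of j]] by blast
  qed
  from choice[OF this] obtain C where "\<forall>j. \<exists>p. (\<forall>b. polyfun (p b)) \<and> (\<exists>y. p (C j) y \<noteq> 0) \<and>
      (\<forall>x. (\<Sum>b\<le>C j. p b (F x) * (x $ j) ^ b) = 0)" by blast
  from choice[OF this] obtain p where p: "\<And>j b. polyfun (p j b)" "\<And>j. \<exists>y. p j (C j) y \<noteq> 0"
    "\<And>j x. (\<Sum>b\<le>C j. p j b (F x) * (x $ j) ^ b) = 0" by blast
  define h where "h y = h0 y * (\<Prod>j\<in>UNIV. p j (C j) y)" for y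
  have hp: "polyfun h"
    unfolding h_def by (intro polyfun_mult h0 polyfun_prod p)
  obtain y1 where "(\<Prod>j\<in>UNIV. p j (C j) y1) \<noteq> 0"
    using polyfun_prod_nonzero[OF finite, of UNIV "\<lambda>j. p j (C j)"] p by blast
  then obtain y2 where "h y2 \<noteq> 0"
    unfolding h_def
    using polyfun_mult_nonzero[of h0 "\<lambda>y. \<Prod>j\<in>UNIV. p j (C j) y" y0 y1] h0 polyfun_prod[of UNIV "\<lambda>j. p j (C j)"] p(1)
    by (metis mult_eq_0_iff)
  then obtain y where y: "y \<in> interior ?R" "h y \<noteq> 0"
    using polyfun_nonzero_in_open[OF hp _ open_interior F0] by blast
  have inner: "y \<in> interior ?R" if "h y \<noteq> 0" "y \<in> ?R" for y
    using that open_at h0(3) by (auto simp: h_def)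
  have closed: "y \<in> ?R" if hy: "h y \<noteq> 0" and cl: "y \<in> closure ?R" for y
  proof -
    obtain s where s: "\<And>k. s k \<in> ?R" "s \<longlonglongrightarrow> y" using cl by (auto simp: closure_sequential)
    have "\<forall>k. \<exists>x. s k = F x" using s(1) by (simp add: image_iff)
    from choice[OF this] obtain x where x: "\<And>k. s k = F (x k)" by blast
    have pc: "(\<lambda>k. p j b (F (x k))) \<longlonglongrightarrow> p j b y" for j b
      using continuous_on_tendsto_compose[OF polyfun_continuous_on[OF p(1)[of j b], of UNIV] s(2)] by (simp add: x)
    have "Bseq (\<lambda>k. x k $ j)" for j
      by (rule roots_bounded[of "\<lambda>b k. p j b (F (x k))" "\<lambda>b. p j b y" "C j"])
        (use pc p(3) hy in \<open>auto simp: h_def\<close>)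
    then have "\<forall>j. \<exists>M. \<forall>k. norm (x k $ j) \<le> M" unfolding Bseq_def by blast
    from choice[OF this] obtain M where M: "\<And>j k. norm (x k $ j) \<le> M j" by blast
    have "norm (x k) \<le> (\<Sum>j\<in>UNIV. M j)" for k
      unfolding norm_vec_def
      by (rule order_trans[OF L2_set_le_sum]) (auto intro: sum_mono M)
    then have "bounded (range x)" by (auto simp: bounded_iff)
    then obtain l r where l: "strict_mono r" "(x \<circ> r) \<longlonglongrightarrow> l"
      using bounded_imp_convergent_subsequence by blast
    have "(\<lambda>k. F ((x \<circ> r) k)) \<longlonglongrightarrow> F l"
      using continuous_on_tendsto_compose[OF contF[of UNIV] l(2)] by simp
    moreover have "(\<lambda>k. F ((x \<circ> r) k)) \<longlonglongrightarrow> y"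
      using LIMSEQ_subseq_LIMSEQ[OF s(2) l(1)] by (simp add: o_def x)
    ultimately show ?thesis using LIMSEQ_unique by blast
  qed
  have "g \<in> closure ?R" for g
  proof (rule ccontr)
    assume g: "g \<notin> closure ?R"
    define L where "L t = y + t *s (g - y)" for t :: complex
    have contL: "continuous_on UNIV L"
      unfolding L_def vector_scalar_mult_def by (intro continuous_intros)
    obtain q where q: "\<And>t. h (L t) = poly q t" using polyfun_on_line[OF hp, of y "g - y"] unfolding L_def by blast
    have "poly q 0 \<noteq> 0" using q[of 0] y(2) by (simp add: L_def)
    then have "q \<noteq> 0" by auto
    then have fin: "finite {t. poly q t = 0}" by (rule poly_roots_finite)
    let ?T = "UNIV - {t. poly q t = 0}"
    have conn: "connected ?T" by (rule connected_open_delete_finite[OF open_UNIV connected_UNIV _ fin]) simp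
    let ?U = "L -` interior ?R" and ?V = "L -` (- closure ?R)"
    have oU: "open ?U" and oV: "open ?V"
      using contL by (auto intro!: open_vimage)
    have "t \<in> ?U \<union> ?V" if "t \<in> ?T" for t
    proof -
      have "h (L t) \<noteq> 0" using that q by simp
      then show ?thesis using closed[of "L t"] inner[of "L t"] by blast
    qed
    then have "?T \<subseteq> ?U \<union> ?V" by blast
    moreover have "?U \<inter> ?V \<inter> ?T = {}"
      using subset_trans[OF interior_subset[of ?R] closure_subset[of ?R]] by blast
    moreover have "0 \<in> ?U \<inter> ?T" using y q[of 0] by (simp add: L_def)
    ultimately have "?V \<inter> ?T = {}" using connectedD[OF conn oU oV] by blast
    then have "finite ?V" using fin by (auto intro: finite_subset)
    moreover have "1 \<in> ?V" using g by (simp add: L_def)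
    ultimately show False using oV finite_imp_not_open by blast
  qed
  then show ?thesis by blast
qed


section \<open>First and second variation at a local minimizer\<close>

text \<open>The hypotheses say that \<open>T\<close> maps \<open>W\<close> to its orthogonal complement and vanishes on the
  complement, so the image is the graph of \<open>t T\<close> over \<open>W\<close>. With \<open>K = P + t T\<close> its
  projection is \<open>K (K\<^sup>* K)\<^sup>-\<^sup>1 K\<^sup>*\<close>, where the inverse is taken on \<open>W\<close>, and
  there \<open>K\<^sup>* K = 1 + t\<^sup>2 T\<^sup>* T\<close>. The expansion is an exact identity with a continuous
  quadratic coefficient, so second order terms can be read off without differentiating twice.\<close>

lemma graph_projection:
  fixes W :: "(complex ^ 'n) set"
  assumes W: "vec.subspace W" and T: "T ** orth_proj W = T" "orth_proj W ** T = 0"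
  shows "\<exists>C. (C \<longlongrightarrow> T ** adj T - adj T ** T) (at 0) \<and>
    (\<forall>t. orth_proj ((*v) (mat 1 + t *\<^sub>R T) ` W) =
      orth_proj W + t *\<^sub>R (T + adj T) + t\<^sup>2 *\<^sub>R C t)"
proof -
  let ?P = "orth_proj W"
  note P = adj_orth_proj[OF W] orth_proj_idem[OF W]
  define A where "A = adj T ** T"
  have T': "?P ** adj T = adj T" "adj T ** ?P = 0"
    using arg_cong[OF T(1), of adj] arg_cong[OF T(2), of adj] by (simp_all add: adj_mult P)
  have adjA: "adj A = A" by (simp add: A_def adj_mult)
  have AP: "A ** ?P = A" "?P ** A = A"
    by (simp_all add: A_def matrix_mul_assoc T') (simp add: matrix_mul_assoc[symmetric] T)
  have pos: "M \<bullet> (A ** M) = norm (T ** M) ^ 2" for M :: "complex ^ 'n ^ 'n"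
    by (simp add: A_def matrix_mul_assoc[symmetric] power2_norm_eq_inner inner_mult_left[of T M])
  have "\<exists>Z. (mat 1 + t\<^sup>2 *\<^sub>R A) ** Z = mat 1 \<and> Z ** (mat 1 + t\<^sup>2 *\<^sub>R A) = mat 1" for t
  proof -
    have "invertible (mat 1 + t\<^sup>2 *\<^sub>R A)"
    proof (rule matrix_invertible_if_injective)
      fix x assume "(mat 1 + t\<^sup>2 *\<^sub>R A) *v x = 0"
      then have "x + t\<^sup>2 *\<^sub>R (A *v x) = 0"
        by (simp add: matrix_vector_mult_add_rdistrib scaleR_matrix_vector)
      then have "x \<bullet> x + t\<^sup>2 * ((A *v x) \<bullet> x) = 0"
        by (metis inner_add_left inner_scaleR_left inner_zero_left)
      moreover have "(A *v x) \<bullet> x = (T *v x) \<bullet> (T *v x)"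
        unfolding inner_eq_Re_cinner A_def by (simp add: cinner_adj flip: matrix_vector_mul_assoc)
      ultimately have "x \<bullet> x = 0"
        by (metis add_nonneg_eq_0_iff inner_ge_zero mult_nonneg_nonneg zero_le_power2)
      then show "x = 0" by simp
    qed
    then show ?thesis by (simp add: invertible_def)
  qed
  then obtain Z where Z: "\<And>t. (mat 1 + t\<^sup>2 *\<^sub>R A) ** Z t = mat 1" "\<And>t. Z t ** (mat 1 + t\<^sup>2 *\<^sub>R A) = mat 1"
    by metis
  have Z1: "Z t = mat 1 - t\<^sup>2 *\<^sub>R (A ** Z t)" for t
    using Z(1)[of t] by (simp add: matrix_algebra algebra_simps)
  have adjZ: "adj (Z t) = Z t" for t
  proof -
    have "adj (Z t) ** (mat 1 + t\<^sup>2 *\<^sub>R A) = mat 1"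
      using arg_cong[OF Z(1)[of t], of adj] by (simp add: adj_mult adj_add adj_scaleR adjA)
    then have "adj (Z t) ** ((mat 1 + t\<^sup>2 *\<^sub>R A) ** Z t) = Z t" by (simp add: matrix_mul_assoc)
    then show ?thesis by (simp add: Z)
  qed
  \<comment> \<open>pair \<open>Z + t\<^sup>2 A Z = 1\<close> with \<open>Z\<close> and drop the nonnegative
    second term\<close>
  have normZ: "norm (Z t) \<le> norm (mat 1 :: complex ^ 'n ^ 'n)" for t
  proof -
    have "Z t + t\<^sup>2 *\<^sub>R (A ** Z t) = mat 1" using Z1[of t] by (metis add_diff_cancel diff_add_cancel)
    then have "Z t \<bullet> Z t + t\<^sup>2 * (Z t \<bullet> (A ** Z t)) = Z t \<bullet> mat 1"
      by (metis inner_add_right inner_scaleR_right)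
    then have "(norm (Z t))\<^sup>2 \<le> Z t \<bullet> mat 1"
      by (simp add: pos power2_norm_eq_inner[symmetric])
        (metis add_increasing2 le_add_same_cancel1 mult_nonneg_nonneg order.refl order.trans zero_le_power2)
    also have "\<dots> \<le> norm (Z t) * norm (mat 1 :: complex ^ 'n ^ 'n)" by (rule norm_cauchy_schwarz)
    finally show ?thesis
      by (metis linorder_not_le mult.commute mult_le_cancel_right norm_ge_zero power2_eq_square zero_less_norm_iff norm_zero)
  qed
  have Zlim: "(Z \<longlongrightarrow> mat 1) (at 0)"
  proof -
    have "((\<lambda>t. Z t - mat 1) \<longlongrightarrow> 0) (at 0)"
    proof (rule Lim_null_comparison)
      show "\<forall>\<^sub>F t in at 0. norm (Z t - mat 1) \<le> t\<^sup>2 * (norm A * norm (mat 1 :: complex ^ 'n ^ 'n))"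
      proof (rule always_eventually, rule allI)
        fix t
        have "norm (Z t - mat 1) = t\<^sup>2 * norm (A ** Z t)"
          by (subst Z1) simp
        also have "norm (A ** Z t) \<le> norm A * norm (mat 1 :: complex ^ 'n ^ 'n)"
          by (rule order_trans[OF norm_matrix_mult_le mult_left_mono[OF normZ norm_ge_zero]])
        finally show "norm (Z t - mat 1) \<le> t\<^sup>2 * (norm A * norm (mat 1 :: complex ^ 'n ^ 'n))"
          by (simp add: mult_left_mono)
      qed
      have "((\<lambda>t::real. t\<^sup>2 * (norm A * norm (mat 1 :: complex ^ 'n ^ 'n))) \<longlongrightarrow> 0\<^sup>2 * (norm A * norm (mat 1 :: complex ^ 'n ^ 'n))) (at 0)"
        by (intro tendsto_intros)
      then show "((\<lambda>t::real. t\<^sup>2 * (norm A * norm (mat 1 :: complex ^ 'n ^ 'n))) \<longlongrightarrow> 0) (at 0)" by simp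
    qed
    then show ?thesis by (rule LIM_zero_cancel)
  qed
  define K where "K t = ?P + t *\<^sub>R T" for t :: real
  define C where "C t = T ** adj T - K t ** A ** Z t ** adj (K t)" for t
  have adjK: "adj (K t) = ?P + t *\<^sub>R adj T" for t by (simp add: K_def adj_add adj_scaleR P)
  have Klim: "(K \<longlongrightarrow> ?P) (at 0)"
  proof -
    have "((\<lambda>t. ?P + t *\<^sub>R T) \<longlongrightarrow> ?P + 0 *\<^sub>R T) (at 0)" by (intro tendsto_intros)
    then show ?thesis by (simp add: K_def[abs_def])
  qed
  have "(C \<longlongrightarrow> T ** adj T - ?P ** A ** mat 1 ** adj ?P) (at 0)"
    unfolding C_def[abs_def]
    by (intro tendsto_diff tendsto_const tendsto_matrix_mult tendsto_adj Klim Zlim)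
  then have Clim: "(C \<longlongrightarrow> T ** adj T - adj T ** T) (at 0)"
    by (simp add: P AP) (simp add: A_def)
  have "orth_proj ((*v) (mat 1 + t *\<^sub>R T) ` W) = ?P + t *\<^sub>R (T + adj T) + t\<^sup>2 *\<^sub>R C t" for t
  proof -
    let ?G = "mat 1 + t *\<^sub>R T" and ?Q = "K t ** Z t ** adj (K t)"
    have GK: "?G ** ?P = K t" by (simp add: K_def matrix_algebra T)
    have KK: "adj (K t) ** K t = (mat 1 + t\<^sup>2 *\<^sub>R A) ** ?P"
      unfolding adjK by (simp add: K_def matrix_algebra T T' P AP) (simp add: A_def power2_eq_square)
    have fix_K: "?Q ** K t = K t"
    proof -
      have "?Q ** K t = K t ** (Z t ** (mat 1 + t\<^sup>2 *\<^sub>R A)) ** ?P"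
        using KK by (metis matrix_mul_assoc)
      also have "\<dots> = K t" by (simp add: Z) (simp add: K_def matrix_algebra T P)
      finally show ?thesis .
    qed
    have "orth_proj ((*v) ?G ` W) = ?Q"
    proof (rule orth_proj_eqI)
      show "vec.subspace ((*v) ?G ` W)" using W by (rule subspace_image)
      show "adj ?Q = ?Q" by (simp add: adj_mult adjZ matrix_mul_assoc)
      show "?Q *v x \<in> (*v) ?G ` W" for x
      proof -
        have "?Q *v x = ?G *v (?P *v (Z t *v (adj (K t) *v x)))"
          by (simp add: matrix_vector_mul_assoc GK matrix_mul_assoc)
        then show ?thesis using orth_proj_in[OF W] by auto
      qed
      fix y assume "y \<in> (*v) ?G ` W"
      then obtain u where u: "u \<in> W" "y = ?G *v u" by auto
      then have "y = K t *v u" by (metis GK matrix_vector_mul_assoc orth_proj_fix[OF W])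
      then show "?Q *v y = y" by (simp add: matrix_vector_mul_assoc fix_K)
    qed
    also have "?Q = K t ** adj (K t) - t\<^sup>2 *\<^sub>R (K t ** A ** Z t ** adj (K t))"
      by (subst Z1) (simp add: matrix_algebra)
    also have "K t ** adj (K t) = ?P + t *\<^sub>R (T + adj T) + t\<^sup>2 *\<^sub>R (T ** adj T)"
      unfolding adjK by (simp add: K_def matrix_algebra T T' P power2_eq_square scaleR_add_right)
    finally show ?thesis by (simp add: C_def algebra_simps)
  qed
  then show ?thesis using Clim by blast
qed

text \<open>The inverse is \<open>mat 1 - t *\<^sub>R T\<close>.\<close>

lemma graph_map_invertible:
  fixes T :: "complex ^ 'n ^ 'n"
  assumes "T ** T = 0" shows "invertible (mat 1 + t *\<^sub>R T)"
proof -
  have "(mat 1 + t *\<^sub>R T) ** (mat 1 - t *\<^sub>R T) = mat 1" by (simp add: matrix_algebra assms)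
  then show ?thesis using invertible_right_inverse by blast
qed

text \<open>Small motions of the subspaces change the frame operator little, so they stay in the neighbourhood of
  \<open>W\<close> for the pseudo-distance; the two parts are the signs of the coefficients of \<open>t\<close> and, if that
  one vanishes together with \<open>B\<close>, of \<open>t\<^sup>2\<close> in the potential.\<close>

lemma local_minimizer_variation:
  fixes W :: "'m::finite \<Rightarrow> (complex ^ 'n) set"
  assumes min: "local_minimizer d w W"
    and T: "\<And>i. T i ** orth_proj (W i) = T i" "\<And>i. orth_proj (W i) ** T i = 0"
  defines "B \<equiv> \<Sum>i\<in>UNIV. (w i)\<^sup>2 *\<^sub>R (T i + adj (T i))"
  shows "0 \<le> frame_op w W \<bullet> B"
    and "B = 0 \<Longrightarrow> 0 \<le> frame_op w W \<bullet> (\<Sum>i\<in>UNIV. (w i)\<^sup>2 *\<^sub>R (T i ** adj (T i) - adj (T i) ** T i))"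
proof -
  let ?S = "frame_op w W"
  have W: "vec.subspace (W i)" "vec.dim (W i) = d i" for i
    using min by (auto simp: local_minimizer_def subspace_families_def)
  have "\<forall>i. \<exists>C. (C \<longlongrightarrow> T i ** adj (T i) - adj (T i) ** T i) (at 0) \<and>
    (\<forall>t. orth_proj ((*v) (mat 1 + t *\<^sub>R T i) ` W i) =
      orth_proj (W i) + t *\<^sub>R (T i + adj (T i)) + t\<^sup>2 *\<^sub>R C t)"
    using graph_projection[OF W(1) T] by blast
  from choice[OF this] obtain C where C: "\<And>i. (C i \<longlongrightarrow> T i ** adj (T i) - adj (T i) ** T i) (at 0)"
    "\<And>i t. orth_proj ((*v) (mat 1 + t *\<^sub>R T i) ` W i) =
      orth_proj (W i) + t *\<^sub>R (T i + adj (T i)) + t\<^sup>2 *\<^sub>R C i t" by blast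
  define D where "D t = (\<Sum>i\<in>UNIV. (w i)\<^sup>2 *\<^sub>R C i t)" for t
  define D0 where "D0 = (\<Sum>i\<in>UNIV. (w i)\<^sup>2 *\<^sub>R (T i ** adj (T i) - adj (T i) ** T i))"
  have Dlim: "(D \<longlongrightarrow> D0) (at 0)"
    unfolding D_def[abs_def] D0_def by (intro tendsto_intros C)
  define V where "V t i = (*v) (mat 1 + t *\<^sub>R T i) ` W i" for t :: real and i
  have TT: "T i ** T i = 0" for i
    by (metis T matrix_mul_assoc matrix_zero_right)
  have V: "V t \<in> subspace_families d" for t
    unfolding subspace_families_def V_def
    using W by (auto intro: subspace_image simp: dim_image_invertible graph_map_invertible[OF TT])
  have SV: "frame_op w (V t) = ?S + t *\<^sub>R B + t\<^sup>2 *\<^sub>R D t" for t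
    by (simp add: frame_op_def V_def C(2) B_def D_def scaleR_add_right sum.distrib scaleR_sum_right ac_simps)
  define f where "f t = 2 * (?S \<bullet> B) + t * (B \<bullet> B + 2 * (?S \<bullet> D t)) + 2 * t\<^sup>2 * (B \<bullet> D t) + t ^ 3 * (D t \<bullet> D t)" for t
  \<comment> \<open>\<open>f\<close> and, if \<open>B = 0\<close>, \<open>g\<close> below are the difference
    quotients of first and second order of the potential\<close>
  have ffpV: "ffp w (V t) = ffp w W + t * f t" for t
    unfolding ffp_eq_inner[OF W(1)] 
    using V[of t] ffp_eq_inner[of "V t" w]
    by (simp add: subspace_families_def SV f_def inner_add_left inner_add_right inner_commute
        algebra_simps power2_eq_square power3_eq_cube)
  obtain \<epsilon> where \<epsilon>: "\<epsilon> > 0" "\<And>V. V \<in> subspace_families d \<Longrightarrow> dist_S w W V < \<epsilon> \<Longrightarrow> ffp w W \<le> ffp w V"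
    using min by (auto simp: local_minimizer_def)
  have "((\<lambda>t. norm (?S - frame_op w (V t))) \<longlongrightarrow> norm (?S - (?S + 0 *\<^sub>R B + 0\<^sup>2 *\<^sub>R D0))) (at 0)"
    unfolding SV by (intro tendsto_intros Dlim)
  then have "\<forall>\<^sub>F t in at 0. norm (?S - frame_op w (V t)) < \<epsilon>"
    using \<epsilon>(1) by (intro order_tendstoD(2)) auto
  then have ev: "\<forall>\<^sub>F t in at 0. 0 \<le> t * f t"
  proof eventually_elim
    case (elim t)
    then show ?case using \<epsilon>(2)[OF V[of t]] dist_S_le[of w W "V t"] ffpV[of t] by linarith
  qed
  have "\<forall>\<^sub>F t in at_right 0. 0 \<le> t * f t"
    by (rule filter_leD[OF at_le[OF subset_UNIV] ev])
  then have evr: "\<forall>\<^sub>F t in at_right 0. 0 \<le> f t"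
    using eventually_at_right_less[of "0::real"] by eventually_elim (simp add: zero_le_mult_iff)
  have "(f \<longlongrightarrow> 2 * (?S \<bullet> B) + 0 * (B \<bullet> B + 2 * (?S \<bullet> D0)) + 2 * 0\<^sup>2 * (B \<bullet> D0) + 0 ^ 3 * (D0 \<bullet> D0)) (at 0)"
    unfolding f_def[abs_def] by (intro tendsto_intros Dlim)
  then have "(f \<longlongrightarrow> 2 * (?S \<bullet> B)) (at_right 0)"
    by (simp add: tendsto_mono[OF at_le[OF subset_UNIV]] )
  then have "0 \<le> 2 * (?S \<bullet> B)"
    by (rule tendsto_lowerbound[OF _ evr]) simp
  then show "0 \<le> ?S \<bullet> B" by simp
  assume B0: "B = 0"
  define g where "g t = 2 * (?S \<bullet> D t) + t\<^sup>2 * (D t \<bullet> D t)" for t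
  have "t * f t = t\<^sup>2 * g t" for t
    by (simp add: f_def g_def B0 power2_eq_square power3_eq_cube algebra_simps)
  then have "\<forall>\<^sub>F t in at 0. 0 \<le> g t"
    using ev unfolding eventually_at_filter
    by (auto elim!: eventually_mono simp: zero_le_mult_iff)
  moreover have "(g \<longlongrightarrow> 2 * (?S \<bullet> D0) + 0\<^sup>2 * (D0 \<bullet> D0)) (at 0)"
    unfolding g_def[abs_def] by (intro tendsto_intros Dlim)
  ultimately have "0 \<le> 2 * (?S \<bullet> D0) + 0\<^sup>2 * (D0 \<bullet> D0)"
    by (intro tendsto_lowerbound[of g _ "at 0"]) auto
  then show "0 \<le> ?S \<bullet> (\<Sum>i\<in>UNIV. (w i)\<^sup>2 *\<^sub>R (T i ** adj (T i) - adj (T i) ** T i))"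
    by (simp add: D0_def)
qed

text \<open>Move only \<open>W i\<close>, in the direction of the negative off-diagonal block \<open>R\<close> of the frame
  operator with respect to \<open>W i\<close>: the derivative of the potential is then a negative multiple of the squared
  norm of \<open>R\<close>.\<close>

lemma local_minimizer_commutes:
  fixes W :: "'m::finite \<Rightarrow> (complex ^ 'n) set"
  assumes min: "local_minimizer d w W" and w: "w i > 0"
  shows "orth_proj (W i) ** frame_op w W = frame_op w W ** orth_proj (W i)"
proof -
  let ?S = "frame_op w W" and ?P = "orth_proj (W i)"
  have W: "vec.subspace (W i)" for i
    using min by (auto simp: local_minimizer_def subspace_families_def)
  note P = adj_orth_proj[OF W] orth_proj_idem[OF W]
  have adjS: "adj ?S = ?S" by (rule adj_frame_op) (rule W)
  define R where "R = ?S ** ?P - ?P ** ?S ** ?P"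
  define T where "T j = (if j = i then - R else 0)" for j
  have RP: "R ** ?P = R" "?P ** R = 0"
    by (simp_all add: R_def matrix_algebra P) (simp add: matrix_mul_assoc P)
  have "0 \<le> ?S \<bullet> (\<Sum>j\<in>UNIV. (w j)\<^sup>2 *\<^sub>R (T j + adj (T j)))"
    by (rule local_minimizer_variation(1)[OF min])
      (auto simp: T_def RP matrix_uminus_left matrix_uminus_right matrix_zero_left matrix_zero_right)
  also have "(\<Sum>j\<in>UNIV. (w j)\<^sup>2 *\<^sub>R (T j + adj (T j))) = (\<Sum>j\<in>UNIV. if j = i then - ((w i)\<^sup>2 *\<^sub>R (R + adj R)) else 0)"
    by (rule sum.cong) (auto simp: T_def adj_uminus algebra_simps)
  also have "\<dots> = - ((w i)\<^sup>2 *\<^sub>R (R + adj R))" by simp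
  also have "?S \<bullet> (- ((w i)\<^sup>2 *\<^sub>R (R + adj R))) = - ((w i)\<^sup>2 * (2 * (?S \<bullet> R)))"
    using inner_adj[of ?S R] by (simp add: adjS inner_add_right)
  finally have "?S \<bullet> R \<le> 0" using w by (simp add: mult_le_0_iff zero_le_mult_iff)
  moreover have "R \<bullet> R = ?S \<bullet> R"
  proof -
    have "R \<bullet> R = (?S ** ?P) \<bullet> R - (?P ** ?S ** ?P) \<bullet> R"
      by (subst R_def) (simp add: inner_diff_left)
    also have "(?S ** ?P) \<bullet> R = ?S \<bullet> R" by (simp add: inner_mult_right P RP)
    also have "(?P ** ?S ** ?P) \<bullet> R = 0"
      by (simp add: inner_mult_left P RP flip: matrix_mul_assoc)
    finally show ?thesis by simp
  qed
  ultimately have "R = 0" by (metis inner_ge_zero inner_eq_zero_iff order_antisym)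
  then have SP: "?S ** ?P = ?P ** ?S ** ?P" by (simp add: R_def)
  then have "adj (?S ** ?P) = adj (?P ** ?S ** ?P)" by simp
  then have "?P ** ?S = ?P ** ?S ** ?P" by (simp add: adj_mult P adjS matrix_mul_assoc)
  then show ?thesis using SP by simp
qed


section \<open>Lowering maps and factorizations of nearby families\<close>

text \<open>The part of \<open>A\<close> that maps eigenvectors of \<open>diag_mat lam\<close> to eigenvectors with strictly
  smaller eigenvalue. Only the order of the values of \<open>lam\<close> matters; the index type itself carries no
  order.\<close>

definition strict_lower :: "('n \<Rightarrow> real) \<Rightarrow> complex ^ 'n ^ 'n \<Rightarrow> complex ^ 'n ^ 'n" where
  "strict_lower lam A = (\<chi> a b. if lam a < lam b then A $ a $ b else 0)"

definition block_diag :: "('n \<Rightarrow> real) \<Rightarrow> complex ^ 'n ^ 'n \<Rightarrow> bool" where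
  "block_diag lam A \<longleftrightarrow> (\<forall>a b. lam a \<noteq> lam b \<longrightarrow> A $ a $ b = 0)"

lemma strict_lower_nth: "strict_lower lam A $ a $ b = (if lam a < lam b then A $ a $ b else 0)"
  by (simp add: strict_lower_def)

lemma strict_lower_low [simp]: "strict_lower lam (strict_lower lam A) = strict_lower lam A" by (simp add: vec_eq_iff strict_lower_nth)
lemma strict_lower_add: "strict_lower lam (A + B) = strict_lower lam A + strict_lower lam B" by (simp add: vec_eq_iff strict_lower_nth)
lemma strict_lower_diff: "strict_lower lam (A - B) = strict_lower lam A - strict_lower lam B" by (simp add: vec_eq_iff strict_lower_nth)
lemma strict_lower_scaleR: "strict_lower lam (c *\<^sub>R A) = c *\<^sub>R strict_lower lam A" by (simp add: vec_eq_iff strict_lower_nth)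
lemma strict_lower_sum: "strict_lower lam (\<Sum>i\<in>I. f i) = (\<Sum>i\<in>I. strict_lower lam (f i))"
  by (simp add: vec_eq_iff strict_lower_nth sum_component)
lemma strict_lower_block: "block_diag lam B \<Longrightarrow> strict_lower lam B = 0"
  by (auto simp: vec_eq_iff strict_lower_nth block_diag_def)

lemma strict_lower_mult_right: "block_diag lam B \<Longrightarrow> strict_lower lam (A ** B) = strict_lower lam A ** B"
proof -
  assume B: "block_diag lam B"
  have "strict_lower lam (A ** B) $ a $ c = (strict_lower lam A ** B) $ a $ c" for a c
  proof -
    have "strict_lower lam (A ** B) $ a $ c = (\<Sum>b\<in>UNIV. if lam a < lam c then A $ a $ b * B $ b $ c else 0)"
      by (simp add: strict_lower_nth matrix_matrix_mult_def)
    also have "\<dots> = (\<Sum>b\<in>UNIV. strict_lower lam A $ a $ b * B $ b $ c)"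
      by (rule sum.cong) (use B in \<open>auto simp: strict_lower_nth block_diag_def\<close>)
    finally show ?thesis by (simp add: matrix_matrix_mult_def)
  qed
  then show ?thesis by (simp add: vec_eq_iff)
qed

lemma strict_lower_mult_left: "block_diag lam B \<Longrightarrow> strict_lower lam (B ** A) = B ** strict_lower lam A"
proof -
  assume B: "block_diag lam B"
  have "strict_lower lam (B ** A) $ a $ c = (B ** strict_lower lam A) $ a $ c" for a c
  proof -
    have "strict_lower lam (B ** A) $ a $ c = (\<Sum>b\<in>UNIV. if lam a < lam c then B $ a $ b * A $ b $ c else 0)"
      by (simp add: strict_lower_nth matrix_matrix_mult_def)
    also have "\<dots> = (\<Sum>b\<in>UNIV. B $ a $ b * strict_lower lam A $ b $ c)"
      by (rule sum.cong) (use B in \<open>auto simp: strict_lower_nth block_diag_def\<close>)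
    finally show ?thesis by (simp add: matrix_matrix_mult_def)
  qed
  then show ?thesis by (simp add: vec_eq_iff)
qed

lemma strict_lower_inner: "strict_lower lam A \<bullet> B = A \<bullet> strict_lower lam B"
  unfolding inner_vec_def by (intro sum.cong refl) (simp add: strict_lower_nth)

lemma commute_diag_imp_block:
  assumes "P ** diag_mat lam = diag_mat lam ** P" shows "block_diag lam P"
  unfolding block_diag_def
proof (intro allI impI)
  fix a b assume "lam a \<noteq> lam b"
  moreover have "(P ** diag_mat lam) $ a $ b = (diag_mat lam ** P) $ a $ b" by (simp add: assms)
  ultimately show "P $ a $ b = 0" by (simp add: diag_mat_mult_left diag_mat_mult_right)
qed

text \<open>The condition on projections \<open>P\<close> that the second variation yields at a local minimizer. Each
  \<open>T i\<close> describes a motion of the range of \<open>P i\<close> that lowers eigenvalues, and the weighted sum,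
  together with its adjoint, is the first order change of the frame operator.\<close>

definition no_lowering_relation ::
    "('n \<Rightarrow> real) \<Rightarrow> ('m::finite \<Rightarrow> real) \<Rightarrow> ('m \<Rightarrow> complex ^ 'n ^ 'n) \<Rightarrow> bool" where
  "no_lowering_relation lam w P \<longleftrightarrow>
    (\<forall>T. (\<forall>i. T i ** P i = T i \<and> P i ** T i = 0 \<and> strict_lower lam (T i) = T i) \<longrightarrow>
      (\<Sum>i\<in>UNIV. (w i)\<^sup>2 *\<^sub>R T i) = 0 \<longrightarrow> (\<forall>i. T i = 0))"

text \<open>Dual form of \<open>no_lowering_relation\<close>: what cannot be reached by a common matrix \<open>X\<close> is,
  after orthogonal projection, a family \<open>T\<close> orthogonal to all constant families, and orthogonality means exactly
  \<open>\<Sum> w\<^sub>i\<^sup>2 T\<^sub>i = 0\<close>. The map \<open>A \<mapsto> (mat 1 - P i) ** strict_lower lam A ** P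
  i\<close> is an orthogonal projection of the space of matrices because \<open>P i\<close> is block diagonal.\<close>

lemma lowering_surjective:
  fixes P :: "'m::finite \<Rightarrow> complex ^ 'n ^ 'n" and w :: "'m \<Rightarrow> real"
  assumes P: "\<And>i. adj (P i) = P i" "\<And>i. P i ** P i = P i" "\<And>i. block_diag lam (P i)"
    and w: "\<And>i. w i > 0"
    and stable: "no_lowering_relation lam w P"
  shows "\<exists>X. \<forall>i. (mat 1 - P i) ** strict_lower lam (Z i - X) ** P i = 0"
proof -
  define pr where "pr i A = (mat 1 - P i) ** strict_lower lam A ** P i" for i and A :: "complex ^ 'n ^ 'n"
  \<comment> \<open>one factor \<open>w i\<close> in the map and one in the residual \<open>r\<close> below
    produce the weights \<open>(w i)\<^sup>2\<close>\<close>
  define \<phi> where "\<phi> X = (\<chi> i. w i *\<^sub>R pr i X)" for X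
  have pr_diff: "pr i (A - B) = pr i A - pr i B" for i A B
    by (simp add: pr_def strict_lower_diff matrix_algebra)
  have lin: "linear \<phi>"
    by (rule linearI) (simp_all add: \<phi>_def pr_def strict_lower_add strict_lower_scaleR matrix_algebra vec_eq_iff algebra_simps)
  have sub: "subspace (range \<phi>)" using linear_subspace_image[OF lin subspace_UNIV] .
  define z where "z = (\<chi> i. w i *\<^sub>R pr i (Z i))"
  obtain y r where y: "y \<in> span (range \<phi>)" and r: "\<And>v. v \<in> span (range \<phi>) \<Longrightarrow> orthogonal r v" and z: "z = y + r"
    using orthogonal_subspace_decomp_exists[of "range \<phi>" z] by metis
  have "span (range \<phi>) = range \<phi>" by (simp only: span_eq_iff sub)
  with y have "y \<in> range \<phi>" by (simp only:)
  then obtain X where X: "y = \<phi> X" by (rule rangeE)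
  have ri: "r $ i = w i *\<^sub>R pr i (Z i - X)" for i
  proof -
    have "r = z - \<phi> X" using z X by simp
    then show ?thesis by (simp add: z_def \<phi>_def pr_diff scaleR_diff_right)
  qed
  define T where "T i = pr i (Z i - X)" for i
  have TP: "T i ** P i = T i" "P i ** T i = 0" "strict_lower lam (T i) = T i" for i
  proof -
    show "T i ** P i = T i" by (simp add: T_def pr_def P flip: matrix_mul_assoc)
    show "P i ** T i = 0" by (simp add: T_def pr_def matrix_algebra P) (simp add: matrix_mul_assoc P)
    have "T i = strict_lower lam ((mat 1 - P i) ** (Z i - X) ** P i)"
      by (simp add: T_def pr_def strict_lower_mult_right P strict_lower_diff strict_lower_mult_left matrix_diff_rdistrib)
    then show "strict_lower lam (T i) = T i" by simp
  qed
  have "(\<Sum>i\<in>UNIV. (w i)\<^sup>2 *\<^sub>R T i) = 0" (is "?Y = 0")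
  proof -
    have "orthogonal r (\<phi> ?Y)" by (intro r span_base) simp
    then have "0 = (\<Sum>i\<in>UNIV. (w i *\<^sub>R T i) \<bullet> (w i *\<^sub>R pr i ?Y))"
      by (simp add: orthogonal_def inner_vec_def[of r] ri \<phi>_def T_def)
    also have "\<dots> = (\<Sum>i\<in>UNIV. ((w i)\<^sup>2 *\<^sub>R T i) \<bullet> ?Y)"
    proof (rule sum.cong[OF refl])
      fix i
      have "T i \<bullet> pr i ?Y = pr i ?Y \<bullet> T i" by (rule inner_commute)
      also have "\<dots> = strict_lower lam ?Y \<bullet> ((mat 1 - P i) ** T i ** P i)"
        unfolding pr_def inner_mult_right[of _ "P i"] inner_mult_left[of "mat 1 - P i"] by (simp add: adj_diff P matrix_mul_assoc)
      also have "(mat 1 - P i) ** T i ** P i = T i" by (simp add: matrix_algebra TP matrix_zero_left)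
      also have "strict_lower lam ?Y \<bullet> T i = T i \<bullet> ?Y" using strict_lower_inner[of lam ?Y "T i"] TP by (simp add: inner_commute)
      finally show "(w i *\<^sub>R T i) \<bullet> (w i *\<^sub>R pr i ?Y) = ((w i)\<^sup>2 *\<^sub>R T i) \<bullet> ?Y"
        by (simp add: power2_eq_square)
    qed
    also have "\<dots> = ?Y \<bullet> ?Y" by (simp only: inner_sum_left)
    finally show ?thesis by simp
  qed
  then have "T i = 0" for i using stable TP unfolding no_lowering_relation_def by blast
  then show ?thesis unfolding T_def pr_def by blast
qed

definition polymat :: "(complex ^ 'q \<Rightarrow> complex ^ 'n ^ 'n) \<Rightarrow> bool" where
  "polymat F \<longleftrightarrow> (\<forall>a b. polyfun (\<lambda>y. F y $ a $ b))"

lemma polymat_const: "polymat (\<lambda>y. A)" by (simp add: polymat_def polyfun_const)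
lemma polymat_add: "polymat F \<Longrightarrow> polymat G \<Longrightarrow> polymat (\<lambda>y. F y + G y)"
  by (simp add: polymat_def polyfun_add)
lemma polymat_diff: "polymat F \<Longrightarrow> polymat G \<Longrightarrow> polymat (\<lambda>y. F y - G y)"
  by (simp add: polymat_def polyfun_diff)
lemma polymat_mult: "polymat F \<Longrightarrow> polymat G \<Longrightarrow> polymat (\<lambda>y. F y ** G y)"
  by (auto simp: polymat_def matrix_matrix_mult_def intro!: polyfun_sum polyfun_mult)
lemma polymat_low: "polymat F \<Longrightarrow> polymat (\<lambda>y. strict_lower lam (F y))"
  unfolding polymat_def strict_lower_nth
proof (intro allI)
  fix a b assume F: "\<forall>a b. polyfun (\<lambda>y. F y $ a $ b)"
  show "polyfun (\<lambda>y. if lam a < lam b then F y $ a $ b else 0)"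
    by (cases "lam a < lam b") (simp_all add: F polyfun_const)
qed

text \<open>A complex multiple of a matrix; \<open>*\<^sub>R\<close> takes real factors only, and complex linear combinations
  are needed to stay within polynomials in complex variables.\<close>

definition cscale :: "complex \<Rightarrow> complex ^ 'n ^ 'n \<Rightarrow> complex ^ 'n ^ 'n" where
  "cscale c A = (\<chi> a b. c * A $ a $ b)"

lemma cscale_nth [simp]: "cscale c A $ a $ b = c * A $ a $ b" by (simp add: cscale_def)
lemma cscale_mult_left: "cscale c A ** B = cscale c (A ** B)"
  by (simp add: vec_eq_iff matrix_matrix_mult_def sum_distrib_left mult.assoc)
lemma cscale_mult_right: "A ** cscale c B = cscale c (A ** B)"
  by (simp add: vec_eq_iff matrix_matrix_mult_def sum_distrib_left ac_simps)
lemma strict_lower_cscale: "strict_lower lam (cscale c A) = cscale c (strict_lower lam A)"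
  by (simp add: vec_eq_iff strict_lower_nth)

text \<open>By \<open>lowering_surjective\<close>, every family \<open>Y\<close> of matrices is a sum \<open>X + N i + H
  i\<close> of a common matrix \<open>X\<close>, matrices \<open>N i\<close> that do not lower eigenvalues on the range of
  \<open>P i\<close>, and matrices \<open>H i\<close> that preserve this range, all linear in \<open>Y\<close>. So the map
  that sends \<open>Y\<close> to \<open>(1 + X) (1 + N i) (1 + H i)\<close> is polynomial with the identity as its derivative
  at 0, and its range is dense.\<close>

theorem dense_factorizations:
  fixes P :: "'m::finite \<Rightarrow> complex ^ 'n ^ 'n" and w :: "'m \<Rightarrow> real" and G :: "'m \<Rightarrow> complex ^ 'n ^ 'n"
  assumes P: "\<And>i. adj (P i) = P i" "\<And>i. P i ** P i = P i" "\<And>i. block_diag lam (P i)"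
    and w: "\<And>i. w i > 0"
    and stable: "no_lowering_relation lam w P"
    and \<epsilon>: "\<epsilon> > 0"
  shows "\<exists>X N H. (\<forall>i. norm (X ** N i ** H i - G i) < \<epsilon>) \<and> (\<forall>i. strict_lower lam (N i ** P i) = 0) \<and>
    (\<forall>i. (mat 1 - P i) ** H i ** P i = 0)"
proof -
  define unit :: "'m \<times> 'n \<times> 'n \<Rightarrow> 'm \<Rightarrow> complex ^ 'n ^ 'n" where
    "unit k i = (\<chi> a b. if (i, a, b) = k then 1 else 0)" for k i
  have "\<forall>k. \<exists>X. \<forall>i. (mat 1 - P i) ** strict_lower lam (unit k i - X) ** P i = 0"
    using lowering_surjective[where P = P and w = w and lam = lam, OF P w stable] by blast
  from choice[OF this] obtain X0 where
    X0: "\<And>k i. (mat 1 - P i) ** strict_lower lam (unit k i - X0 k) ** P i = 0" by blast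
  \<comment> \<open>a solution \<open>X\<close> that is complex linear, hence polynomial, in the given family,
    pieced together from solutions for the matrix units\<close>
  define X where "X y = (\<Sum>k\<in>UNIV. cscale (y $ k) (X0 k))" for y :: "complex ^ ('m \<times> 'n \<times> 'n)"
  define Y where "Y i y = (\<chi> a b. y $ (i, a, b))" for i and y :: "complex ^ ('m \<times> 'n \<times> 'n)"
  define M where "M i y = Y i y - X y" for i y
  define H where "H i y = strict_lower lam (M i y) ** P i" for i y
  define N where "N i y = M i y - H i y" for i y
  define F where "F i y = (mat 1 + X y) ** (mat 1 + N i y) ** (mat 1 + H i y)" for i y
  define \<Psi> :: "complex ^ ('m \<times> 'n \<times> 'n) \<Rightarrow> complex ^ ('m \<times> 'n \<times> 'n)" where
    "\<Psi> y = (\<chi> k. F (fst k) y $ fst (snd k) $ snd (snd k))" for y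
  have XX: "X y $ a $ b = (\<Sum>k\<in>UNIV. y $ k * X0 k $ a $ b)" for y a b
    by (simp add: X_def sum_component)
  have YM: "M i y = (\<Sum>k\<in>UNIV. cscale (y $ k) (unit k i - X0 k))" for i y
  proof -
    have "Y i y $ a $ b = (\<Sum>k\<in>UNIV. y $ k * unit k i $ a $ b)" for a b
    proof -
      have "(\<Sum>k\<in>UNIV. y $ k * unit k i $ a $ b) = (\<Sum>k\<in>UNIV. if k = (i, a, b) then y $ (i, a, b) else 0)"
        by (rule sum.cong) (auto simp: unit_def)
      then show ?thesis by (simp add: Y_def)
    qed
    then show ?thesis
      by (simp add: vec_eq_iff M_def XX sum_component right_diff_distrib sum_subtractf)
  qed
  have key: "(mat 1 - P i) ** strict_lower lam (M i y) ** P i = 0" for i y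
  proof -
    have "(mat 1 - P i) ** strict_lower lam (M i y) ** P i =
        (\<Sum>k\<in>UNIV. cscale (y $ k) ((mat 1 - P i) ** strict_lower lam (unit k i - X0 k) ** P i))"
      unfolding YM by (simp add: strict_lower_sum matrix_sum_left matrix_sum_right strict_lower_cscale cscale_mult_left cscale_mult_right)
    then show ?thesis by (simp add: X0 vec_eq_iff)
  qed
  have polyX: "polymat X" unfolding polymat_def XX
    by (intro allI polyfun_sum polyfun_mult polyfun_coord polyfun_const)
  have polyY: "polymat (Y i)" for i unfolding polymat_def Y_def by (auto intro: polyfun_coord)
  have polyF: "polymat (F i)" for i
    unfolding F_def[abs_def] N_def[abs_def] H_def[abs_def] M_def[abs_def]
    by (intro polymat_add polymat_mult polymat_const polymat_diff polymat_low polyX polyY)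
  have lX: "linear X"
    by (rule linearI) (simp_all add: vec_eq_iff XX sum.distrib ring_distribs scaleR_sum_right)
  have lY: "linear (Y i)" for i
    by (rule linearI) (simp_all add: vec_eq_iff Y_def)
  have lM: "linear (M i)" for i
    unfolding M_def[abs_def] by (intro linear_compose_sub lX lY)
  have lH: "linear (H i)" for i
    by (rule linearI)
      (simp_all add: H_def linear_add[OF lM] linear_scale[OF lM] strict_lower_add strict_lower_scaleR matrix_add_rdistrib matrix_scaleR_left)
  have lN: "linear (N i)" for i
    unfolding N_def[abs_def] by (intro linear_compose_sub lM lH)
  have plus1: "((\<lambda>y. mat 1 + f y) has_derivative f) (at x)" if "linear f"
    for f :: "complex ^ ('m \<times> 'n \<times> 'n) \<Rightarrow> complex ^ 'n ^ 'n" and x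
    using has_derivative_add[OF has_derivative_const linear_imp_has_derivative[OF that]] by simp
  have derF: "(F i has_derivative Y i) (at 0)" for i
  proof -
    note pd = bounded_bilinear.FDERIV[OF bounded_bilinear_matrix_mult]
    have "(F i has_derivative (\<lambda>v. ((mat 1 + X 0) ** (mat 1 + N i 0)) ** H i v +
        ((mat 1 + X 0) ** N i v + X v ** (mat 1 + N i 0)) ** (mat 1 + H i 0))) (at 0)"
      unfolding F_def[abs_def] by (intro pd plus1 lX lN lH)
    then show ?thesis by (simp add: linear_0[OF lX] linear_0[OF lN] linear_0[OF lH] linear_0[OF lY] N_def M_def)
  qed
  have der: "(\<Psi> has_derivative (\<lambda>v. v)) (at 0)"
    unfolding has_derivative_componentwise_within[of \<Psi>]
  proof
    fix b :: "complex ^ ('m \<times> 'n \<times> 'n)" assume "b \<in> Basis"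
    then obtain k c where b: "b = axis k c" by (auto simp: Basis_vec_def)
    obtain i j l where k: "k = (i, j, l)" by (cases k)
    have "((\<lambda>y. F i y $ j $ l \<bullet> c) has_derivative (\<lambda>v. Y i v $ j $ l \<bullet> c)) (at 0)"
      by (intro has_derivative_inner_left bounded_linear.has_derivative[OF bounded_linear_vec_nth] derF)
    then show "((\<lambda>y. \<Psi> y \<bullet> b) has_derivative (\<lambda>v. v \<bullet> b)) (at 0)"
      by (simp add: b k inner_axis \<Psi>_def Y_def)
  qed
  have "closure (range \<Psi>) = UNIV"
  proof (rule polynomial_map_dense_range[OF _ der])
    show "polyfun (\<lambda>x. \<Psi> x $ i)" for i using polyF by (simp add: \<Psi>_def polymat_def)
  qed (auto simp: surj_def)
  define g :: "complex ^ ('m \<times> 'n \<times> 'n)" where "g = (\<chi> k. G (fst k) $ fst (snd k) $ snd (snd k))"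
  have "g \<in> closure (range \<Psi>)" using \<open>closure (range \<Psi>) = UNIV\<close> by simp
  then obtain y where y: "dist (\<Psi> y) g < \<epsilon>" using \<epsilon> unfolding closure_approachable by blast
  have "norm (F i y - G i) < \<epsilon>" for i
  proof -
    have "(norm (F i y - G i))\<^sup>2 = (\<Sum>a\<in>UNIV. \<Sum>b\<in>UNIV. (norm ((\<Psi> y - g) $ (i, a, b)))\<^sup>2)"
      by (simp add: power2_norm_eq_inner inner_vec_def \<Psi>_def g_def)
    also have "\<dots> = (\<Sum>p\<in>UNIV. (norm ((\<Psi> y - g) $ (i, p)))\<^sup>2)"
      unfolding sum.cartesian_product UNIV_Times_UNIV by (rule sum.cong) auto
    also have "\<dots> = (\<Sum>k\<in>range (Pair i). (norm ((\<Psi> y - g) $ k))\<^sup>2)"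
      by (subst sum.reindex) (auto simp: inj_on_def)
    also have "\<dots> \<le> (\<Sum>k\<in>UNIV. (norm ((\<Psi> y - g) $ k))\<^sup>2)"
      by (rule sum_mono2) auto
    also have "\<dots> = (norm (\<Psi> y - g))\<^sup>2" by (simp add: power2_norm_eq_inner inner_vec_def)
    finally have "norm (F i y - G i) \<le> norm (\<Psi> y - g)" by (rule power2_le_imp_le) simp
    then show ?thesis using y by (simp add: dist_norm)
  qed
  moreover have "strict_lower lam ((mat 1 + N i y) ** P i) = 0" for i
    by (simp add: matrix_add_rdistrib strict_lower_add strict_lower_block P N_def H_def matrix_diff_rdistrib strict_lower_diff strict_lower_mult_right
        flip: matrix_mul_assoc)
  moreover have "(mat 1 - P i) ** (mat 1 + H i y) ** P i = 0" for i
  proof -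
    have "(mat 1 - P i) ** H i y ** P i = 0" using key[of i y] by (simp add: H_def P flip: matrix_mul_assoc)
    then show ?thesis by (simp add: matrix_add_ldistrib matrix_add_rdistrib matrix_diff_rdistrib P)
  qed
  ultimately show ?thesis unfolding F_def
    by (intro exI[of _ "mat 1 + X y"] exI[of _ "\<lambda>i. mat 1 + N i y"] exI[of _ "\<lambda>i. mat 1 + H i y"]) simp
qed


section \<open>Bases, dimensions and unitary changes of coordinates\<close>

lemma invertible_map_between_subspaces:
  fixes V W :: "(complex ^ 'n) set"
  assumes "vec.subspace V" "vec.subspace W" "vec.dim V = vec.dim W"
  obtains G where "invertible G" "V = (*v) G ` W"
proof -
  obtain B where B: "B \<subseteq> W" "vec.independent B" "W \<subseteq> vec.span B" "card B = vec.dim W"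
    using vec.basis_exists[of W] by metis
  obtain C where C: "C \<subseteq> V" "vec.independent C" "V \<subseteq> vec.span C" "card C = vec.dim V"
    using vec.basis_exists[of V] by metis
  obtain f where f: "bij_betw f B C"
    using finite_same_card_bij[OF vec.finiteI_independent[OF B(2)] vec.finiteI_independent[OF C(2)]] B(4) C(4) assms(3)
    by auto
  then have fB: "f ` B = C" "inj_on f B" by (auto simp: bij_betw_def)
  obtain g where g: "Vector_Spaces.linear (*s) (*s) g" "inj g" "\<And>x. x \<in> B \<Longrightarrow> g x = f x"
    using vec.linear_independent_extend_inj[OF B(2), of f] fB C(2) by auto
  have gm: "matrix g *v x = g x" for x by (rule matrix_works[OF g(1)])
  have "invertible (matrix g)"
  proof (rule matrix_invertible_if_injective)
    fix x assume "matrix g *v x = 0"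
    then have "matrix g *v x = matrix g *v 0" by simp
    then show "x = 0" using g(2) by (simp only: gm) (simp add: inj_def)
  qed
  moreover have "V = (*v) (matrix g) ` W"
  proof -
    have "vec.span B = W" using B(1,3) assms(2) vec.span_minimal by blast
    moreover have "vec.span C = V" using C(1,3) assms(1) vec.span_minimal by blast
    moreover have "g ` B = C" using fB g(3) by (metis image_cong)
    ultimately show ?thesis
      using vec.linear_span_image[OF g(1), of B] by (simp add: gm[abs_def])
  qed
  ultimately show ?thesis using that by blast
qed

text \<open>The subspace is the image of a coordinate subspace, whose projection is diagonal, under an invertible
  map.\<close>

lemma trace_orth_proj:
  fixes W :: "(complex ^ 'n) set"
  assumes W: "vec.subspace W"
  shows "trace (orth_proj W) = of_nat (vec.dim W)"
proof -
  obtain s :: "'n set" where s: "card s = vec.dim W"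
    using obtain_subset_with_card_n[of "vec.dim W" "UNIV :: 'n set"] dim_subset_UNIV_cart_gen[of W] by auto
  define K where "K = {x :: complex ^ 'n. \<forall>i. i \<notin> s \<longrightarrow> x $ i = 0}"
  have K: "vec.subspace K" by (auto simp: K_def vec.subspace_def)
  have "vec.dim W = vec.dim K" using dim_substandard_cart[of s, where 'a = complex] s by (simp add: K_def)
  then obtain G where G: "invertible G" "W = (*v) G ` K"
    using invertible_map_between_subspaces[OF W K] by blast
  have diag: "(diag_mat f *v x) $ i = complex_of_real (f i) * x $ i" for f :: "'n \<Rightarrow> real" and x i
  proof -
    have "(diag_mat f *v x) $ i = (\<Sum>j\<in>UNIV. if j = i then complex_of_real (f i) * x $ i else 0)"
      unfolding matrix_vector_mult_def diag_mat_def vec_lambda_beta by (rule sum.cong) auto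
    then show ?thesis by simp
  qed
  have "orth_proj K = diag_mat (\<lambda>i. if i \<in> s then 1 else 0)"
    by (rule orth_proj_eqI[OF K]) (auto simp: K_def diag vec_eq_iff)
  moreover have "trace (diag_mat (\<lambda>i. if i \<in> s then 1 else 0)) = (of_nat (card s) :: complex)"
  proof -
    have "trace (diag_mat (\<lambda>i. if i \<in> s then 1 else 0)) = (\<Sum>i\<in>UNIV. if i \<in> s then 1 else 0 :: complex)"
      unfolding trace_def by (rule sum.cong) (auto simp: diag_mat_def)
    then show ?thesis by (simp add: sum.If_cases)
  qed
  ultimately show ?thesis using trace_orth_proj_image[OF K G(1)] s by (simp add: G(2)[symmetric])
qed

lemma unitary_commute: "adj U ** U = mat 1 \<Longrightarrow> U ** adj U = mat 1"
  by (simp add: matrix_left_right_inverse)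

lemma unitary_adj: "adj U ** U = mat 1 \<Longrightarrow> adj (adj U) ** adj U = mat 1"
  by (simp add: unitary_commute)

lemma unitary_mult:
  assumes "adj U ** U = mat 1" "adj V ** V = mat 1" shows "adj (U ** V) ** (U ** V) = mat 1"
  by (metis assms adj_mult matrix_mul_assoc matrix_mul_rid)

lemma unitary_invertible: "adj U ** U = mat 1 \<Longrightarrow> invertible U"
  using invertible_left_inverse by blast

lemma orth_proj_unitary_image:
  assumes W: "vec.subspace W" and U: "adj U ** U = mat 1"
  shows "orth_proj ((*v) U ` W) = U ** orth_proj W ** adj U"
proof (rule orth_proj_eqI[OF subspace_image[OF W]])
  show "adj (U ** orth_proj W ** adj U) = U ** orth_proj W ** adj U"
    by (simp add: adj_mult adj_orth_proj[OF W] matrix_mul_assoc)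
  show "(U ** orth_proj W ** adj U) *v x \<in> (*v) U ` W" for x
    using orth_proj_in[OF W] by (simp flip: matrix_vector_mul_assoc)
  fix y assume "y \<in> (*v) U ` W"
  then obtain u where u: "u \<in> W" "y = U *v u" by auto
  have "(U ** orth_proj W ** adj U) *v y = U *v (orth_proj W *v ((adj U ** U) *v u))"
    by (simp add: u(2) matrix_vector_mul_assoc matrix_mul_assoc)
  then show "(U ** orth_proj W ** adj U) *v y = y" by (simp add: U orth_proj_fix[OF W u(1)] u(2))
qed

lemma frame_op_unitary_image:
  assumes W: "\<And>i. vec.subspace (W i)" and U: "adj U ** U = mat 1"
  shows "frame_op w (\<lambda>i. (*v) U ` W i) = U ** frame_op w W ** adj U"
  by (simp add: frame_op_def orth_proj_unitary_image[OF W U] matrix_sum_left matrix_sum_right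
      matrix_scaleR_left matrix_scaleR_right)

lemma inner_unitary_conj:
  assumes "adj U ** U = mat 1"
  shows "(U ** A ** adj U) \<bullet> (U ** B ** adj U) = A \<bullet> (B :: complex ^ 'n ^ 'n)"
proof -
  have "(U ** A ** adj U) \<bullet> (U ** B ** adj U) = (U ** A) \<bullet> (U ** B ** (adj U ** U))"
    by (simp add: inner_mult_right[of _ "adj U"] matrix_mul_assoc)
  also have "\<dots> = A \<bullet> ((adj U ** U) ** B)"
    unfolding assms by (simp add: inner_mult_left[of U] matrix_mul_assoc assms)
  finally show ?thesis by (simp add: assms)
qed

section \<open>Comparison of frame operators\<close>

text \<open>\<open>H i\<close> does not change \<open>W i\<close>. Write \<open>X = U ** R\<close> with \<open>U\<close>
  unitary and \<open>R\<close> not lowering; after the unitary change of coordinates \<open>U\<close> the family is the image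
  of \<open>W\<close> under the maps \<open>R ** N i\<close>, which respect the filtration by large eigenvalues on \<open>W
  i\<close>, and \<open>upper_image_trace_ge\<close> applies to each of them.\<close>

lemma factored_family_inequality:
  fixes W :: "'m::finite \<Rightarrow> (complex ^ 'n) set"
  assumes W: "\<And>i. vec.subspace (W i)" and diag: "frame_op w W = diag_mat lam"
    and comm: "\<And>i. orth_proj (W i) ** diag_mat lam = diag_mat lam ** orth_proj (W i)"
    and inv: "\<And>i. invertible (X ** N i ** H i)"
    and N: "\<And>i. strict_lower lam (N i ** orth_proj (W i)) = 0"
    and H: "\<And>i. (mat 1 - orth_proj (W i)) ** H i ** orth_proj (W i) = 0"
  shows "\<exists>U. adj U ** U = mat 1 \<and> frame_op w W \<bullet> frame_op w W \<le>
      frame_op w (\<lambda>i. (*v) (X ** N i ** H i) ` W i) \<bullet> (U ** diag_mat lam ** adj U)"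
proof -
  have invX: "invertible X" and invN: "invertible (N i)" and invH: "invertible (H i)" for i
    using invertible_mult_factors(1)[OF invertible_mult_factors(1)[OF inv]]
      invertible_mult_factors(2)[OF invertible_mult_factors(1)[OF inv]] invertible_mult_factors(2)[OF inv] by auto
  obtain U R where U: "adj U ** U = mat 1" and XR: "X = U ** R"
    and R: "\<And>a b. lam a < lam b \<Longrightarrow> R $ a $ b = 0"
    using upper_factorization[OF invX] by metis
  have invR: "invertible R" using invX XR invertible_mult_factors(2) by blast
  let ?D = "diag_mat lam"
  have HW: "(*v) (H i) ` W i = W i" for i
  proof (rule vec.subspace_dim_equal)
    show "vec.subspace ((*v) (H i) ` W i)" using W by (rule subspace_image)
    show "(*v) (H i) ` W i \<subseteq> W i"
    proof
      fix y assume "y \<in> (*v) (H i) ` W i"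
      then obtain u where u: "u \<in> W i" "y = H i *v u" by auto
      have "((mat 1 - orth_proj (W i)) ** H i ** orth_proj (W i)) *v u = 0" by (simp add: H)
      then have "y - orth_proj (W i) *v y = 0"
        using u orth_proj_fix[OF W u(1)]
        by (simp add: matrix_vector_mult_diff_rdistrib flip: matrix_vector_mul_assoc)
      then show "y \<in> W i" using orth_proj_in[OF W, of i y] by simp
    qed
  qed (use W in \<open>simp_all add: dim_image_invertible[OF invH]\<close>)
  define M where "M i = R ** N i" for i
  have invM: "invertible (M i)" for i unfolding M_def by (rule invertible_mult[OF invR invN])
  have img: "(*v) (X ** N i ** H i) ` W i = (*v) U ` ((*v) (M i) ` W i)" for i
  proof -
    have "(*v) (X ** N i ** H i) ` W i = (*v) (X ** N i) ` ((*v) (H i) ` W i)"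
      by (simp add: image_image matrix_vector_mul_assoc)
    also have "\<dots> = (*v) (X ** N i) ` W i" by (simp only: HW)
    also have "\<dots> = (*v) U ` ((*v) (M i) ` W i)"
      by (simp add: image_image matrix_vector_mul_assoc XR M_def matrix_mul_assoc)
    finally show ?thesis .
  qed
  have upper: "(M i ** orth_proj (W i)) $ a $ b = 0" if "lam a < lam b" for i a b
  proof -
    have "R $ a $ c * (N i ** orth_proj (W i)) $ c $ b = 0" for c
    proof (cases "lam a < lam c")
      case False
      then have "strict_lower lam (N i ** orth_proj (W i)) $ c $ b = (N i ** orth_proj (W i)) $ c $ b"
        using that by (simp add: strict_lower_nth)
      then show ?thesis by (simp add: N)
    qed (simp add: R)
    then have "(\<Sum>c\<in>UNIV. R $ a $ c * (N i ** orth_proj (W i)) $ c $ b) = 0"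
      by (intro sum.neutral) blast
    then show ?thesis
      unfolding M_def matrix_mul_assoc[symmetric]
      unfolding matrix_matrix_mult_def[of R] by simp
  qed
  have sub: "vec.subspace ((*v) (M i) ` W i)" for i using W by (rule subspace_image)
  have "frame_op w (\<lambda>i. (*v) (X ** N i ** H i) ` W i) \<bullet> (U ** ?D ** adj U) =
      frame_op w (\<lambda>i. (*v) (M i) ` W i) \<bullet> ?D"
    unfolding img frame_op_unitary_image[OF sub U] inner_unitary_conj[OF U] ..
  also have "\<dots> = (\<Sum>i\<in>UNIV. (w i)\<^sup>2 * Re (trace (orth_proj ((*v) (M i) ` W i) ** ?D)))"
    by (simp add: frame_op_def inner_sum_left inner_matrix_herm)
  also have "\<dots> \<ge> (\<Sum>i\<in>UNIV. (w i)\<^sup>2 * Re (trace (orth_proj (W i) ** ?D)))"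
    by (intro sum_mono mult_left_mono upper_image_trace_ge W invM comm upper) auto
  also have "(\<Sum>i\<in>UNIV. (w i)\<^sup>2 * Re (trace (orth_proj (W i) ** ?D))) = frame_op w W \<bullet> ?D"
    by (simp add: frame_op_def inner_sum_left inner_matrix_herm)
  finally show ?thesis using U by (auto simp: diag)
qed

text \<open>If \<open>K\<close> inverts \<open>G\<close> and \<open>A x = 0\<close>, then \<open>x = K (G - A) x\<close>,
  which forces \<open>x = 0\<close> when \<open>G - A\<close> is small.\<close>

lemma invertible_near:
  fixes G :: "complex ^ 'n ^ 'n"
  assumes "invertible G"
  shows "\<exists>\<delta>>0. \<forall>A. norm (A - G) < \<delta> \<longrightarrow> invertible A"
proof -
  obtain K where K: "K ** G = mat 1" using assms by (auto simp: invertible_def)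
  show ?thesis
  proof (intro exI[of _ "1 / (norm K + 1)"] conjI allI impI)
    show "0 < 1 / (norm K + 1)" by (simp add: add_nonneg_pos)
    fix A assume A: "norm (A - G) < 1 / (norm K + 1)"
    then have lt: "norm K * norm (A - G) < 1"
      by (smt (verit) divide_less_eq_1 mult.commute mult_left_mono norm_ge_zero pos_less_divide_eq mult_nonneg_nonneg ring_distribs(1))
    show "invertible A"
    proof (rule matrix_invertible_if_injective)
      fix x assume x: "A *v x = 0"
      have "x = K *v (G *v x)" by (simp add: matrix_vector_mul_assoc K)
      also have "G *v x = - ((A - G) *v x)" by (simp add: matrix_vector_mult_diff_rdistrib x)
      finally have "norm x \<le> norm K * norm ((A - G) *v x)"
        by (metis norm_matrix_vector_le norm_minus_cancel)
      also have "\<dots> \<le> norm K * (norm (A - G) * norm x)"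
        by (intro mult_left_mono norm_matrix_vector_le norm_ge_zero)
      finally have "norm x * (1 - norm K * norm (A - G)) \<le> 0" by (simp add: algebra_simps)
      then show "x = 0" using lt by (simp add: mult_le_0_iff)
    qed
  qed
qed

lemma norm_unitary:
  fixes U :: "complex ^ 'n ^ 'n"
  assumes "adj U ** U = mat 1" shows "norm U = norm (mat 1 :: complex ^ 'n ^ 'n)"
proof -
  have "U \<bullet> U = (U ** mat 1) \<bullet> U" by simp
  also have "\<dots> = mat 1 \<bullet> (mat 1 :: complex ^ 'n ^ 'n)" by (simp only: inner_mult_left assms)
  finally show ?thesis by (simp add: norm_eq_sqrt_inner)
qed

lemma norm_orth_proj_le:
  fixes W :: "(complex ^ 'n) set"
  assumes "vec.subspace W" shows "norm (orth_proj W) \<le> norm (mat 1 :: complex ^ 'n ^ 'n)"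
proof -
  have "orth_proj W \<bullet> orth_proj W = mat 1 \<bullet> orth_proj W"
    using inner_mult_left[of "orth_proj W" "mat 1" "orth_proj W"]
    by (simp add: adj_orth_proj orth_proj_idem assms)
  also have "\<dots> \<le> norm (mat 1 :: complex ^ 'n ^ 'n) * norm (orth_proj W)" by (rule norm_cauchy_schwarz)
  finally have "norm (orth_proj W) * norm (orth_proj W) \<le> norm (mat 1 :: complex ^ 'n ^ 'n) * norm (orth_proj W)"
    by (simp add: power2_norm_eq_inner flip: power2_eq_square)
  then show ?thesis by (cases "norm (orth_proj W) = 0") (auto simp: mult_le_cancel_right)
qed

text \<open>The limit is a projection whose range contains the limit subspace; since traces pass to the limit, the difference
  of the two projections is a projection of trace zero.\<close>

lemma orth_proj_limit:
  fixes W :: "(complex ^ 'n) set" and G L :: "complex ^ 'n ^ 'n"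
  assumes W: "vec.subspace W" and G: "invertible G" and A: "A \<longlonglongrightarrow> G" "\<And>k. invertible (A k)"
    and lim: "(\<lambda>k. orth_proj ((*v) (A k) ` W)) \<longlonglongrightarrow> L"
  shows "L = orth_proj ((*v) G ` W)"
proof -
  let ?p = "orth_proj W" and ?P = "\<lambda>k. orth_proj ((*v) (A k) ` W)" and ?Q = "orth_proj ((*v) G ` W)"
  have V: "vec.subspace ((*v) G ` W)" and Vk: "vec.subspace ((*v) (A k) ` W)" for k
    using W by (auto intro: subspace_image)
  note Q = adj_orth_proj[OF V] orth_proj_idem[OF V]
  have "(\<lambda>k. adj (?P k)) \<longlonglongrightarrow> adj L" by (rule tendsto_adj[OF lim])
  then have adjL: "adj L = L" using lim LIMSEQ_unique by (simp add: adj_orth_proj[OF Vk])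
  have "(\<lambda>k. ?P k ** ?P k) \<longlonglongrightarrow> L ** L" by (rule tendsto_matrix_mult[OF lim lim])
  then have LL: "L ** L = L" using lim LIMSEQ_unique by (simp add: orth_proj_idem[OF Vk])
  have "?P k ** (A k ** ?p) = A k ** ?p" for k
  proof (rule matrix_eq[THEN iffD2], rule allI)
    fix x
    have "A k *v (?p *v x) \<in> (*v) (A k) ` W" using orth_proj_in[OF W] by blast
    then show "(?P k ** (A k ** ?p)) *v x = (A k ** ?p) *v x"
      using orth_proj_fix[OF Vk] by (simp flip: matrix_vector_mul_assoc)
  qed
  then have "(\<lambda>k. A k ** ?p) \<longlonglongrightarrow> L ** (G ** ?p)"
    using tendsto_matrix_mult[OF lim tendsto_matrix_mult[OF A(1) tendsto_const[of ?p]]] by simp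
  moreover have "(\<lambda>k. A k ** ?p) \<longlonglongrightarrow> G ** ?p" by (intro tendsto_matrix_mult A(1) tendsto_const)
  ultimately have LG: "L ** (G ** ?p) = G ** ?p" by (rule LIMSEQ_unique)
  have LQ: "L ** ?Q = ?Q"
  proof (rule matrix_eq[THEN iffD2], rule allI)
    fix x
    obtain u where u: "u \<in> W" "?Q *v x = G *v u" using orth_proj_in[OF V, of x] by auto
    have "(L ** (G ** ?p)) *v u = (G ** ?p) *v u" by (simp add: LG)
    then show "(L ** ?Q) *v x = ?Q *v x"
      using u orth_proj_fix[OF W u(1)] by (simp flip: matrix_vector_mul_assoc)
  qed
  then have QL: "?Q ** L = ?Q" by (metis adjL Q(1) adj_mult)
  have "(\<lambda>k. trace (?P k)) \<longlonglongrightarrow> trace L"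
    unfolding trace_def by (intro tendsto_sum tendsto_vec_nth lim)
  then have "trace L = trace ?p"
    using trace_orth_proj_image[OF W A(2)] by (simp add: LIMSEQ_const_iff)
  also have "\<dots> = trace ?Q" using trace_orth_proj_image[OF W G] by simp
  finally have "trace (L - ?Q) = 0" by (simp add: trace_diff)
  moreover have "(L - ?Q) ** adj (L - ?Q) = L - ?Q"
    by (simp add: adj_diff adjL Q matrix_algebra LL LQ QL)
  ultimately have "(L - ?Q) \<bullet> (L - ?Q) = 0" by (simp add: inner_matrix)
  then show ?thesis by simp
qed

text \<open>Every family \<open>V\<close> with the dimensions of \<open>W\<close> is the image of \<open>W\<close> under
  invertible matrices, and these are limits of matrices for which \<open>factored_family_inequality\<close> holds.\<close>

lemma diagonal_comparison:
  fixes W V :: "'m::finite \<Rightarrow> (complex ^ 'n) set"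
  assumes W: "W \<in> subspace_families d" and V: "V \<in> subspace_families d"
    and diag: "frame_op w W = diag_mat lam" and w: "\<And>i. w i > 0"
    and comm: "\<And>i. orth_proj (W i) ** diag_mat lam = diag_mat lam ** orth_proj (W i)"
    and stable: "no_lowering_relation lam w (\<lambda>i. orth_proj (W i))"
  shows "\<exists>U. adj U ** U = mat 1 \<and>
    frame_op w W \<bullet> frame_op w W \<le> frame_op w V \<bullet> (U ** diag_mat lam ** adj U)"
proof -
  let ?s = "frame_op w W \<bullet> frame_op w W" and ?D = "diag_mat lam"
  have Ws: "vec.subspace (W i)" and Vs: "vec.subspace (V i)" and dims: "vec.dim (V i) = vec.dim (W i)" for i
    using W V by (auto simp: subspace_families_def)
  have "\<forall>i. \<exists>G. invertible G \<and> V i = (*v) G ` W i"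
    using invertible_map_between_subspaces[OF Vs Ws dims] by metis
  from choice[OF this] obtain G where G: "\<And>i. invertible (G i)" "\<And>i. V i = (*v) (G i) ` W i" by blast
  have "\<forall>i. \<exists>\<delta>>0. \<forall>A. norm (A - G i) < \<delta> \<longrightarrow> invertible A" using invertible_near[OF G(1)] by blast
  from choice[OF this] obtain \<delta> where
    \<delta>: "\<And>i. \<delta> i > 0" "\<And>i A. norm (A - G i) < \<delta> i \<Longrightarrow> invertible A" by blast
  \<comment> \<open>within \<open>\<delta>0\<close> of \<open>G\<close> all matrices stay invertible\<close>
  define \<delta>0 where "\<delta>0 = Min (range \<delta>)"
  have \<delta>0: "\<delta>0 > 0" "\<delta>0 \<le> \<delta> i" for i using \<delta>(1) by (auto simp: \<delta>0_def)
  have "\<forall>k. \<exists>A U. (\<forall>i. norm (A i - G i) < inverse (real (Suc k)) \<and> invertible (A i)) \<and> adj U ** U = mat 1 \<and>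
      ?s \<le> frame_op w (\<lambda>i. (*v) (A i) ` W i) \<bullet> (U ** ?D ** adj U)"
  proof
    fix k
    have "\<exists>X N H. (\<forall>i. norm (X ** N i ** H i - G i) < min \<delta>0 (inverse (real (Suc k)))) \<and>
        (\<forall>i. strict_lower lam (N i ** orth_proj (W i)) = 0) \<and>
        (\<forall>i. (mat 1 - orth_proj (W i)) ** H i ** orth_proj (W i) = 0)"
    proof (rule dense_factorizations[OF _ _ _ w stable])
      show "0 < min \<delta>0 (inverse (real (Suc k)))" using \<delta>0(1) by simp
    qed (use Ws comm commute_diag_imp_block in \<open>auto simp: adj_orth_proj orth_proj_idem\<close>)
    then obtain X N H where
      near: "\<And>i. norm (X ** N i ** H i - G i) < \<delta>0" "\<And>i. norm (X ** N i ** H i - G i) < inverse (real (Suc k))"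
      and N: "\<And>i. strict_lower lam (N i ** orth_proj (W i)) = 0"
      and H: "\<And>i. (mat 1 - orth_proj (W i)) ** H i ** orth_proj (W i) = 0"
      by auto
    have inv: "invertible (X ** N i ** H i)" for i
      by (rule \<delta>(2)[of _ i]) (use near(1)[of i] \<delta>0(2)[of i] in linarith)
    show "\<exists>A U. (\<forall>i. norm (A i - G i) < inverse (real (Suc k)) \<and> invertible (A i)) \<and> adj U ** U = mat 1 \<and>
      ?s \<le> frame_op w (\<lambda>i. (*v) (A i) ` W i) \<bullet> (U ** ?D ** adj U)"
      using factored_family_inequality[OF Ws diag comm inv N H] near(2) inv
      by (intro exI[of _ "\<lambda>i. X ** N i ** H i"]) blast
  qed
  from choice[OF this] obtain A where "\<forall>k. \<exists>U. (\<forall>i. norm (A k i - G i) < inverse (real (Suc k)) \<and> invertible (A k i)) \<and> adj U ** U = mat 1 \<and>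
      ?s \<le> frame_op w (\<lambda>i. (*v) (A k i) ` W i) \<bullet> (U ** ?D ** adj U)" by blast
  from choice[OF this] obtain U where
    A: "\<And>k i. norm (A k i - G i) < inverse (real (Suc k))" "\<And>k i. invertible (A k i)"
    and U: "\<And>k. adj (U k) ** U k = mat 1"
    and le: "\<And>k. ?s \<le> frame_op w (\<lambda>i. (*v) (A k i) ` W i) \<bullet> (U k ** ?D ** adj (U k))" by blast
  have Alim: "(\<lambda>k. A k i) \<longlonglongrightarrow> G i" for i
  proof -
    have "(\<lambda>k. A k i - G i) \<longlonglongrightarrow> 0"
      by (rule Lim_null_comparison[OF _ LIMSEQ_inverse_real_of_nat])
        (rule always_eventually, rule allI, rule less_imp_le, rule A(1))
    then show ?thesis by (rule LIM_zero_cancel)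
  qed
  define p where "p k = (\<chi> i. orth_proj ((*v) (A k i) ` W i))" for k
  have As: "vec.subspace ((*v) (A k i) ` W i)" for k i by (rule subspace_image[OF Ws])
  have "bounded (range U)" 
    unfolding bounded_iff using norm_unitary[OF U] by (metis order_refl rangeE)
  then obtain l r where r: "strict_mono r" "(U \<circ> r) \<longlonglongrightarrow> l"
    using bounded_imp_convergent_subsequence by blast
  have "norm (p k) \<le> (\<Sum>i\<in>(UNIV :: 'm set). norm (mat 1 :: complex ^ 'n ^ 'n))" for k
  proof -
    have "norm (p k) \<le> (\<Sum>i\<in>UNIV. norm (p k $ i))"
      unfolding norm_vec_def[of "p k"] by (rule L2_set_le_sum) simp
    also have "\<dots> \<le> (\<Sum>i\<in>(UNIV :: 'm set). norm (mat 1 :: complex ^ 'n ^ 'n))"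
      by (rule sum_mono) (simp add: p_def norm_orth_proj_le As)
    finally show ?thesis .
  qed
  then have "bounded (range (p \<circ> r))" by (auto simp: bounded_iff)
  then obtain L t where t: "strict_mono t" "(p \<circ> r \<circ> t) \<longlonglongrightarrow> L"
    using bounded_imp_convergent_subsequence by blast
  define q where "q = r \<circ> t"
  have q: "strict_mono q" unfolding q_def using r(1) t(1) by (rule strict_mono_o)
  have Uq: "(\<lambda>k. U (q k)) \<longlonglongrightarrow> l"
    using LIMSEQ_subseq_LIMSEQ[OF r(2) t(1)] by (simp add: q_def o_def)
  have plim: "(\<lambda>k. orth_proj ((*v) (A (q k) i) ` W i)) \<longlonglongrightarrow> orth_proj (V i)" for i
  proof -
    have lim: "(\<lambda>k. orth_proj ((*v) (A (q k) i) ` W i)) \<longlonglongrightarrow> L $ i"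
      using tendsto_vec_nth[OF t(2), of i] by (simp add: p_def q_def o_def)
    have "(\<lambda>k. A (q k) i) \<longlonglongrightarrow> G i"
      using LIMSEQ_subseq_LIMSEQ[OF Alim q] by (simp add: o_def)
    from orth_proj_limit[OF Ws G(1) this A(2) lim] show ?thesis using lim by (simp add: G(2))
  qed
  have "(\<lambda>k. frame_op w (\<lambda>i. (*v) (A (q k) i) ` W i) \<bullet> (U (q k) ** ?D ** adj (U (q k))))
      \<longlonglongrightarrow> frame_op w V \<bullet> (l ** ?D ** adj l)"
    unfolding frame_op_def
    by (intro tendsto_inner tendsto_sum tendsto_scaleR tendsto_const plim tendsto_matrix_mult tendsto_adj Uq)
  then have "?s \<le> frame_op w V \<bullet> (l ** ?D ** adj l)"
    by (rule LIMSEQ_le_const) (use le in blast)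
  moreover have "adj l ** l = mat 1"
  proof -
    have "(\<lambda>k. adj (U (q k)) ** U (q k)) \<longlonglongrightarrow> adj l ** l" by (intro tendsto_matrix_mult tendsto_adj Uq)
    then show ?thesis by (simp add: U LIMSEQ_const_iff)
  qed
  ultimately show ?thesis by blast
qed

lemma inner_of_real:
  "z \<bullet> (complex_of_real c * z) = c * (norm z)\<^sup>2" "z \<bullet> (z * complex_of_real c) = c * (norm z)\<^sup>2"
  unfolding inner_complex_def cmod_power2 by (simp_all add: power2_eq_square algebra_simps)

section \<open>Comparison with a local minimizer\<close>

text \<open>In coordinates in which the frame operator is diagonal, the second variation along lowering maps \<open>T\<close>
  with \<open>\<Sum> w\<^sub>i\<^sup>2 T\<^sub>i = 0\<close> is a sum of terms \<open>(lam a - lam b) *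
  \<bar>T\<^sub>a\<^sub>b\<bar>\<^sup>2\<close>, all of which are nonpositive because \<open>T\<^sub>a\<^sub>b \<noteq>
  0\<close> only if \<open>lam a < lam b\<close>. At a minimizer the sum is nonnegative, so all terms vanish.\<close>

lemma local_minimizer_diagonalized:
  fixes W :: "'m::finite \<Rightarrow> (complex ^ 'n) set"
  assumes min: "local_minimizer d w W" and w: "\<And>i. w i > 0"
  shows "\<exists>U lam W'. adj U ** U = mat 1 \<and> frame_op w W = U ** diag_mat lam ** adj U \<and>
    W' \<in> subspace_families d \<and> frame_op w W' = diag_mat lam \<and>
    (\<forall>i. orth_proj (W' i) ** diag_mat lam = diag_mat lam ** orth_proj (W' i)) \<and>
    no_lowering_relation lam w (\<lambda>i. orth_proj (W' i))"
proof -
  let ?S = "frame_op w W" and ?P = "\<lambda>i. orth_proj (W i)"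
  have fam: "W \<in> subspace_families d" using min by (simp add: local_minimizer_def)
  then have W: "vec.subspace (W i)" "vec.dim (W i) = d i" for i by (auto simp: subspace_families_def)
  obtain U lam where U: "adj U ** U = mat 1" and S: "?S = U ** diag_mat lam ** adj U"
    by (rule hermitian_diagonalization[OF adj_frame_op[of W w, OF W(1)]])
  have U': "U ** adj U = mat 1" by (rule unitary_commute[OF U])
  have [simp]: "adj U ** (U ** A) = A" "U ** (adj U ** A) = A" for A :: "complex ^ 'n ^ 'n"
    by (simp_all add: matrix_mul_assoc U U')
  let ?D = "diag_mat lam"
  define W' where "W' i = (*v) (adj U) ` W i" for i
  have op': "orth_proj (W' i) = adj U ** ?P i ** U" for i
    unfolding W'_def using orth_proj_unitary_image[OF W(1) unitary_adj[OF U]] by simp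
  have fam': "W' \<in> subspace_families d"
    using W by (auto simp: subspace_families_def W'_def subspace_image
        dim_image_invertible[OF unitary_invertible[OF unitary_adj[OF U]]])
  have S': "frame_op w W' = ?D"
    unfolding W'_def using frame_op_unitary_image[of W "adj U" w, OF W(1) unitary_adj[OF U]]
    by (simp add: S U flip: matrix_mul_assoc)
  have comm: "orth_proj (W' i) ** ?D = ?D ** orth_proj (W' i)" for i
  proof -
    have "adj U ** (?P i ** ?S) ** U = adj U ** (?S ** ?P i) ** U"
      using local_minimizer_commutes[OF min w] by simp
    then show ?thesis by (simp add: op' S U flip: matrix_mul_assoc)
  qed
  have stable: "no_lowering_relation lam w (\<lambda>i. orth_proj (W' i))"
    unfolding no_lowering_relation_def
  proof (intro allI impI)
    fix T i
    assume T: "\<forall>i. T i ** orth_proj (W' i) = T i \<and> orth_proj (W' i) ** T i = 0 \<and> strict_lower lam (T i) = T i"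
      and rel: "(\<Sum>i\<in>UNIV. (w i)\<^sup>2 *\<^sub>R T i) = 0"
    define R where "R i = U ** T i ** adj U" for i
    have "R i ** ?P i = R i" "?P i ** R i = 0" for i
    proof -
      have "R i ** ?P i = U ** (T i ** orth_proj (W' i)) ** adj U"
        by (simp add: R_def op' U' flip: matrix_mul_assoc)
      then show "R i ** ?P i = R i" using T by (simp add: R_def)
      have "?P i ** R i = U ** (orth_proj (W' i) ** T i) ** adj U"
        by (simp add: R_def op' flip: matrix_mul_assoc)
      then show "?P i ** R i = 0" using T by (simp add: matrix_zero_left matrix_zero_right)
    qed
    note var = local_minimizer_variation(2)[OF min this]
    have relR: "(\<Sum>i\<in>UNIV. (w i)\<^sup>2 *\<^sub>R R i) = 0"
    proof -
      have "(\<Sum>i\<in>UNIV. (w i)\<^sup>2 *\<^sub>R R i) = U ** (\<Sum>i\<in>UNIV. (w i)\<^sup>2 *\<^sub>R T i) ** adj U"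
        by (simp add: R_def matrix_sum_left matrix_sum_right matrix_scaleR_left matrix_scaleR_right)
      then show ?thesis by (simp add: rel matrix_zero_left matrix_zero_right)
    qed
    have "(\<Sum>i\<in>UNIV. (w i)\<^sup>2 *\<^sub>R (R i + adj (R i))) = 0"
    proof -
      have "(\<Sum>i\<in>UNIV. (w i)\<^sup>2 *\<^sub>R (R i + adj (R i))) =
          (\<Sum>i\<in>UNIV. (w i)\<^sup>2 *\<^sub>R R i) + adj (\<Sum>i\<in>UNIV. (w i)\<^sup>2 *\<^sub>R R i)"
        by (simp add: adj_sum adj_scaleR scaleR_add_right sum.distrib)
      then show ?thesis by (simp add: relR)
    qed
    from var[OF this] have nonneg: "0 \<le> (\<Sum>i\<in>UNIV. (w i)\<^sup>2 * (?S \<bullet> (R i ** adj (R i) - adj (R i) ** R i)))"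
      by (simp add: inner_sum_right)
    have second_order: "?S \<bullet> (R i ** adj (R i) - adj (R i) ** R i) =
        (\<Sum>a\<in>UNIV. \<Sum>b\<in>UNIV. (lam a - lam b) * (norm (T i $ a $ b))\<^sup>2)" for i
    proof -
      have "R i ** adj (R i) - adj (R i) ** R i = U ** (T i ** adj (T i) - adj (T i) ** T i) ** adj U"
        by (simp add: R_def adj_mult matrix_diff_ldistrib matrix_diff_rdistrib flip: matrix_mul_assoc)
      then have "?S \<bullet> (R i ** adj (R i) - adj (R i) ** R i) = ?D \<bullet> (T i ** adj (T i) - adj (T i) ** T i)"
        by (simp add: S inner_unitary_conj[OF U])
      also have "\<dots> = (T i ** adj (T i)) \<bullet> ?D - (adj (T i) ** T i) \<bullet> ?D"
        by (simp add: inner_diff_right inner_commute)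
      also have "\<dots> = T i \<bullet> (?D ** T i) - T i \<bullet> (T i ** ?D)"
        by (simp add: inner_mult_right[of "T i" "adj (T i)"] inner_mult_left[of "adj (T i)" "T i"])
      also have "\<dots> = (\<Sum>a\<in>UNIV. \<Sum>b\<in>UNIV. (lam a - lam b) * (norm (T i $ a $ b))\<^sup>2)"
        unfolding inner_vec_def sum_subtractf[symmetric]
        by (intro sum.cong refl) (simp add: diag_mat_mult_left diag_mat_mult_right inner_of_real algebra_simps)
      finally show ?thesis .
    qed
    have ge: "0 \<le> (\<Sum>i\<in>UNIV. \<Sum>a\<in>UNIV. \<Sum>b\<in>UNIV. (w i)\<^sup>2 * ((lam a - lam b) * (norm (T i $ a $ b))\<^sup>2))"
      using nonneg unfolding second_order sum_distrib_left .
    have Tlow: "T i $ a $ b = 0" if "\<not> lam a < lam b" for i a b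
      using T that strict_lower_nth[of lam "T i" a b] by simp
    have np: "(w i)\<^sup>2 * ((lam a - lam b) * (norm (T i $ a $ b))\<^sup>2) \<le> 0" for i a b
      using Tlow[of a b i] by (cases "lam a < lam b") (auto simp: mult_le_0_iff)
    have "(\<Sum>i\<in>UNIV. \<Sum>a\<in>UNIV. \<Sum>b\<in>UNIV. (w i)\<^sup>2 * ((lam a - lam b) * (norm (T i $ a $ b))\<^sup>2)) \<le> 0"
      by (intro sum_nonpos np)
    with ge have "(\<Sum>i\<in>UNIV. \<Sum>a\<in>UNIV. \<Sum>b\<in>UNIV. - ((w i)\<^sup>2 * ((lam a - lam b) * (norm (T i $ a $ b))\<^sup>2))) = 0"
      unfolding sum_negf by linarith
    then have zero: "(w i)\<^sup>2 * ((lam a - lam b) * (norm (T i $ a $ b))\<^sup>2) = 0" for i a b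
      using np by (simp add: sum_nonneg_eq_0_iff sum_nonneg) blast
    have "T i $ a $ b = 0" for a b
      using zero[of i a b] Tlow[of a b i] w[of i] by (cases "lam a < lam b") auto
    then show "T i = 0" by (simp add: vec_eq_iff)
  qed
  show ?thesis using U S fam' S' comm stable by blast
qed

theorem local_minimizer_comparison:
  fixes W V :: "'m::finite \<Rightarrow> (complex ^ 'n) set"
  assumes min: "local_minimizer d w W" and w: "\<And>i. w i > 0" and V: "V \<in> subspace_families d"
  obtains U where "adj U ** U = mat 1"
    "frame_op w W \<bullet> frame_op w W \<le> frame_op w V \<bullet> (U ** frame_op w W ** adj U)"
proof -
  obtain Q lam W' where Q: "adj Q ** Q = mat 1" and S: "frame_op w W = Q ** diag_mat lam ** adj Q"
    and W': "W' \<in> subspace_families d" "frame_op w W' = diag_mat lam"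
      "\<And>i. orth_proj (W' i) ** diag_mat lam = diag_mat lam ** orth_proj (W' i)"
      "no_lowering_relation lam w (\<lambda>i. orth_proj (W' i))"
    using local_minimizer_diagonalized[OF min w] by blast
  obtain U where U: "adj U ** U = mat 1"
    and le: "frame_op w W' \<bullet> frame_op w W' \<le> frame_op w V \<bullet> (U ** diag_mat lam ** adj U)"
    using diagonal_comparison[OF W'(1) V W'(2) w W'(3,4)] by blast
  have "frame_op w W \<bullet> frame_op w W = frame_op w W' \<bullet> frame_op w W'"
    by (simp add: S W'(2) inner_unitary_conj[OF Q])
  moreover have "U ** diag_mat lam ** adj U = (U ** adj Q) ** frame_op w W ** adj (U ** adj Q)"
  proof -
    have "(U ** adj Q) ** frame_op w W ** adj (U ** adj Q) =
        U ** (adj Q ** Q) ** diag_mat lam ** (adj Q ** Q) ** adj U"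
      by (simp add: S adj_mult matrix_mul_assoc)
    then show ?thesis by (simp add: Q)
  qed
  ultimately show ?thesis
    using that[OF unitary_mult[OF U unitary_adj[OF Q]]] le by simp
qed

section \<open>Invertibility of the frame operator\<close>

lemma matrix_vector_sum: "(\<Sum>i\<in>I. f i) *v x = (\<Sum>i\<in>I. f i *v (x :: complex ^ 'n))"
  by (induction I rule: infinite_finite_induct) (simp_all add: matrix_vector_mult_add_rdistrib)

text \<open>Suppose that \<open>lam e = 0\<close>. The rank one maps with values in the line of \<open>e\<close> lower
  eigenvalues, so a relation \<open>\<Sum> w\<^sub>i\<^sup>2 x\<^sub>i = 0\<close> with \<open>x\<^sub>i\<close> in the
  \<open>i\<close>-th subspace is trivial. The frame operator itself provides such a relation for every \<open>y\<close> in
  the \<open>i\<close>-th subspace, namely \<open>\<Sum> w\<^sub>k\<^sup>2 P\<^sub>k y = S y\<close> with \<open>S y\<close>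
  again in that subspace. Hence the subspaces are pairwise orthogonal, and their sum has dimension \<open>\<Sum> d\<^sub>i
  \<ge> n\<close> although it is orthogonal to \<open>e\<close>.\<close>

lemma local_minimizer_invertible:
  fixes W :: "'m::finite \<Rightarrow> (complex ^ 'n) set"
  assumes min: "local_minimizer d w W" and w: "\<And>i. w i > 0" and dims: "CARD('n) \<le> (\<Sum>i\<in>UNIV. d i)"
  shows "invertible (frame_op w W)"
proof -
  obtain Q lam V where Q: "adj Q ** Q = mat 1" and S: "frame_op w W = Q ** diag_mat lam ** adj Q"
    and V: "V \<in> subspace_families d" and D: "frame_op w V = diag_mat lam"
    and comm: "\<And>i. orth_proj (V i) ** diag_mat lam = diag_mat lam ** orth_proj (V i)"
    and stable: "no_lowering_relation lam w (\<lambda>i. orth_proj (V i))"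
    using local_minimizer_diagonalized[OF min w] by blast
  let ?P = "\<lambda>i. orth_proj (V i)"
  have Vs: "vec.subspace (V i)" "vec.dim (V i) = d i" for i using V by (auto simp: subspace_families_def)
  note P = adj_orth_proj[OF Vs(1)] orth_proj_idem[OF Vs(1)]
  have lam_eq: "lam a = (\<Sum>i\<in>UNIV. (w i)\<^sup>2 * (norm (?P i *v axis a 1))\<^sup>2)" for a
  proof -
    have "complex_of_real (lam a) = frame_op w V $ a $ a" by (simp add: D diag_mat_def)
    then have "lam a = (\<Sum>i\<in>UNIV. (w i)\<^sup>2 * Re (?P i $ a $ a))"
      by (simp add: complex_eq_iff frame_op_def sum_component)
    moreover have "Re (?P i $ a $ a) = (norm (?P i *v axis a 1))\<^sup>2" for i
    proof -
      have "(norm (?P i *v axis a 1))\<^sup>2 = Re (cinner (?P i *v axis a 1) (?P i *v axis a 1))"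
        by (simp add: cinner_self)
      also have "\<dots> = Re (cinner (?P i *v axis a 1) (axis a 1))"
        using cinner_adj[of "?P i" "?P i *v axis a 1" "axis a 1"] by (simp add: P matrix_vector_mul_assoc)
      also have "cinner (?P i *v axis a 1) (axis a 1) = (\<Sum>b\<in>UNIV. if b = a then ?P i $ a $ a else 0)"
        unfolding cinner_def matrix_vector_axis by (rule sum.cong) (auto simp: axis_def column_def)
      finally show ?thesis by simp
    qed
    ultimately show ?thesis by simp
  qed
  have lam_nonneg: "0 \<le> lam a" for a unfolding lam_eq by (simp add: sum_nonneg)
  have kernel: "?P i $ b $ a = 0" "?P i $ a $ b = 0" if "lam a = 0" for i a b
  proof -
    have "(w i)\<^sup>2 * (norm (?P i *v axis a 1))\<^sup>2 = 0"
      using that unfolding lam_eq by (simp add: sum_nonneg_eq_0_iff)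
    then have "?P i *v axis a 1 = 0" using w[of i] by simp
    then show "?P i $ b $ a = 0" by (simp add: matrix_vector_axis column_def vec_eq_iff)
    then have "adj (?P i) $ a $ b = 0" by simp
    then show "?P i $ a $ b = 0" by (simp only: P)
  qed
  have "invertible (diag_mat lam)"
  proof (rule ccontr)
    assume "\<not> invertible (diag_mat lam)"
    have "\<exists>a. lam a = 0"
    proof (rule ccontr)
      assume "\<nexists>a. lam a = 0"
      then have "diag_mat lam ** diag_mat (\<lambda>a. inverse (lam a)) = mat 1"
        by (auto simp: vec_eq_iff diag_mat_mult_left) (auto simp: diag_mat_def mat_def)
      then show False using \<open>\<not> invertible (diag_mat lam)\<close> invertible_right_inverse by blast
    qed
    then obtain e where e: "lam e = 0" by blast
    have no_relation: "x i = 0"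
      if x: "\<And>i. ?P i *v x i = x i" and rel: "(\<Sum>i\<in>UNIV. (w i)\<^sup>2 *\<^sub>R x i) = 0" for x :: "'m \<Rightarrow> complex ^ 'n" and i
    proof -
      define T :: "'m \<Rightarrow> complex ^ 'n ^ 'n" where "T i = (\<chi> a b. if a = e then cnj (x i $ b) else 0)" for i
      have TP: "T i ** ?P i = T i" for i
      proof -
        have "(T i ** ?P i) $ a $ c = T i $ a $ c" for a c
        proof (cases "a = e")
          case True
          have "x i $ c = (\<Sum>b\<in>UNIV. ?P i $ c $ b * x i $ b)"
            using arg_cong[OF x[of i], of "\<lambda>y. y $ c"] by (simp add: matrix_vector_mult_def)
          then have "cnj (x i $ c) = (\<Sum>b\<in>UNIV. adj (?P i) $ b $ c * cnj (x i $ b))" by simp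
          then show ?thesis by (simp only: P) (simp add: matrix_matrix_mult_def T_def True mult.commute)
        qed (simp add: matrix_matrix_mult_def T_def)
        then show ?thesis by (simp add: vec_eq_iff)
      qed
      have PT: "?P i ** T i = 0" for i
      proof -
        have "(?P i ** T i) $ a $ c = 0" for a c
          unfolding matrix_matrix_mult_def T_def by (simp, rule sum.neutral) (simp add: kernel[OF e])
        then show ?thesis by (simp add: vec_eq_iff)
      qed
      have xlow: "x i $ b = 0" if "lam b = 0" for i b
      proof -
        have "x i $ b = (\<Sum>a\<in>UNIV. ?P i $ b $ a * x i $ a)"
          using arg_cong[OF x[of i], of "\<lambda>y. y $ b"] by (simp add: matrix_vector_mult_def)
        then show ?thesis by (simp add: kernel[OF that])
      qed
      have "strict_lower lam (T i) = T i" for i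
      proof -
        have "strict_lower lam (T i) $ a $ b = T i $ a $ b" for a b
          using xlow[of b i] lam_nonneg[of b] e by (auto simp: strict_lower_nth T_def less_le)
        then show ?thesis by (simp add: vec_eq_iff)
      qed
      moreover have "(\<Sum>i\<in>UNIV. (w i)\<^sup>2 *\<^sub>R T i) = 0"
      proof -
        have "(\<Sum>i\<in>UNIV. (w i)\<^sup>2 *\<^sub>R T i) $ a $ b = (if a = e then cnj ((\<Sum>i\<in>UNIV. (w i)\<^sup>2 *\<^sub>R x i) $ b) else 0)" for a b
          by (simp add: T_def sum_component)
        then show ?thesis by (simp add: rel vec_eq_iff)
      qed
      ultimately have "T i = 0" using stable TP PT unfolding no_lowering_relation_def by blast
      then have "T i $ e $ b = 0" for b by simp
      then show ?thesis by (simp add: T_def vec_eq_iff)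
    qed
    have orth: "?P j ** ?P i = 0" if "j \<noteq> i" for i j
    proof (rule matrix_eq[THEN iffD2], rule allI)
      fix z
      define y where "y = ?P i *v z"
      have Py: "?P i *v y = y" by (simp add: y_def matrix_vector_mul_assoc P)
      \<comment> \<open>the frame operator applied to \<open>y\<close>, moved into the \<open>i\<close>-th summand,
        turns \<open>\<Sum> w\<^sub>k\<^sup>2 P\<^sub>k y\<close> into a relation\<close>
      define x where "x k = ?P k *v y - (if k = i then inverse ((w i)\<^sup>2) *\<^sub>R (diag_mat lam *v y) else 0)" for k
      have "?P i *v (diag_mat lam *v y) = diag_mat lam *v y"
        by (metis Py comm matrix_vector_mul_assoc)
      then have "?P k *v x k = x k" for k
        by (simp add: x_def matrix_vector_mult_diff_distrib matrix_vector_mul_assoc P matrix_vector_scaleR)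
      moreover have "(\<Sum>k\<in>UNIV. (w k)\<^sup>2 *\<^sub>R x k) = 0"
      proof -
        have "(w k)\<^sup>2 *\<^sub>R x k = (w k)\<^sup>2 *\<^sub>R (?P k *v y) - (if k = i then diag_mat lam *v y else 0)" for k
          using w[of i] by (simp add: x_def scaleR_diff_right)
        then have "(\<Sum>k\<in>UNIV. (w k)\<^sup>2 *\<^sub>R x k) = (\<Sum>k\<in>UNIV. (w k)\<^sup>2 *\<^sub>R (?P k *v y)) - diag_mat lam *v y"
          by (simp add: sum_subtractf)
        also have "(\<Sum>k\<in>UNIV. (w k)\<^sup>2 *\<^sub>R (?P k *v y)) = frame_op w V *v y"
          by (simp add: frame_op_def matrix_vector_sum scaleR_matrix_vector)
        finally show ?thesis by (simp add: D)
      qed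
      ultimately have "x j = 0" by (rule no_relation)
      then show "(?P j ** ?P i) *v z = 0 *v z"
        using that by (simp add: x_def y_def matrix_vector_mul_assoc)
    qed
    define R where "R = (\<Sum>i\<in>UNIV. ?P i)"
    have adjR: "adj R = R" by (simp add: R_def adj_sum P)
    have RR: "R ** R = R"
    proof -
      have "R ** R = (\<Sum>i\<in>UNIV. \<Sum>j\<in>UNIV. ?P i ** ?P j)"
        unfolding R_def by (simp add: matrix_sum_left matrix_sum_right) (rule sum.swap)
      also have "\<dots> = (\<Sum>i\<in>UNIV. \<Sum>j\<in>UNIV. if j = i then ?P i else 0)"
        by (intro sum.cong refl) (auto simp: orth P)
      finally show ?thesis by (simp add: R_def)
    qed
    have "(mat 1 - R) \<bullet> (mat 1 - R) = Re (trace (mat 1 - R))"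
      by (simp add: inner_matrix adj_diff adjR matrix_algebra RR)
    also have "\<dots> = real CARD('n) - real (\<Sum>i\<in>UNIV. d i)"
      by (simp add: trace_diff R_def trace_sum trace_orth_proj Vs) (simp add: trace_def mat_def)
    also have "\<dots> \<le> 0" using dims by (simp del: of_nat_sum)
    finally have "mat 1 - R = 0" by (metis inner_ge_zero inner_eq_zero_iff order_antisym)
    then have "R = mat 1" by simp
    then have "R $ e $ e = 1" by (simp add: mat_def)
    moreover have "R $ e $ e = 0" by (simp add: R_def sum_component kernel[OF e])
    ultimately show False by simp
  qed
  then show ?thesis
    unfolding S using Q unitary_invertible unitary_adj by (intro invertible_mult) blast+
qed

section \<open>Spectra and the theorem\<close>

text \<open>Constant polynomials as entries, so that multiplicativity of determinants over the polynomial ring gives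
  similarity invariance of \<open>charpoly\<close>.\<close>

definition const_mat :: "complex ^ 'n ^ 'n \<Rightarrow> complex poly ^ 'n ^ 'n" where
  "const_mat A = (\<chi> i j. [:A $ i $ j:])"

lemma const_poly_sum: "[:\<Sum>i\<in>I. f i:] = (\<Sum>i\<in>I. [:f i:])"
proof (induction I rule: infinite_finite_induct)
  case (insert i I)
  have "[:f i + sum f I:] = [:f i:] + [:sum f I:]" by simp
  then show ?case by (simp only: sum.insert[OF insert(1,2)] insert.IH)
qed simp_all

lemma const_mat_mult: "const_mat (A ** B) = const_mat A ** const_mat B"
  by (simp add: const_mat_def matrix_matrix_mult_def vec_eq_iff const_poly_sum mult.commute)

lemma const_mat_1: "const_mat (mat 1) = mat 1"
  by (simp add: const_mat_def mat_def vec_eq_iff one_pCons)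

lemma charpoly_similar:
  fixes U V A :: "complex ^ 'n ^ 'n"
  assumes "U ** V = mat 1"
  shows "charpoly (U ** A ** V) = charpoly A"
proof -
  let ?X = "mat [:0, 1:] :: complex poly ^ 'n ^ 'n"
  have UV: "const_mat U ** const_mat V = mat 1"
    using const_mat_mult[of U V] by (simp add: assms const_mat_1)
  have X: "M ** ?X = ?X ** M" for M :: "complex poly ^ 'n ^ 'n"
  proof -
    have "(M ** ?X) $ i $ j = [:0, 1:] * M $ i $ j" for i j
    proof -
      have "(M ** ?X) $ i $ j = (\<Sum>k\<in>UNIV. if k = j then [:0, 1:] * M $ i $ j else 0)"
        unfolding matrix_matrix_mult_def mat_def vec_lambda_beta by (rule sum.cong) (auto simp: mult.commute)
      then show ?thesis by simp
    qed
    moreover have "(?X ** M) $ i $ j = [:0, 1:] * M $ i $ j" for i j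
    proof -
      have "(?X ** M) $ i $ j = (\<Sum>k\<in>UNIV. if k = i then [:0, 1:] * M $ i $ j else 0)"
        unfolding matrix_matrix_mult_def mat_def vec_lambda_beta by (rule sum.cong) auto
      then show ?thesis by simp
    qed
    ultimately show ?thesis by (simp add: vec_eq_iff)
  qed
  have "const_mat U ** (?X - const_mat A) ** const_mat V = ?X ** (const_mat U ** const_mat V) - const_mat (U ** A ** V)"
    by (simp add: matrix_diff_ldistrib matrix_diff_rdistrib const_mat_mult matrix_mul_assoc X)
  also have "\<dots> = ?X - const_mat (U ** A ** V)" by (simp add: UV)
  finally have "charpoly (U ** A ** V) = det (const_mat U ** (?X - const_mat A) ** const_mat V)"
    by (simp add: charpoly_def const_mat_def)
  also have "\<dots> = det (const_mat U ** const_mat V) * det (?X - const_mat A)" by (simp add: det_mul)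
  also have "\<dots> = det (?X - const_mat A)" by (simp add: UV)
  finally show ?thesis by (simp only: charpoly_def const_mat_def)
qed

lemma global_imp_local_minimizer: "global_minimizer d w W \<Longrightarrow> local_minimizer d w W"
  unfolding global_minimizer_def local_minimizer_def is_arg_min_def
  by (auto intro!: exI[of _ 1] simp: not_less)

theorem theorem4p3p2:
  fixes d :: "'m::finite \<Rightarrow> nat" and w :: "'m \<Rightarrow> real"
  assumes "normalized_pair TYPE('n::finite) d w"
  shows "(\<forall>(W :: 'm \<Rightarrow> (complex ^ 'n) set) (V :: 'm \<Rightarrow> (complex ^ 'n) set).
            global_minimizer d w W \<longrightarrow> global_minimizer d w V \<longrightarrow>
            spectrum_mset (frame_op w W) = spectrum_mset (frame_op w V))
       \<and> (\<forall>W :: 'm \<Rightarrow> (complex ^ 'n) set.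
            local_minimizer d w W \<longrightarrow>
            W \<in> fusion_frames d w \<and> global_minimizer d w W)"
proof (intro conjI allI impI)
  have w: "\<And>i. w i > 0" and dims: "CARD('n) \<le> (\<Sum>i\<in>UNIV. d i)"
    using assms by (auto simp: normalized_pair_def)
  have sub: "vec.subspace (W i)" if "W \<in> subspace_families d" for W :: "'m \<Rightarrow> (complex ^ 'n) set" and i
    using that by (simp add: subspace_families_def)
  {
    fix W V :: "'m \<Rightarrow> (complex ^ 'n) set"
    assume min: "local_minimizer d w W" and V: "V \<in> subspace_families d"
    let ?S = "frame_op w W" and ?T = "frame_op w V"
    have W: "W \<in> subspace_families d" using min by (simp add: local_minimizer_def)
    obtain U where U: "adj U ** U = mat 1" and le: "?S \<bullet> ?S \<le> ?T \<bullet> (U ** ?S ** adj U)"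
      by (rule local_minimizer_comparison[OF min w V])
    have "(?T - U ** ?S ** adj U) \<bullet> (?T - U ** ?S ** adj U) = ?T \<bullet> ?T - 2 * (?T \<bullet> (U ** ?S ** adj U)) + ?S \<bullet> ?S"
      by (simp add: inner_diff_left inner_diff_right inner_unitary_conj[OF U] inner_commute)
    also have "\<dots> \<le> ffp w V - ffp w W"
      using le by (simp add: ffp_eq_inner[OF sub[OF W]] ffp_eq_inner[OF sub[OF V]])
    finally have "(?T - U ** ?S ** adj U) \<bullet> (?T - U ** ?S ** adj U) \<le> ffp w V - ffp w W" .
    with U have "\<exists>U. adj U ** U = mat 1 \<and>
        (?T - U ** ?S ** adj U) \<bullet> (?T - U ** ?S ** adj U) \<le> ffp w V - ffp w W" by blast
  } note cmp = this
  {
    fix W :: "'m \<Rightarrow> (complex ^ 'n) set"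
    assume min: "local_minimizer d w W"
    then have W: "W \<in> subspace_families d" by (simp add: local_minimizer_def)
    then show "W \<in> fusion_frames d w"
      using local_minimizer_invertible[OF min w dims] by (simp add: fusion_frames_def)
    have "ffp w W \<le> ffp w V" if V: "V \<in> subspace_families d" for V :: "'m \<Rightarrow> (complex ^ 'n) set"
      using cmp[OF min V] inner_ge_zero by (metis diff_ge_0_iff_ge order_trans)
    then show "global_minimizer d w W"
      using W by (auto simp: global_minimizer_def is_arg_min_def not_less)
  }
  fix W V :: "'m \<Rightarrow> (complex ^ 'n) set"
  assume min: "global_minimizer d w W" "global_minimizer d w V"
  then have "V \<in> subspace_families d" "ffp w V \<le> ffp w W"
    by (auto simp: global_minimizer_def is_arg_min_def not_less)
  then obtain U where U: "adj U ** U = mat 1"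
    and "(frame_op w V - U ** frame_op w W ** adj U) \<bullet> (frame_op w V - U ** frame_op w W ** adj U) \<le> 0"
    using cmp[OF global_imp_local_minimizer[OF min(1)], of V] by force
  then have "frame_op w V = U ** frame_op w W ** adj U"
    by (metis inner_ge_zero inner_eq_zero_iff order_antisym right_minus_eq)
  then show "spectrum_mset (frame_op w W) = spectrum_mset (frame_op w V)"
    by (simp add: spectrum_mset_def charpoly_similar[OF unitary_commute[OF U]])
qed


end
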